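(* Let $M\ge 1$. For all sizes $k_1,\dots,k_M$, $L_p^{\mathrm I},L_p^{\mathrm{II}}$ ($1\le p\le M-1$), $L_M$, all variables $\bm u^{(p)},\bm v_{\mathrm I}^{(p)},\bm v_{\mathrm{II}}^{(p)},\bm v^{(M)}$ and every admissible colouring $\bm I$, the trigonometric $\mathfrak{gl}_{M+1}$ partition function $\psi$ equals the extended trigonometric weight function $W$: $$\psi\big(\bm u^{(1)},\dots,\bm u^{(M)}\,\big|\,\{\bm v_{\mathrm I}^{(1)},\bm v_{\mathrm{II}}^{(1)}\},\dots,\{\bm v_{\mathrm I}^{(M-1)},\bm v_{\mathrm{II}}^{(M-1)}\},\bm v^{(M)}\,\big|\,\bm I\big)=W\big(\bm u^{(1)},\dots,\bm u^{(M)}\,\big|\,\{\bm v_{\mathrm I}^{(1)},\bm v_{\mathrm{II}}^{(1)}\},\dots,\{\bm v_{\mathrm I}^{(M-1)},\bm v_{\mathrm{II}}^{(M-1)}\},\bm v^{(M)}\,\big|\,\bm I\big)$$ (an identity of rational functions in the variables and $q$).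
   Context: **Sizes, variables, coordinates.** Fix $M\ge1$ and nonnegative integers $k_1,\dots,k_M$, $L_p^{\mathrm I},L_p^{\mathrm{II}}$ ($1\le p\le M-1$), $L_M$; $q$ is a nonzero parameter. There are ordered lists of variables $\bm u^{(p)}=(u^{(p)}_1,\dots,u^{(p)}_{k_p})$ ($1\le p\le M$), $\bm v^{(p)}_{\mathrm I}=(v^{(p)}_{\mathrm I,1},\dots,v^{(p)}_{\mathrm I,L^{\mathrm I}_p})$, $\bm v^{(p)}_{\mathrm{II}}=(v^{(p)}_{\mathrm{II},1},\dots,v^{(p)}_{\mathrm{II},L^{\mathrm{II}}_p})$ ($1\le p\le M-1$), $\bm v^{(M)}=(v^{(M)}_1,\dots,v^{(M)}_{L_M})$. The sizes are the lengths of the lists and are omitted from the notation of functions. Order the $v$-variables as $\bm v_{\mathrm I}^{(1)},\dots,\bm v_{\mathrm I}^{(M-1)},\bm v^{(M)},\bm v_{\mathrm{II}}^{(M-1)},\dots,\bm v_{\mathrm{II}}^{(1)}$; the $c$-th variable in this list defines the coordinate $c\in\{1,2,\dots\}$. A coordinate is in layer $p<M$ if its variable belongs to $\bm v_{\mathrm I}^{(p)}$ or $\bm v_{\mathrm{II}}^{(p)}$, and in layer $M$ if it belongs to $\bm v^{(M)}$. **Colourings.** A colouring assigns to each coordinate $c$ of layer $p$ a colour $i_c^{(p)}\in\{1,\dots,p+1\}$. For $1\le j\le M$, let $\widehat{\bm I}^{(j)}$ be the set of coordinates in layers $j,\dots,M$ and $\bm I^{(j)}=\bm I^{(j)}_{k_j}\subset\widehat{\bm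 I}^{(j)}$ the subset of those with colour in $\{1,\dots,j\}$. The colouring is admissible if $|\bm I^{(j)}|=k_j$ for all $j$; write $\bm I^{(j)}=\{I^{(j)}_1<\dots<I^{(j)}_{k_j}\}$ and $\bm I=(\bm I^{(1)},\dots,\bm I^{(M)})$ (this determines the colouring). For $1\le j\le M-1$, the elements of $\widehat{\bm I}^{(j)}$ with colour in $\{1,\dots,j+1\}$ number $k_{j+1}+L_j^{\mathrm I}+L_j^{\mathrm{II}}$; relabel them in increasing order by $1,2,\dots,k_{j+1}+L_j^{\mathrm I}+L_j^{\mathrm{II}}$, and let $\widetilde{\bm I}^{(j)}=\{\widetilde I^{(j)}_1<\dots<\widetilde I^{(j)}_{k_j}\}$ be the image of $\bm I^{(j)}$. **Column variables.** For $p<M$, let $m_i(\bm v^{(p)}_{\mathrm I}|\bm u^{(p+1)}|\bm v^{(p)}_{\mathrm{II}})$ be the $i$-th entry of the concatenated ordered list $(\bm v^{(p)}_{\mathrm I},\bm u^{(p+1)},\bm v^{(p)}_{\mathrm{II}})$. **Partition function.** Put $N_p=L_p^{\mathrm I}+k_{p+1}+L_p^{\mathrm{II}}$ for $p<M$, $N_M=L_M$. Layer $p$ is a grid with rows $r=1,\dots,k_p$ (top to bottom; row $r$ carries $u^{(p)}_r$) and columns $s=1,\dots,N_p$ (left to right; column $s$ carries $m_s(\bm v^{(p)}_{\mathrm I}|\bm u^{(p+1)}|\bm v^{(p)}_{\mathrm{II}})$ if $p<M$, and $v^{(M)}_s$ if $p=M$). Edges carry colours in $\{1,\dots,M+1\}$: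 horizontal $h^{(p)}_{r,s}$ ($0\le s\le N_p$) and vertical edges with colours $t^{(p)}_{r,s}$ ($0\le r\le k_p$); vertex $(r,s)$ has left, right, bottom, top edges $h^{(p)}_{r,s-1},h^{(p)}_{r,s},t^{(p)}_{r,s},t^{(p)}_{r-1,s}$. Boundary conditions: $h^{(p)}_{r,N_p}=p+1$ for all $r$; $t^{(p)}_{k_p,s}=p+1$ for all $s$ as bottom boundary colours; $h^{(1)}_{r,0}=1$; $h^{(p+1)}_{r,0}=t^{(p)}_{0,L_p^{\mathrm I}+r}$ for $1\le r\le k_{p+1}$, $p<M$; and the top edge $t^{(p)}_{0,s}$ of a column carrying a $v$-variable has the colour of the corresponding coordinate. A vertex with left, bottom, right, top colours $(a,b,c,d)$, row variable $u$ and column variable $v$ has weight equal to the coefficient of $e_c\otimes e_d$ in $R(u,v)(e_a\otimes e_b)$, where $$R(u,v)=\sum_i(u-qv)E_{ii}\otimes E_{ii}+\sum_{i>j}q(u-v)E_{ii}\otimes E_{jj}+\sum_{i<j}(u-v)E_{ii}\otimes E_{jj}+\sum_{i>j}(1-q)u\,E_{ij}\otimes E_{ji}+\sum_{i<j}(1-q)v\,E_{ij}\otimes E_{ji},$$ with $1\le i,j\le M+1$ and $E_{ij}e_k=\delta_{jk}e_i$. Then $\psi$ is the sum over all edge colourings satisfying the boundary conditions of the product of the weights of all vertices in all layers. **Extended trigonometric weight function.** With $\bm u^{(p)}_{\sigma_p}=(u^{(p)}_{\sigma_p(1)},\dots,u^{(p)}_{\sigma_p(k_p)})$, $m_i^{(p)}:=m_i(\bm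 v^{(p)}_{\mathrm I}|\bm u^{(p+1)}_{\sigma_{p+1}}|\bm v^{(p)}_{\mathrm{II}})$ and $\ell:=L^{\mathrm I}_1+\dots+L^{\mathrm I}_{M-1}$, $$W=\sum_{\sigma_1\in S_{k_1}}\cdots\sum_{\sigma_M\in S_{k_M}}\prod_{p=1}^{M-1}\Bigg\{\prod_{a=1}^{k_p}\Bigg(\prod_{i=1}^{\widetilde I^{(p)}_a-1}\big(u^{(p)}_{\sigma_p(a)}-m^{(p)}_i\big)\,(1-q)u^{(p)}_{\sigma_p(a)}\prod_{i=\widetilde I^{(p)}_a+1}^{N_p}\big(u^{(p)}_{\sigma_p(a)}-q\,m^{(p)}_i\big)\Bigg)\prod_{1\le a<b\le k_p}\frac{q u^{(p)}_{\sigma_p(a)}-u^{(p)}_{\sigma_p(b)}}{u^{(p)}_{\sigma_p(a)}-u^{(p)}_{\sigma_p(b)}}\Bigg\}$$ $$\times\prod_{a=1}^{k_M}\Bigg(\prod_{i=1}^{I^{(M)}_a-1-\ell}\big(u^{(M)}_{\sigma_M(a)}-v^{(M)}_i\big)\,(1-q)u^{(M)}_{\sigma_M(a)}\prod_{i=I^{(M)}_a+1-\ell}^{L_M}\big(u^{(M)}_{\sigma_M(a)}-q v^{(M)}_i\big)\Bigg)\prod_{1\le a<b\le k_M}\frac{q u^{(M)}_{\sigma_M(a)}-u^{(M)}_{\sigma_M(b)}}{u^{(M)}_{\sigma_M(a)}-u^{(M)}_{\sigma_M(b)}}.$$ *)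

theory Defs
  imports Complex_Main "HOL-Library.FuncSet" "HOL-Combinatorics.Permutations"
begin

text \<open>
  Indices are 1-based throughout. The sizes are \<open>k p\<close> for \<open>1 \<le> p \<le> M\<close>, \<open>LI p\<close> and \<open>LII p\<close> for
  \<open>1 \<le> p < M\<close>, and \<open>LM\<close>. The variables are \<open>u p r\<close> (\<open>1 \<le> r \<le> k p\<close>), \<open>vI p s\<close> (\<open>1 \<le> s \<le> LI p\<close>),
  \<open>vII p s\<close> (\<open>1 \<le> s \<le> LII p\<close>) and \<open>vM s\<close> (\<open>1 \<le> s \<le> LM\<close>). Values of these functions outside the
  stated ranges are never used.
\<close>

section \<open>Coordinates and colourings\<close>

text \<open>
  The \<open>v\<close>-variables are ordered as
  \<open>vI 1, \<dots>, vI (M - 1), vM, vII (M - 1), \<dots>, vII 1\<close>. In this order \<open>vI p s\<close> has position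
  \<open>offI LI p + s\<close>, \<open>vM s\<close> has position \<open>offI LI M + s\<close>, and \<open>vII p s\<close> has position
  \<open>offII M LI LII LM p + s\<close>. The number \<open>\<ell>\<close> of the weight function is \<open>offI LI M\<close>.
\<close>

definition offI :: "(nat \<Rightarrow> nat) \<Rightarrow> nat \<Rightarrow> nat" where
  "offI LI p = (\<Sum>j\<in>{1..<p}. LI j)"

definition offII :: "nat \<Rightarrow> (nat \<Rightarrow> nat) \<Rightarrow> (nat \<Rightarrow> nat) \<Rightarrow> nat \<Rightarrow> nat \<Rightarrow> nat" where
  "offII M LI LII LM p = offI LI M + LM + (\<Sum>j\<in>{p<..<M}. LII j)"

definition layer_coords ::
  "nat \<Rightarrow> (nat \<Rightarrow> nat) \<Rightarrow> (nat \<Rightarrow> nat) \<Rightarrow> nat \<Rightarrow> nat \<Rightarrow> nat set" where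
  "layer_coords M LI LII LM p =
     (if p < M then {offI LI p + s | s. s \<in> {1..LI p}} \<union> {offII M LI LII LM p + s | s. s \<in> {1..LII p}}
      else {offI LI M + s | s. s \<in> {1..LM}})"

definition is_colouring ::
  "nat \<Rightarrow> (nat \<Rightarrow> nat) \<Rightarrow> (nat \<Rightarrow> nat) \<Rightarrow> nat \<Rightarrow> (nat \<Rightarrow> nat) \<Rightarrow> bool" where
  "is_colouring M LI LII LM col \<longleftrightarrow>
     (\<forall>p\<in>{1..M}. \<forall>c\<in>layer_coords M LI LII LM p. col c \<in> {1..p + 1})"

definition Ihat :: "nat \<Rightarrow> (nat \<Rightarrow> nat) \<Rightarrow> (nat \<Rightarrow> nat) \<Rightarrow> nat \<Rightarrow> nat \<Rightarrow> nat set" where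
  "Ihat M LI LII LM j = (\<Union>p\<in>{j..M}. layer_coords M LI LII LM p)"

definition Iset ::
  "nat \<Rightarrow> (nat \<Rightarrow> nat) \<Rightarrow> (nat \<Rightarrow> nat) \<Rightarrow> nat \<Rightarrow> (nat \<Rightarrow> nat) \<Rightarrow> nat \<Rightarrow> nat set" where
  "Iset M LI LII LM col j = {c \<in> Ihat M LI LII LM j. col c \<in> {1..j}}"

definition admissible ::
  "nat \<Rightarrow> (nat \<Rightarrow> nat) \<Rightarrow> (nat \<Rightarrow> nat) \<Rightarrow> (nat \<Rightarrow> nat) \<Rightarrow> nat \<Rightarrow> (nat \<Rightarrow> nat) \<Rightarrow> bool" where
  "admissible M k LI LII LM col \<longleftrightarrow>
     is_colouring M LI LII LM col \<and> (\<forall>j\<in>{1..M}. card (Iset M LI LII LM col j) = k j)"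

definition nth_smallest :: "nat set \<Rightarrow> nat \<Rightarrow> nat" where
  "nth_smallest A a = sorted_list_of_set A ! (a - 1)"

text \<open>The increasing relabelling by \<open>1, 2, \<dots>\<close> of the elements of \<open>Ihat j\<close> with colour in
  \<open>{1..j + 1}\<close>, and the image of \<open>Iset j\<close> under it.\<close>

definition relabel ::
  "nat \<Rightarrow> (nat \<Rightarrow> nat) \<Rightarrow> (nat \<Rightarrow> nat) \<Rightarrow> nat \<Rightarrow> (nat \<Rightarrow> nat) \<Rightarrow> nat \<Rightarrow> nat \<Rightarrow> nat" where
  "relabel M LI LII LM col j c =
     card {d \<in> Ihat M LI LII LM j. col d \<in> {1..j + 1} \<and> d \<le> c}"

definition Itilde ::
  "nat \<Rightarrow> (nat \<Rightarrow> nat) \<Rightarrow> (nat \<Rightarrow> nat) \<Rightarrow> nat \<Rightarrow> (nat \<Rightarrow> nat) \<Rightarrow> nat \<Rightarrow> nat set" where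
  "Itilde M LI LII LM col j = relabel M LI LII LM col j ` Iset M LI LII LM col j"

section \<open>Column variables\<close>

definition ncols :: "nat \<Rightarrow> (nat \<Rightarrow> nat) \<Rightarrow> (nat \<Rightarrow> nat) \<Rightarrow> (nat \<Rightarrow> nat) \<Rightarrow> nat \<Rightarrow> nat \<Rightarrow> nat" where
  "ncols M k LI LII LM p = (if p < M then LI p + k (p + 1) + LII p else LM)"

text \<open>The \<open>i\<close>-th entry of the concatenated list \<open>(vI p, u (p + 1), vII p)\<close>, for \<open>p < M\<close>.\<close>

definition mcol ::
  "(nat \<Rightarrow> nat) \<Rightarrow> (nat \<Rightarrow> nat) \<Rightarrow> (nat \<Rightarrow> nat \<Rightarrow> 'a) \<Rightarrow> (nat \<Rightarrow> nat \<Rightarrow> 'a) \<Rightarrow> (nat \<Rightarrow> nat \<Rightarrow> 'a)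
     \<Rightarrow> nat \<Rightarrow> nat \<Rightarrow> 'a" where
  "mcol k LI vI u vII p i =
     (if i \<le> LI p then vI p i
      else if i \<le> LI p + k (p + 1) then u (p + 1) (i - LI p)
      else vII p (i - LI p - k (p + 1)))"

definition colvar ::
  "nat \<Rightarrow> (nat \<Rightarrow> nat) \<Rightarrow> (nat \<Rightarrow> nat) \<Rightarrow> (nat \<Rightarrow> nat \<Rightarrow> 'a) \<Rightarrow> (nat \<Rightarrow> nat \<Rightarrow> 'a) \<Rightarrow> (nat \<Rightarrow> nat \<Rightarrow> 'a)
     \<Rightarrow> (nat \<Rightarrow> 'a) \<Rightarrow> nat \<Rightarrow> nat \<Rightarrow> 'a" where
  "colvar M k LI u vI vII vM p s = (if p < M then mcol k LI vI u vII p s else vM s)"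

section \<open>The R-matrix\<close>

text \<open>\<open>Eunit i j c a\<close> is the coefficient of \<open>e\<^sub>c\<close> in \<open>E\<^sub>i\<^sub>j e\<^sub>a\<close>. \<open>Rcoeff n q u v a b c d\<close> is the
  coefficient of \<open>e\<^sub>c \<otimes> e\<^sub>d\<close> in \<open>R(u,v) (e\<^sub>a \<otimes> e\<^sub>b)\<close>, with colours \<open>1, \<dots>, n\<close>.\<close>

definition Eunit :: "nat \<Rightarrow> nat \<Rightarrow> nat \<Rightarrow> nat \<Rightarrow> 'a::field" where
  "Eunit i j c a = (if a = j \<and> c = i then 1 else 0)"

definition Rcoeff :: "nat \<Rightarrow> 'a::field \<Rightarrow> 'a \<Rightarrow> 'a \<Rightarrow> nat \<Rightarrow> nat \<Rightarrow> nat \<Rightarrow> nat \<Rightarrow> 'a" where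
  "Rcoeff n q u v a b c d =
     (\<Sum>i\<in>{1..n}. (u - q * v) * (Eunit i i c a * Eunit i i d b))
   + (\<Sum>(i, j)\<in>{(i, j) \<in> {1..n} \<times> {1..n}. i > j}. q * (u - v) * (Eunit i i c a * Eunit j j d b))
   + (\<Sum>(i, j)\<in>{(i, j) \<in> {1..n} \<times> {1..n}. i < j}. (u - v) * (Eunit i i c a * Eunit j j d b))
   + (\<Sum>(i, j)\<in>{(i, j) \<in> {1..n} \<times> {1..n}. i > j}. (1 - q) * u * (Eunit i j c a * Eunit j i d b))
   + (\<Sum>(i, j)\<in>{(i, j) \<in> {1..n} \<times> {1..n}. i < j}. (1 - q) * v * (Eunit i j c a * Eunit j i d b))"

section \<open>The partition function\<close>

text \<open>An edge colouring of all layers is a pair \<open>(h, t)\<close>, with \<open>h (p, r, s)\<close> and \<open>t (p, r, s)\<close> the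
  colours of the horizontal and vertical edges of layer \<open>p\<close>.\<close>

definition hedges ::
  "nat \<Rightarrow> (nat \<Rightarrow> nat) \<Rightarrow> (nat \<Rightarrow> nat) \<Rightarrow> (nat \<Rightarrow> nat) \<Rightarrow> nat \<Rightarrow> (nat \<times> nat \<times> nat) set" where
  "hedges M k LI LII LM = (SIGMA p:{1..M}. {1..k p} \<times> {0..ncols M k LI LII LM p})"

definition tedges ::
  "nat \<Rightarrow> (nat \<Rightarrow> nat) \<Rightarrow> (nat \<Rightarrow> nat) \<Rightarrow> (nat \<Rightarrow> nat) \<Rightarrow> nat \<Rightarrow> (nat \<times> nat \<times> nat) set" where
  "tedges M k LI LII LM = (SIGMA p:{1..M}. {0..k p} \<times> {1..ncols M k LI LII LM p})"

definition edge_colourings ::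
  "nat \<Rightarrow> (nat \<Rightarrow> nat) \<Rightarrow> (nat \<Rightarrow> nat) \<Rightarrow> (nat \<Rightarrow> nat) \<Rightarrow> nat
     \<Rightarrow> ((nat \<times> nat \<times> nat \<Rightarrow> nat) \<times> (nat \<times> nat \<times> nat \<Rightarrow> nat)) set" where
  "edge_colourings M k LI LII LM =
     (hedges M k LI LII LM \<rightarrow>\<^sub>E {1..M + 1}) \<times> (tedges M k LI LII LM \<rightarrow>\<^sub>E {1..M + 1})"

definition boundary ::
  "nat \<Rightarrow> (nat \<Rightarrow> nat) \<Rightarrow> (nat \<Rightarrow> nat) \<Rightarrow> (nat \<Rightarrow> nat) \<Rightarrow> nat \<Rightarrow> (nat \<Rightarrow> nat)
     \<Rightarrow> (nat \<times> nat \<times> nat \<Rightarrow> nat) \<Rightarrow> (nat \<times> nat \<times> nat \<Rightarrow> nat) \<Rightarrow> bool" where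
  "boundary M k LI LII LM col h t \<longleftrightarrow>
     (\<forall>p\<in>{1..M}. \<forall>r\<in>{1..k p}. h (p, r, ncols M k LI LII LM p) = p + 1) \<and>
     (\<forall>p\<in>{1..M}. \<forall>s\<in>{1..ncols M k LI LII LM p}. t (p, k p, s) = p + 1) \<and>
     (\<forall>r\<in>{1..k 1}. h (1, r, 0) = 1) \<and>
     (\<forall>p\<in>{1..<M}. \<forall>r\<in>{1..k (p + 1)}. h (p + 1, r, 0) = t (p, 0, LI p + r)) \<and>
     (\<forall>p\<in>{1..<M}. \<forall>s\<in>{1..LI p}. t (p, 0, s) = col (offI LI p + s)) \<and>
     (\<forall>p\<in>{1..<M}. \<forall>s\<in>{1..LII p}.
        t (p, 0, LI p + k (p + 1) + s) = col (offII M LI LII LM p + s)) \<and>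
     (\<forall>s\<in>{1..LM}. t (M, 0, s) = col (offI LI M + s))"

definition partition_function ::
  "nat \<Rightarrow> (nat \<Rightarrow> nat) \<Rightarrow> (nat \<Rightarrow> nat) \<Rightarrow> (nat \<Rightarrow> nat) \<Rightarrow> nat \<Rightarrow> 'a::field
     \<Rightarrow> (nat \<Rightarrow> nat \<Rightarrow> 'a) \<Rightarrow> (nat \<Rightarrow> nat \<Rightarrow> 'a) \<Rightarrow> (nat \<Rightarrow> nat \<Rightarrow> 'a) \<Rightarrow> (nat \<Rightarrow> 'a)
     \<Rightarrow> (nat \<Rightarrow> nat) \<Rightarrow> 'a" where
  "partition_function M k LI LII LM q u vI vII vM col =
     (\<Sum>(h, t)\<in>{(h, t) \<in> edge_colourings M k LI LII LM. boundary M k LI LII LM col h t}.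
        \<Prod>p\<in>{1..M}. \<Prod>r\<in>{1..k p}. \<Prod>s\<in>{1..ncols M k LI LII LM p}.
          Rcoeff (M + 1) q (u p r) (colvar M k LI u vI vII vM p s)
            (h (p, r, s - 1)) (t (p, r, s)) (h (p, r, s)) (t (p, r - 1, s)))"

section \<open>The extended trigonometric weight function\<close>

text \<open>The summation variable \<open>\<sigma>\<close> is the tuple \<open>(\<sigma>\<^sub>1, \<dots>, \<sigma>\<^sub>M)\<close>, and \<open>us\<close> is the
  family of permuted lists of \<open>u\<close>-variables. Layers \<open>p < M\<close> use the
  relabelled positions \<open>Itilde p\<close>, the top layer uses \<open>Iset M\<close> shifted by \<open>\<ell>\<close>. The
  denominators are nonzero precisely when each list \<open>u p 1, \<dots>, u p (k p)\<close> is pairwise distinct.\<close>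

definition weight_function ::
  "nat \<Rightarrow> (nat \<Rightarrow> nat) \<Rightarrow> (nat \<Rightarrow> nat) \<Rightarrow> (nat \<Rightarrow> nat) \<Rightarrow> nat \<Rightarrow> 'a::field
     \<Rightarrow> (nat \<Rightarrow> nat \<Rightarrow> 'a) \<Rightarrow> (nat \<Rightarrow> nat \<Rightarrow> 'a) \<Rightarrow> (nat \<Rightarrow> nat \<Rightarrow> 'a) \<Rightarrow> (nat \<Rightarrow> 'a)
     \<Rightarrow> (nat \<Rightarrow> nat) \<Rightarrow> 'a" where
  "weight_function M k LI LII LM q u vI vII vM col =
     (\<Sum>\<sigma>\<in>(\<Pi>\<^sub>E p\<in>{1..M}. {\<pi>. \<pi> permutes {1..k p}}).
        let us = (\<lambda>p a. u p (\<sigma> p a));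
            m = mcol k LI vI us vII;
            It = (\<lambda>p a. nth_smallest (Itilde M LI LII LM col p) a);
            IM = (\<lambda>a. nth_smallest (Iset M LI LII LM col M) a);
            l = offI LI M
        in
          (\<Prod>p\<in>{1..M - 1}.
             (\<Prod>a\<in>{1..k p}.
                (\<Prod>i\<in>{1..It p a - 1}. us p a - m p i)
                * ((1 - q) * us p a)
                * (\<Prod>i\<in>{It p a + 1..ncols M k LI LII LM p}. us p a - q * m p i))
             * (\<Prod>(a, b)\<in>{(a, b) \<in> {1..k p} \<times> {1..k p}. a < b}.
                  (q * us p a - us p b) / (us p a - us p b)))
          * (\<Prod>a\<in>{1..k M}.
               (\<Prod>i\<in>{1..IM a - 1 - l}. us M a - vM i)
               * ((1 - q) * us M a)
               * (\<Prod>i\<in>{IM a + 1 - l..LM}. us M a - q * vM i))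
          * (\<Prod>(a, b)\<in>{(a, b) \<in> {1..k M} \<times> {1..k M}. a < b}.
               (q * us M a - us M b) / (us M a - us M b)))"

end

theory Submission
  imports Defs "HOL-Combinatorics.Multiset_Permutations" "HOL-Computational_Algebra.Polynomial"
begin

text \<open>
  A single layer sends a family \<open>F\<close> of functions of a list of row variables, indexed by the words of
  left boundary colours, to such a family for the column variables and the top colours. By the
  Yang-Baxter equation it preserves the exchange relation
  \<open>F(\<dots>, w, v, \<dots>) (v - q w) = F(\<dots>, v, w, \<dots>) R(v, w)\<close>, and its output is symmetric in the row variables.
  Peel off the first column, with variable \<open>v\<close> and top colour \<open>c\<close>. If \<open>c\<close> is the bottom colour, the
  column is frozen. Otherwise the output is a polynomial in \<open>v\<close> of degree less than the number of
  rows. At \<open>v = z\<close> for a row variable \<open>z\<close>, move \<open>z\<close> to the bottom row by symmetry: there \<open>R(z, z)\<close>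
  is a multiple of the flip, the rest of that row freezes, and the remaining column carries \<open>z\<close> through
  the variables of \<open>F\<close> by the exchange relation. Lagrange interpolation at the row variables then
  expresses the layer as a sum over permutations, and iterating over the layers gives the weight
  function. The symmetry argument divides by \<open>x - q y\<close>, so it requires generic \<open>q\<close>; the general case
  follows since both sides are polynomials in \<open>q\<close>.
\<close>

section \<open>The Yang-Baxter equation\<close>

text \<open>Interpolation in \<open>v\<close> has as many nodes as there are rows, so the degree
  must be strictly smaller than this number. The bound rests on the colours: a layer with boundary
  colour \<open>P\<close> receives only colours below \<open>P\<close> from the left, and then the
  change of colour along a turning column costs one power of \<open>v\<close>. For this reason a
  support condition is carried through the induction over layers next to the exchange relation. The
  factors of the weight function come out of a quotient. Carrying \<open>z\<close> past another row
  variable \<open>b\<close> produces \<open>b - q * z\<close>, the Lagrange denominator is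
  \<open>b - z\<close>, and the quotient equals \<open>(q * z - b) / (z - b)\<close>. Rows are used
  up in the order in which columns turn, so the terms are indexed by orderings of the row variables,
  and the colours other than \<open>P\<close>, read from left to right, form the word at which
  \<open>F\<close> is evaluated. These orderings permute the column variables of the layer that
  produced \<open>F\<close>, which is how the permutations of neighbouring layers become coupled.
  The exceptional \<open>q\<close> are ratios of row variables of one layer, hence finite in number,
  and the denominators of the weight function do not contain \<open>q\<close>.\<close>

text \<open>Left, bottom, right and top colours, in this order.\<close>

definition wt :: "'a::field \<Rightarrow> 'a \<Rightarrow> 'a \<Rightarrow> nat \<Rightarrow> nat \<Rightarrow> nat \<Rightarrow> nat \<Rightarrow> 'a" where
  "wt q x v a b c d =
     (if c = a \<and> d = b then (if a = b then x - q * v else if b < a then q * (x - v) else x - v)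
      else if c = b \<and> d = a then (if a < c then (1 - q) * x else (1 - q) * v)
      else 0)"

text \<open>The R-matrix maps a pair of colours to a combination of the same pair and the exchanged
  pair; \<open>pass\<close> and \<open>swap\<close> are the two coefficients. For equal colours the
  two outcomes coincide, and the whole weight is put into \<open>pass\<close>.\<close>

definition pass :: "'a::field \<Rightarrow> 'a \<Rightarrow> 'a \<Rightarrow> nat \<Rightarrow> nat \<Rightarrow> 'a" where
  "pass q x v a b = (if a = b then x - q * v else if b < a then q * (x - v) else x - v)"

definition swap :: "'a::field \<Rightarrow> 'a \<Rightarrow> 'a \<Rightarrow> nat \<Rightarrow> nat \<Rightarrow> 'a" where
  "swap q x v a b = (if a = b then 0 else if a < b then (1 - q) * x else (1 - q) * v)"

lemma wt_pass_swap:
  "wt q x v a b c d = pass q x v a b * of_bool (c = a \<and> d = b)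
     + swap q x v a b * of_bool (c = b \<and> d = a)"
  unfolding wt_def pass_def swap_def of_bool_def
  by (cases "c = a"; cases "d = b"; cases "c = b"; cases "a = b"; simp)

lemma sum_wt:
  assumes "finite C" "a \<in> C" "b \<in> C"
  shows "(\<Sum>c\<in>C. \<Sum>d\<in>C. wt q x v a b c d * f c d) = pass q x v a b * f a b + swap q x v a b * f b a"
proof -
  have "(\<Sum>c\<in>C. \<Sum>d\<in>C. wt q x v a b c d * f c d)
     = (\<Sum>c\<in>C. \<Sum>d\<in>C. (if c = a then if d = b then pass q x v a b * f c d else 0 else 0)
         + (if c = b then if d = a then swap q x v a b * f c d else 0 else 0))"
    by (intro sum.cong refl) (auto simp: wt_pass_swap algebra_simps)
  also have "\<dots> = (\<Sum>c\<in>C. (if c = a then pass q x v a b * f c b else 0)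
         + (if c = b then swap q x v a b * f c a else 0))"
    using assms by (intro sum.cong refl) (auto simp: sum.distrib)
  also have "\<dots> = pass q x v a b * f a b + swap q x v a b * f b a"
    using assms by (simp add: sum.distrib)
  finally show ?thesis .
qed

lemma swap_same [simp]: "swap q x v a a = 0"
  by (simp add: swap_def)

text \<open>Every vertex keeps or exchanges its two colours, so both sides are combinations of
  values of \<open>E\<close> at rearrangements of \<open>(a1, a2, b)\<close>. With \<open>E\<close>
  arbitrary the claim becomes a comparison of at most six coefficients.\<close>

lemma yang_baxter_aux:
  fixes q :: "'a::field" and E :: "nat \<Rightarrow> nat \<Rightarrow> nat \<Rightarrow> 'a"
  shows "pass q y v a2 b * (pass q x v a1 b * (pass q x y a1 a2 * E a1 a2 b + swap q x y a1 a2
    * E a2 a1 b)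
       + swap q x v a1 b * (pass q x y b a2 * E b a2 a1 + swap q x y b a2 * E a2 b a1))
     + swap q y v a2 b * (pass q x v a1 a2 * (pass q x y a1 b * E a1 b a2 + swap q x y a1 b
       * E b a1 a2)
       + swap q x v a1 a2 * (pass q x y a2 b * E a2 b a1 + swap q x y a2 b * E b a2 a1))
     = pass q x y a1 a2 * (pass q x v a1 b * (pass q y v a2 b * E a1 a2 b + swap q y v a2 b
       * E a1 b a2)
       + swap q x v a1 b * (pass q y v a2 a1 * E b a2 a1 + swap q y v a2 a1 * E b a1 a2))
     + swap q x y a1 a2 * (pass q x v a2 b * (pass q y v a1 b * E a2 a1 b + swap q y v a1 b
       * E a2 b a1)
       + swap q x v a2 b * (pass q y v a1 a2 * E b a1 a2 + swap q y v a1 a2 * E b a2 a1))"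
    (is "?L = ?R")
proof -
  \<comment> \<open>Equal colours merge some of the rearrangements, so each pattern of equalities
    has its own list of coefficients \<open>c0\<close>, \<open>c1\<close>, and so on. The order of
    distinct colours is split only when a coefficient is checked.\<close>
  consider "a1 = a2" "a2 = b" | "a1 = a2" "a1 \<noteq> b" | "a2 = b" "a1 \<noteq> b"
    | "a1 = b" "a2 \<noteq> b" | "a1 \<noteq> a2" "a2 \<noteq> b" "a1 \<noteq> b"
    by blast
  thus ?thesis
  proof cases
    assume "a1 = a2" "a2 = b"
    thus ?thesis by simp
  next
    assume e: "a1 = a2" and ne: "a1 \<noteq> b"
    have c0: "pass q y v a1 b * pass q x v a1 b * pass q x y a1 a1 = pass q x y a1 a1
      * pass q x v a1 b * pass q y v a1 b"
      using ne by (auto simp: pass_def swap_def algebra_simps)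
    have c1: "pass q y v a1 b * swap q x v a1 b * pass q x y b a1 + swap q y v a1 b
      * pass q x v a1 a1 * swap q x y a1 b = pass q x y a1 a1 * swap q x v a1 b * pass q y v a1 a1"
      using ne by (auto simp: pass_def swap_def algebra_simps)
    have c2: "pass q y v a1 b * swap q x v a1 b * swap q x y b a1 + swap q y v a1 b
      * pass q x v a1 a1 * pass q x y a1 b = pass q x y a1 a1 * pass q x v a1 b * swap q y v a1 b"
      using ne by (auto simp: pass_def swap_def algebra_simps)
    have "?L = (pass q y v a1 b * pass q x v a1 b * pass q x y a1 a1) * E a1 a1 b + (pass q y v a1 b
      * swap q x v a1 b * pass q x y b a1 + swap q y v a1 b * pass q x v a1 a1 * swap q x y a1 b)
      * E b a1 a1 + (pass q y v a1 b * swap q x v a1 b * swap q x y b a1 + swap q y v a1 b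
      * pass q x v a1 a1 * pass q x y a1 b) * E a1 b a1"
      by (simp only: e[symmetric] swap_same mult_zero_left mult_zero_right add_0_left add_0_right
        distrib_left distrib_right mult_ac add_ac)
    also have "\<dots> = (pass q x y a1 a1 * pass q x v a1 b * pass q y v a1 b) * E a1 a1 b
      + (pass q x y a1 a1 * swap q x v a1 b * pass q y v a1 a1) * E b a1 a1 + (pass q x y a1 a1
      * pass q x v a1 b * swap q y v a1 b) * E a1 b a1"
      by (simp only: c0 c1 c2)
    also have "\<dots> = ?R"
      by (simp only: e[symmetric] swap_same mult_zero_left mult_zero_right add_0_left add_0_right
        distrib_left distrib_right mult_ac add_ac)
    finally show ?thesis .
  next
    assume e: "a2 = b" and ne: "a1 \<noteq> b"
    have c0: "pass q y v b b * pass q x v a1 b * pass q x y a1 b = pass q x y a1 b * pass q x v a1 b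
      * pass q y v b b"
      using ne by (auto simp: pass_def swap_def algebra_simps)
    have c1: "pass q y v b b * pass q x v a1 b * swap q x y a1 b = pass q x y a1 b * swap q x v a1 b
      * swap q y v b a1 + swap q x y a1 b * pass q x v b b * pass q y v a1 b"
      using ne by (auto simp: pass_def swap_def algebra_simps)
    have c2: "pass q y v b b * swap q x v a1 b * pass q x y b b = pass q x y a1 b * swap q x v a1 b
      * pass q y v b a1 + swap q x y a1 b * pass q x v b b * swap q y v a1 b"
      using ne by (auto simp: pass_def swap_def algebra_simps)
    have "?L = (pass q y v b b * pass q x v a1 b * pass q x y a1 b) * E a1 b b + (pass q y v b b
      * pass q x v a1 b * swap q x y a1 b) * E b a1 b + (pass q y v b b * swap q x v a1 b
      * pass q x y b b) * E b b a1"
      by (simp only: e swap_same mult_zero_left mult_zero_right add_0_left add_0_right distrib_left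
        distrib_right mult_ac add_ac)
    also have "\<dots> = (pass q x y a1 b * pass q x v a1 b * pass q y v b b) * E a1 b b
      + (pass q x y a1 b * swap q x v a1 b * swap q y v b a1 + swap q x y a1 b * pass q x v b b
      * pass q y v a1 b) * E b a1 b + (pass q x y a1 b * swap q x v a1 b * pass q y v b a1
      + swap q x y a1 b * pass q x v b b * swap q y v a1 b) * E b b a1"
      by (simp only: c0 c1 c2)
    also have "\<dots> = ?R"
      by (simp only: e swap_same mult_zero_left mult_zero_right add_0_left add_0_right distrib_left
        distrib_right mult_ac add_ac)
    finally show ?thesis .
  next
    assume e: "a1 = b" and ne: "a2 \<noteq> b"
    have c0: "pass q y v a2 b * pass q x v b b * pass q x y b a2 + swap q y v a2 b * swap q x v b a2
      * swap q x y a2 b = pass q x y b a2 * pass q x v b b * pass q y v a2 b + swap q x y b a2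
      * swap q x v a2 b * swap q y v b a2"
      using ne by (auto simp: pass_def swap_def algebra_simps)
    have c1: "pass q y v a2 b * pass q x v b b * swap q x y b a2 + swap q y v a2 b * swap q x v b a2
      * pass q x y a2 b = swap q x y b a2 * pass q x v a2 b * pass q y v b b"
      using ne by (auto simp: pass_def swap_def algebra_simps)
    have c2: "swap q y v a2 b * pass q x v b a2 * pass q x y b b = pass q x y b a2 * pass q x v b b
      * swap q y v a2 b + swap q x y b a2 * swap q x v a2 b * pass q y v b a2"
      using ne by (auto simp: pass_def swap_def algebra_simps)
    have "?L = (pass q y v a2 b * pass q x v b b * pass q x y b a2 + swap q y v a2 b
      * swap q x v b a2 * swap q x y a2 b) * E b a2 b + (pass q y v a2 b * pass q x v b b
      * swap q x y b a2 + swap q y v a2 b * swap q x v b a2 * pass q x y a2 b) * E a2 b b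
      + (swap q y v a2 b * pass q x v b a2 * pass q x y b b) * E b b a2"
      by (simp only: e swap_same mult_zero_left mult_zero_right add_0_left add_0_right distrib_left
        distrib_right mult_ac add_ac)
    also have "\<dots> = (pass q x y b a2 * pass q x v b b * pass q y v a2 b + swap q x y b a2
      * swap q x v a2 b * swap q y v b a2) * E b a2 b + (swap q x y b a2 * pass q x v a2 b
      * pass q y v b b) * E a2 b b + (pass q x y b a2 * pass q x v b b * swap q y v a2 b
      + swap q x y b a2 * swap q x v a2 b * pass q y v b a2) * E b b a2"
      by (simp only: c0 c1 c2)
    also have "\<dots> = ?R"
      by (simp only: e swap_same mult_zero_left mult_zero_right add_0_left add_0_right distrib_left
        distrib_right mult_ac add_ac)
    finally show ?thesis .
  next
    assume ne: "a1 \<noteq> a2" "a2 \<noteq> b" "a1 \<noteq> b"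
    have c0: "pass q y v a2 b * pass q x v a1 b * pass q x y a1 a2 = pass q x y a1 a2
      * pass q x v a1 b * pass q y v a2 b"
      using ne by (auto simp: pass_def swap_def algebra_simps)
    have c1: "pass q y v a2 b * pass q x v a1 b * swap q x y a1 a2 = swap q x y a1 a2
      * pass q x v a2 b * pass q y v a1 b"
      using ne by (auto simp: pass_def swap_def algebra_simps)
    have c2: "pass q y v a2 b * swap q x v a1 b * pass q x y b a2 + swap q y v a2 b
      * swap q x v a1 a2 * swap q x y a2 b = pass q x y a1 a2 * swap q x v a1 b * pass q y v a2 a1
      + swap q x y a1 a2 * swap q x v a2 b * swap q y v a1 a2"
      using ne by (auto simp: pass_def swap_def algebra_simps)
    have c3: "pass q y v a2 b * swap q x v a1 b * swap q x y b a2 + swap q y v a2 b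
      * swap q x v a1 a2 * pass q x y a2 b = swap q x y a1 a2 * pass q x v a2 b * swap q y v a1 b"
      using ne by (auto simp: pass_def swap_def algebra_simps)
    have c4: "swap q y v a2 b * pass q x v a1 a2 * pass q x y a1 b = pass q x y a1 a2
      * pass q x v a1 b * swap q y v a2 b"
      using ne by (auto simp: pass_def swap_def algebra_simps)
    have c5: "swap q y v a2 b * pass q x v a1 a2 * swap q x y a1 b = pass q x y a1 a2
      * swap q x v a1 b * swap q y v a2 a1 + swap q x y a1 a2 * swap q x v a2 b * pass q y v a1 a2"
      using ne by (auto simp: pass_def swap_def algebra_simps)
    have "?L = (pass q y v a2 b * pass q x v a1 b * pass q x y a1 a2) * E a1 a2 b + (pass q y v a2 b
      * pass q x v a1 b * swap q x y a1 a2) * E a2 a1 b + (pass q y v a2 b * swap q x v a1 b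
      * pass q x y b a2 + swap q y v a2 b * swap q x v a1 a2 * swap q x y a2 b) * E b a2 a1
      + (pass q y v a2 b * swap q x v a1 b * swap q x y b a2 + swap q y v a2 b * swap q x v a1 a2
      * pass q x y a2 b) * E a2 b a1 + (swap q y v a2 b * pass q x v a1 a2 * pass q x y a1 b)
      * E a1 b a2 + (swap q y v a2 b * pass q x v a1 a2 * swap q x y a1 b) * E b a1 a2"
      by (simp only:  swap_same mult_zero_left mult_zero_right add_0_left add_0_right distrib_left
        distrib_right mult_ac add_ac)
    also have "\<dots> = (pass q x y a1 a2 * pass q x v a1 b * pass q y v a2 b) * E a1 a2 b
      + (swap q x y a1 a2 * pass q x v a2 b * pass q y v a1 b) * E a2 a1 b + (pass q x y a1 a2
      * swap q x v a1 b * pass q y v a2 a1 + swap q x y a1 a2 * swap q x v a2 b * swap q y v a1 a2)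
      * E b a2 a1 + (swap q x y a1 a2 * pass q x v a2 b * swap q y v a1 b) * E a2 b a1
      + (pass q x y a1 a2 * pass q x v a1 b * swap q y v a2 b) * E a1 b a2 + (pass q x y a1 a2
      * swap q x v a1 b * swap q y v a2 a1 + swap q x y a1 a2 * swap q x v a2 b * pass q y v a1 a2)
      * E b a1 a2"
      by (simp only: c0 c1 c2 c3 c4 c5)
    also have "\<dots> = ?R"
      by (simp only:  swap_same mult_zero_left mult_zero_right add_0_left add_0_right distrib_left
        distrib_right mult_ac add_ac)
    finally show ?thesis .
  qed
qed

text \<open>In operator form this is R_12(x,y) R_13(x,v) R_23(y,v) = R_23(y,v) R_13(x,v) R_12(x,y).
  It is the auxiliary identity with \<open>E\<close> the indicator of the outgoing colours
  \<open>(c1, c2, d)\<close>.\<close>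

lemma yang_baxter:
  fixes q :: "'a::field"
  assumes C: "finite C" "a1 \<in> C" "a2 \<in> C" "b \<in> C"
  shows "(\<Sum>h2\<in>C. \<Sum>m\<in>C. wt q y v a2 b h2 m *
           (\<Sum>h1\<in>C. wt q x v a1 m h1 d * wt q x y h1 h2 c1 c2))
       = (\<Sum>g1\<in>C. \<Sum>g2\<in>C. wt q x y a1 a2 g1 g2 *
           (\<Sum>m\<in>C. wt q x v g1 b c1 m * wt q y v g2 m c2 d))"
    (is "?L = ?R")
proof -
  have 1: "(\<Sum>h1\<in>C. wt q x v a1 m h1 d * wt q x y h1 h2 c1 c2)
     = pass q x v a1 m * of_bool (d = m) * wt q x y a1 h2 c1 c2
       + swap q x v a1 m * of_bool (d = a1) * wt q x y m h2 c1 c2" if "m \<in> C" for m h2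
  proof -
    have "(\<Sum>h1\<in>C. wt q x v a1 m h1 d * wt q x y h1 h2 c1 c2) =
      (\<Sum>h1\<in>C. (if h1 = a1 then pass q x v a1 m * of_bool (d = m) * wt q x y a1 h2 c1 c2 else 0)
       + (if h1 = m then swap q x v a1 m * of_bool (d = a1) * wt q x y m h2 c1 c2 else 0))"
      by (intro sum.cong refl) (auto simp: wt_pass_swap[of q x v] algebra_simps)
    thus ?thesis using that C by (simp add: sum.distrib)
  qed
  have 2: "(\<Sum>m\<in>C. wt q x v g1 b c1 m * wt q y v g2 m c2 d)
     = pass q x v g1 b * of_bool (c1 = g1) * wt q y v g2 b c2 d
       + swap q x v g1 b * of_bool (c1 = b) * wt q y v g2 g1 c2 d" if "g1 \<in> C" for g1 g2
  proof -
    have "(\<Sum>m\<in>C. wt q x v g1 b c1 m * wt q y v g2 m c2 d) =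
      (\<Sum>m\<in>C. (if m = b then pass q x v g1 b * of_bool (c1 = g1) * wt q y v g2 b c2 d else 0)
       + (if m = g1 then swap q x v g1 b * of_bool (c1 = b) * wt q y v g2 g1 c2 d else 0))"
      by (intro sum.cong refl) (auto simp: wt_pass_swap[of q x v] algebra_simps)
    thus ?thesis using that C by (simp add: sum.distrib)
  qed
  have L: "?L = pass q y v a2 b * (pass q x v a1 b * of_bool (d = b) * wt q x y a1 a2 c1 c2
       + swap q x v a1 b * of_bool (d = a1) * wt q x y b a2 c1 c2)
     + swap q y v a2 b * (pass q x v a1 a2 * of_bool (d = a2) * wt q x y a1 b c1 c2
       + swap q x v a1 a2 * of_bool (d = a1) * wt q x y a2 b c1 c2)"
    using C by (simp add: sum_wt 1)
  have R: "?R = pass q x y a1 a2 * (pass q x v a1 b * of_bool (c1 = a1) * wt q y v a2 b c2 d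
       + swap q x v a1 b * of_bool (c1 = b) * wt q y v a2 a1 c2 d)
     + swap q x y a1 a2 * (pass q x v a2 b * of_bool (c1 = a2) * wt q y v a1 b c2 d
       + swap q x v a2 b * of_bool (c1 = b) * wt q y v a1 a2 c2 d)"
    using C by (simp add: sum_wt 2)
  show ?thesis unfolding L R
    using yang_baxter_aux[of q y v a2 b x a1 "\<lambda>i j k. of_bool (c1 = i \<and> c2 = j \<and> d = k)"]
    by (simp only: wt_pass_swap of_bool_conj mult_ac add_ac distrib_left)
qed

lemma sum_swap4:
  "(\<Sum>a\<in>A. \<Sum>b\<in>B. \<Sum>c\<in>C. \<Sum>d\<in>D. f a b c d) = (\<Sum>d\<in>D. \<Sum>b\<in>B. \<Sum>c\<in>C. \<Sum>a\<in>A. f a b c d)"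
  unfolding sum.cartesian_product
  by (rule sum.reindex_bij_witness[of _ "\<lambda>(d, b, c, a). (a, b, c, d)" "\<lambda>(a, b, c, d).
    (d, b, c, a)"]) auto

lemma sum_swap4':
  "(\<Sum>a\<in>A. \<Sum>b\<in>B. \<Sum>c\<in>C. \<Sum>d\<in>D. f a b c d) = (\<Sum>d\<in>D. \<Sum>a\<in>A. \<Sum>b\<in>B. \<Sum>c\<in>C. f a b c d)"
  unfolding sum.cartesian_product
  by (rule sum.reindex_bij_witness[of _ "\<lambda>(d, a, b, c). (a, b, c, d)" "\<lambda>(a, b, c, d).
    (d, a, b, c)"]) auto

section \<open>Polynomial functions, state sums and sorted lists\<close>

text \<open>Polynomial functions of degree less than \<open>n\<close>; for \<open>n = 0\<close> only the zero function.\<close>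

definition poly_below :: "nat \<Rightarrow> ('a::field \<Rightarrow> 'a) \<Rightarrow> bool" where
  "poly_below n f \<longleftrightarrow> (\<exists>p. (\<forall>i\<ge>n. coeff p i = 0) \<and> (\<forall>x. f x = poly p x))"

lemma poly_below_0 [simp]: "poly_below n (\<lambda>_. 0)"
  unfolding poly_below_def by (intro exI[of _ 0]) auto

lemma poly_below_const: "0 < n \<Longrightarrow> poly_below n (\<lambda>_. c)"
  unfolding poly_below_def by (intro exI[of _ "[:c:]"]) (auto simp: coeff_pCons split: nat.split)

lemma poly_below_linear: "poly_below 2 (\<lambda>x. a + b * x)"
  unfolding poly_below_def
  by (intro exI[of _ "[:a, b:]"]) (auto simp: coeff_pCons algebra_simps split: nat.split)

lemma poly_below_add: "poly_below n f \<Longrightarrow> poly_below n g \<Longrightarrow> poly_below n (\<lambda>x. f x + g x)"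
  unfolding poly_below_def
proof (elim exE conjE)
  fix p p' assume "\<forall>i\<ge>n. coeff p i = 0" "\<forall>x. f x = poly p x" "\<forall>i\<ge>n. coeff p' i = 0" "\<forall>x. g x
    = poly p' x"
  thus "\<exists>p. (\<forall>i\<ge>n. coeff p i = 0) \<and> (\<forall>x. f x + g x = poly p x)"
    by (intro exI[of _ "p + p'"]) auto
qed

lemma poly_below_sum: "(\<And>a. a \<in> A \<Longrightarrow> poly_below n (f a)) \<Longrightarrow> poly_below n (\<lambda>x. \<Sum>a\<in>A. f a x)"
  by (induction A rule: infinite_finite_induct) (auto intro: poly_below_add)

text \<open>The two bounds are asymmetric so that the case \<open>n = 0\<close> is included: degree
  at most \<open>m\<close> times degree below \<open>n\<close> has degree below
  \<open>m + n\<close>, and a vanishing factor gives a vanishing product.\<close>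

lemma poly_below_mult:
  assumes "poly_below (Suc m) f" "poly_below n g"
  shows "poly_below (m + n) (\<lambda>x. f x * g x)"
proof -
  obtain p p' where p: "\<forall>i\<ge>Suc m. coeff p i = 0" "\<forall>x. f x = poly p x"
    and p': "\<forall>i\<ge>n. coeff p' i = 0" "\<forall>x. g x = poly p' x"
    using assms unfolding poly_below_def by blast
  have "coeff (p * p') i = 0" if "i \<ge> m + n" for i
    unfolding coeff_mult
  proof (intro sum.neutral ballI)
    fix j assume "j \<in> {..i}"
    hence "j \<ge> Suc m \<or> i - j \<ge> n" using that by auto
    thus "coeff p j * coeff p' (i - j) = 0" using p p' by auto
  qed
  thus ?thesis unfolding poly_below_def using p p'
    by (intro exI[of _ "p * p'"]) auto
qed

lemma poly_below_cmult: "poly_below n f \<Longrightarrow> poly_below n (\<lambda>x. c * f x)"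
  using poly_below_mult[of 0 "\<lambda>_. c" n f] by (simp add: poly_below_const)

lemma poly_below_prod:
  assumes "finite A" "\<And>a. a \<in> A \<Longrightarrow> poly_below 2 (f a)" "card A < n"
  shows "poly_below n (\<lambda>x. \<Prod>a\<in>A. f a x)"
  using assms
proof (induction A arbitrary: n rule: finite_induct)
  case (insert a A)
  then obtain n' where "n = Suc n'" by (cases n) auto
  moreover have "poly_below (1 + n') (\<lambda>x. f a x * (\<Prod>a\<in>A. f a x))"
    using insert calculation by (intro poly_below_mult insert.IH) (auto simp: numeral_2_eq_2)
  ultimately show ?case using insert by simp
qed (auto intro: poly_below_const)

lemma poly_below_eqI:
  assumes "poly_below n f" "poly_below n g" "finite S" "n \<le> card S" "\<And>x. x \<in> S \<Longrightarrow> f x = g x"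
  shows "f = g"
proof -
  obtain p p' where p: "\<forall>i\<ge>n. coeff p i = 0" "\<forall>x. f x = poly p x"
    and p': "\<forall>i\<ge>n. coeff p' i = 0" "\<forall>x. g x = poly p' x"
    using assms unfolding poly_below_def by blast
  define r where "r = p - p'"
  have "r = 0"
  proof (rule ccontr)
    assume r: "r \<noteq> 0"
    have "S \<subseteq> {x. poly r x = 0}" using assms(5) p p' by (auto simp: r_def)
    hence cS: "card S \<le> degree r"
      using order.trans[OF card_mono[OF poly_roots_finite[OF r]] card_poly_roots_bound[OF r]] by
        blast
    have "coeff r (degree r) \<noteq> 0" using r by simp
    moreover have "coeff r i = 0" if "i \<ge> n" for i using p p' that by (simp add: r_def)
    ultimately have "degree r < n" by (meson leI)
    thus False using assms(4) cS by simp
  qed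
  thus ?thesis using p p' by (auto simp: r_def fun_eq_iff)
qed

section \<open>Matrix units and vertex weights\<close>

lemma sum_Eunit_pair:
  assumes "a \<in> {1..n}" "b \<in> {1..n}"
  shows "(\<Sum>(i, j)\<in>{(i, j) \<in> {1..n} \<times> {1..n}. R i j}. w * (Eunit i i c a * Eunit j j d b)) =
      (if R a b \<and> c = a \<and> d = b then w else (0::'a::field))"
    and "(\<Sum>(i, j)\<in>{(i, j) \<in> {1..n} \<times> {1..n}. R i j}. w * (Eunit i j c a * Eunit j i d b)) =
      (if R b a \<and> c = b \<and> d = a then w else (0::'a::field))"
proof -
  have fin: "finite {(i, j) \<in> {1..n} \<times> {1..n}. R i j}"
    by (rule finite_subset[of _ "{1..n} \<times> {1..n}"]) auto
  have "(\<Sum>(i, j)\<in>{(i, j) \<in> {1..n} \<times> {1..n}. R i j}. w * (Eunit i i c a * Eunit j j d b)) =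
    (\<Sum>z\<in>{(i, j) \<in> {1..n} \<times> {1..n}. R i j}. if z = (a, b) then if c = a \<and> d
      = b then w else 0 else 0)"
    by (intro sum.cong refl) (auto simp: Eunit_def split: if_splits)
  thus "(\<Sum>(i, j)\<in>{(i, j) \<in> {1..n} \<times> {1..n}. R i j}. w * (Eunit i i c a * Eunit j j d b)) =
      (if R a b \<and> c = a \<and> d = b then w else 0)"
    using assms fin by auto
  have "(\<Sum>(i, j)\<in>{(i, j) \<in> {1..n} \<times> {1..n}. R i j}. w * (Eunit i j c a * Eunit j i d b)) =
    (\<Sum>z\<in>{(i, j) \<in> {1..n} \<times> {1..n}. R i j}. if z = (b, a) then if c = b \<and> d
      = a then w else 0 else 0)"
    by (intro sum.cong refl) (auto simp: Eunit_def split: if_splits)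
  thus "(\<Sum>(i, j)\<in>{(i, j) \<in> {1..n} \<times> {1..n}. R i j}. w * (Eunit i j c a * Eunit j i d b)) =
      (if R b a \<and> c = b \<and> d = a then w else 0)"
    using assms fin by auto
qed

lemma Rcoeff_eq_wt:
  assumes "a \<in> {1..n}" "b \<in> {1..n}"
  shows "Rcoeff n q x v a b c d = wt q x v a b c d"
proof -
  have diag: "(\<Sum>i\<in>{1..n}. (x - q * v) * (Eunit i i c a * Eunit i i d b)) =
     (if a = b \<and> c = a \<and> d = b then x - q * v else 0)"
  proof -
    have "(\<Sum>i\<in>{1..n}. (x - q * v) * (Eunit i i c a * Eunit i i d b)) =
      (\<Sum>i\<in>{1..n}. if i = a then if a = b \<and> c = a \<and> d = b then x - q * v else 0 else 0)"
      by (intro sum.cong refl) (auto simp: Eunit_def split: if_splits)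
    thus ?thesis using assms by simp
  qed
  show ?thesis
    unfolding Rcoeff_def diag sum_Eunit_pair[OF assms]
    by (cases "a = b"; cases "c = a"; cases "d = b"; cases "c = b"; cases "d = a"; cases "a < b")
      (simp_all add: wt_def)
qed

section \<open>Path sums and products of transfer matrices\<close>

lemma sum_PiE_insert:
  assumes "x \<notin> S"
  shows "(\<Sum>f\<in>PiE (insert x S) T. g f) = (\<Sum>y\<in>T x. \<Sum>f\<in>PiE S T. g (f(x := y)))"
proof -
  have "inj_on (\<lambda>(y, g). g(x := y)) (T x \<times> PiE S T)"
    using inj_combinator[OF assms] .
  thus ?thesis
    by (simp add: PiE_insert_eq sum.reindex sum.cartesian_product case_prod_unfold)
qed

text \<open>\<open>G r a\<close> is the entry at \<open>(a, e)\<close> of the product of the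
  remaining matrices \<open>K (r + 1)\<close>, ..., \<open>K N\<close>; expanding the product gives
  the paths. With colours as states this describes one column, with words as states a whole
  layer.\<close>

lemma transfer_path_sum:
  assumes S: "finite S" and end_: "\<And>a. G N a = of_bool (a = e)"
    and step: "\<And>r a. r < N \<Longrightarrow> a \<in> S \<Longrightarrow> G r a = (\<Sum>m\<in>S. K (Suc r) a m * G (Suc r) m :: 'a::field)"
    and "r \<le> N" "a \<in> S"
  shows "(\<Sum>f\<in>{f \<in> {r..N} \<rightarrow>\<^sub>E S. f N = e \<and> f r = a}. \<Prod>s\<in>{r<..N}. K s (f (s - 1)) (f s)) = G r a"
proof -
  have conv: "(\<Sum>f\<in>{f \<in> {r..N} \<rightarrow>\<^sub>E S. f N = e \<and> f r = a}. \<Prod>s\<in>{r<..N}. K s (f (s - 1)) (f s))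
    = (\<Sum>f\<in>{r..N} \<rightarrow>\<^sub>E S. of_bool (f N = e \<and> f r = a) * (\<Prod>s\<in>{r<..N}. K s (f (s - 1)) (f s)))" for r a
    using S by (intro sum.mono_neutral_cong_left) (auto intro: finite_PiE)
  have "(\<Sum>f\<in>{r..N} \<rightarrow>\<^sub>E S. of_bool (f N = e \<and> f r = a) * (\<Prod>s\<in>{r<..N}. K s (f (s - 1)) (f s)))
    = G r a"
    using assms(4,5)
  proof (induction r arbitrary: a rule: inc_induct)
    case base
    have "(\<Sum>f\<in>{N..N} \<rightarrow>\<^sub>E S. of_bool (f N = e \<and> f N = a) * (\<Prod>s\<in>{N<..N}. K s (f (s - 1)) (f s)))
       = (\<Sum>y\<in>S. of_bool (y = e \<and> y = a))"
      by (simp add: sum_PiE_insert)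
    also have "\<dots> = (\<Sum>y\<in>S. if y = a then of_bool (a = e) else 0)"
      by (intro sum.cong) auto
    also have "\<dots> = G N a" using base S by (simp add: end_)
    finally show ?case .
  next
    case (step r)
    let ?X = "\<lambda>f. \<Prod>s\<in>{Suc r<..N}. K s (f (s - 1)) (f s)"
    have ins: "{r..N} = insert r {Suc r..N}" "{r<..N}
      = insert (Suc r) {Suc r<..N}" using step by auto
    have "(\<Sum>f\<in>{r..N} \<rightarrow>\<^sub>E S. of_bool (f N = e \<and> f r = a) * (\<Prod>s\<in>{r<..N}. K s (f (s - 1)) (f s)))
       = (\<Sum>y\<in>S. \<Sum>f\<in>{Suc r..N} \<rightarrow>\<^sub>E S. of_bool (f N = e \<and> y = a) * (K (Suc r) y (f (Suc r)) * ?X f))"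
      unfolding ins
    proof (subst sum_PiE_insert, simp, intro sum.cong refl)
      fix y f
      have "(\<Prod>s\<in>{Suc r<..N}. K s ((f(r := y)) (s - 1)) ((f(r := y)) s)) = ?X f"
        by (intro prod.cong refl) auto
      thus "of_bool ((f(r := y)) N = e \<and> (f(r := y)) r = a) *
          (\<Prod>s\<in>insert (Suc r) {Suc r<..N}. K s ((f(r := y)) (s - 1)) ((f(r := y)) s))
        = of_bool (f N = e \<and> y = a) * (K (Suc r) y (f (Suc r)) * ?X f)"
        using step by simp
    qed
    also have "\<dots> = (\<Sum>y\<in>S. if y = a then \<Sum>f\<in>{Suc r..N} \<rightarrow>\<^sub>E S. of_bool (f N = e) * (K (Suc r) a (f
      (Suc r)) * ?X f) else 0)"
      by (intro sum.cong) auto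
    also have "\<dots> = (\<Sum>f\<in>{Suc r..N} \<rightarrow>\<^sub>E S. of_bool (f N = e) * (K (Suc r) a (f (Suc r)) * ?X f))"
      using step S by simp
    also have "\<dots> = (\<Sum>f\<in>{Suc r..N} \<rightarrow>\<^sub>E S. \<Sum>m\<in>S. K (Suc r) a m * (of_bool (f N = e \<and> f (Suc r)
      = m) * ?X f))"
    proof (intro sum.cong refl)
      fix f assume f: "f \<in> {Suc r..N} \<rightarrow>\<^sub>E S"
      hence "f (Suc r) \<in> S" using step by auto
      moreover have "(\<Sum>m\<in>S. K (Suc r) a m * (of_bool (f N = e \<and> f (Suc r) = m) * ?X f))
        = (\<Sum>m\<in>S. if m = f (Suc r) then K (Suc r) a m * (of_bool (f N = e) * ?X f) else 0)"
        by (intro sum.cong) auto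
      ultimately show "of_bool (f N = e) * (K (Suc r) a (f (Suc r)) * ?X f)
        = (\<Sum>m\<in>S. K (Suc r) a m * (of_bool (f N = e \<and> f (Suc r) = m) * ?X f))"
        using S by (simp add: mult_ac)
    qed
    also have "\<dots> = (\<Sum>m\<in>S. K (Suc r) a m * (\<Sum>f\<in>{Suc r..N} \<rightarrow>\<^sub>E S. of_bool (f N = e \<and> f (Suc r)
      = m) * ?X f))"
      by (subst sum.swap) (simp add: sum_distrib_left)
    also have "\<dots> = (\<Sum>m\<in>S. K (Suc r) a m * G (Suc r) m)"
      by (intro sum.cong refl arg_cong2[of _ _ _ _ "(*)"] step.IH)
    finally show ?case using step assms(3)[of r a] by simp
  qed
  thus ?thesis by (simp only: conv)
qed

section \<open>Permutations and sorted lists\<close>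

lemma sum_permutations_of_set:
  assumes "inj_on f {1..n}"
  shows "(\<Sum>ws\<in>permutations_of_set (set (map f [1..<Suc n])). X ws)
       = (\<Sum>\<pi>\<in>{\<pi>. \<pi> permutes {1..n}}. X (map (\<lambda>a. f (\<pi> a)) [1..<Suc n]))"
proof (rule sum.reindex_bij_betw[symmetric], rule bij_betw_imageI)
  let ?g = "\<lambda>\<pi>. map (\<lambda>a. f (\<pi> a)) [1..<Suc n]"
  show inj: "inj_on ?g {\<pi>. \<pi> permutes {1..n}}"
  proof (rule inj_onI)
    fix \<pi> \<pi>' assume *: "\<pi> \<in> {\<pi>. \<pi> permutes {1..n}}" "\<pi>' \<in> {\<pi>. \<pi> permutes {1..n}}" "?g \<pi> = ?g \<pi>'"
    show "\<pi> = \<pi>'"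
    proof
      fix a
      show "\<pi> a = \<pi>' a"
      proof (cases "a \<in> {1..n}")
        case True
        hence "f (\<pi> a) = f (\<pi>' a)" using *(3) by (auto simp del: upt_Suc)
        moreover have "\<pi> a \<in> {1..n}" "\<pi>' a \<in> {1..n}"
          using *(1,2) True by (simp_all only: mem_Collect_eq permutes_in_image)
        ultimately show ?thesis using inj_onD[OF assms] by blast
      next
        case False
        thus ?thesis using * by (auto simp: permutes_def)
      qed
    qed
  qed
  have sub: "?g ` {\<pi>. \<pi> permutes {1..n}} \<subseteq> permutations_of_set (set (map f [1..<Suc n]))"
  proof (rule image_subsetI)
    fix \<pi> assume "\<pi> \<in> {\<pi>. \<pi> permutes {1..n}}"
    hence p: "\<pi> permutes {1..n}" by simp
    have "set (?g \<pi>) = f ` (\<pi> ` {1..n})" by (auto simp del: upt_Suc)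
    hence "set (?g \<pi>) = set (map f [1..<Suc n])" using permutes_image[OF p] by
      (auto simp del: upt_Suc)
    moreover have "inj_on (\<lambda>a. f (\<pi> a)) {1..n}"
      using assms comp_inj_on[of \<pi> "{1..n}" f] permutes_inj_on[OF p] permutes_image[OF p] by
        (simp add: o_def)
    hence "distinct (?g \<pi>)"
      by (simp add: distinct_map atLeastLessThanSuc_atLeastAtMost del: upt_Suc)
    ultimately show "?g \<pi> \<in> permutations_of_set (set (map f [1..<Suc n]))"
      by (simp add: permutations_of_set_def del: upt_Suc)
  qed
  \<comment> \<open>Surjectivity follows by counting: the image lies in the set of orderings, and
    both have n! elements.\<close>
  have "card (set (map f [1..<Suc n])) = n"
    using card_image[OF assms] by (simp add: atLeastLessThanSuc_atLeastAtMost del: upt_Suc)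
  hence "card (permutations_of_set (set (map f [1..<Suc n]))) = fact n"
    by (subst card_permutations_of_set) auto
  moreover have "card (?g ` {\<pi>. \<pi> permutes {1..n}}) = fact n"
    using card_image[OF inj] card_permutations[of "{1..n}" n] by simp
  ultimately show "?g ` {\<pi>. \<pi> permutes {1..n}} = permutations_of_set (set (map f [1..<Suc n]))"
    by (intro card_subset_eq sub) auto
qed

lemma sorted_list_of_set_eqI:
  "sorted xs \<Longrightarrow> distinct xs \<Longrightarrow> set xs = A \<Longrightarrow> sorted_list_of_set A = xs"
  using sorted_list_of_set.idem_if_sorted_distinct by fastforce

lemma filter_sorted_list_of_set:
  fixes A :: "nat set"
  shows "finite A \<Longrightarrow> filter P (sorted_list_of_set A) = sorted_list_of_set {x \<in> A. P x}"
  by (rule sorted_list_of_set_eqI[symmetric]) (auto simp: sorted_wrt_filter)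

lemma sorted_list_of_set_insert_max:
  fixes n :: nat
  assumes "finite A" "\<And>x. x \<in> A \<Longrightarrow> x < n"
  shows "sorted_list_of_set (insert n A) = sorted_list_of_set A @ [n]"
  by (rule sorted_list_of_set_eqI) (use assms in \<open>auto simp: sorted_append less_imp_le\<close>)

lemma nth_smallest_insert_max:
  assumes "finite A" "\<And>x. x \<in> A \<Longrightarrow> x < n"
  shows "a \<in> {1..card A} \<Longrightarrow> nth_smallest (insert n A) a = nth_smallest A a"
    and "nth_smallest (insert n A) (Suc (card A)) = n"
proof -
  have "sorted_list_of_set (insert n A) = sorted_list_of_set A @ [n]"
    using assms by (rule sorted_list_of_set_insert_max)
  thus "a \<in> {1..card A} \<Longrightarrow> nth_smallest (insert n A) a = nth_smallest A a"
    "nth_smallest (insert n A) (Suc (card A)) = n"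
    by (auto simp: nth_smallest_def nth_append simp del: sorted_list_of_set_insert_remove)
qed

lemma nth_smallest_in:
  assumes "finite A" "a \<in> {1..card A}"
  shows "nth_smallest A a \<in> A"
proof -
  have "nth_smallest A a \<in> set (sorted_list_of_set A)"
    unfolding nth_smallest_def using assms by (intro nth_mem) auto
  thus ?thesis using assms by simp
qed

lemma nth_smallest_shift:
  assumes "finite A" "a \<in> {1..card A}"
  shows "nth_smallest ((+) l ` A) a = l + nth_smallest A a"
proof -
  have "sorted_list_of_set ((+) l ` A) = map ((+) l) (sorted_list_of_set A)"
    by (rule sorted_list_of_set_eqI) (use assms in \<open>auto simp: sorted_map distinct_map\<close>)
  thus ?thesis using assms by (auto simp: nth_smallest_def)
qed

section \<open>Columns and grids\<close>

locale vertex_model =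
  fixes C :: "nat set" and q :: "'a::field"
  assumes finite_C: "finite C"
begin

definition words :: "nat \<Rightarrow> nat list set" where
  "words n = {w. length w = n \<and> set w \<subseteq> C}"

lemma finite_words [simp]: "finite (words n)"
  unfolding words_def using finite_lists_length_eq[OF finite_C, of n] by (simp add: conj_commute)

lemma words_0 [simp]: "words 0 = {[]}"
  by (auto simp: words_def)

lemma sum_words_Suc: "(\<Sum>w\<in>words (Suc n). f w) = (\<Sum>a\<in>C. \<Sum>w\<in>words n. f (a # w))"
proof -
  have "words (Suc n) = (\<lambda>(a, w). a # w) ` (C \<times> words n)"
    by (auto simp: words_def length_Suc_conv image_iff)
  moreover have "inj_on (\<lambda>(a, w). a # w) (C \<times> words n)"
    by (auto simp: inj_on_def)
  ultimately show ?thesis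
    by (simp add: sum.reindex sum.cartesian_product case_prod_unfold)
qed

lemma sum_words_add: "(\<Sum>w\<in>words (m + n). f w) = (\<Sum>v\<in>words m. \<Sum>w\<in>words n. f (v @ w))"
  by (induction m arbitrary: f) (simp_all add: sum_words_Suc)

text \<open>One column of variable \<open>v\<close>, with the rows listed from top to bottom: left word, bottom colour,
  right word, top colour.\<close>

fun column :: "'a list \<Rightarrow> 'a \<Rightarrow> nat list \<Rightarrow> nat \<Rightarrow> nat list \<Rightarrow> nat \<Rightarrow> 'a" where
  "column [] v [] b [] d = (if b = d then 1 else 0)"
| "column (x # xs) v (a # as) b (h # hs) d = (\<Sum>m\<in>C. wt q x v a m h d * column xs v as b hs m)"
| "column _ _ _ _ _ _ = 0"

lemma column_append:
  assumes "length as = length xs" "length hs = length xs" "d \<in> C"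
  shows "column (xs @ ys) v (as @ bs) b (hs @ gs) d
       = (\<Sum>m\<in>C. column xs v as m hs d * column ys v bs b gs m)"
  using assms
proof (induction xs arbitrary: as hs d)
  case Nil
  have "(\<Sum>m\<in>C. (if m = d then 1 else 0) * column ys v bs b gs m)
      = (\<Sum>m\<in>C. if m = d then column ys v bs b gs m else 0)"
    by (intro sum.cong) auto
  with Nil show ?case using finite_C by simp
next
  case (Cons x xs)
  then obtain a as' h hs' where *: "as = a # as'" "hs = h # hs'"
    by (metis length_Suc_conv)
  have "column ((x # xs) @ ys) v (as @ bs) b (hs @ gs) d
    = (\<Sum>m\<in>C. wt q x v a m h d * (\<Sum>m'\<in>C. column xs v as' m' hs' m * column ys v bs b gs m'))"
    using Cons by (simp add: *)
  also have "\<dots> = (\<Sum>m'\<in>C. \<Sum>m\<in>C. wt q x v a m h d * column xs v as' m' hs' m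
    * column ys v bs b gs m')"
    by (simp add: sum_distrib_left mult_ac) (rule sum.swap)
  also have "\<dots> = (\<Sum>m\<in>C. column (x # xs) v as m hs d * column ys v bs b gs m)"
    by (simp add: * sum_distrib_right)
  finally show ?case .
qed

lemma column_snoc:
  assumes "length as = length xs" "length hs = length xs" "b \<in> C" "d \<in> C"
  shows "column (xs @ [y]) v (as @ [a]) b (hs @ [h]) d
       = (\<Sum>m\<in>C. column xs v as m hs d * wt q y v a b h m)"
proof -
  have "column [y] v [a] b [h] m = wt q y v a b h m" if "m \<in> C" for m
  proof -
    have "column [y] v [a] b [h] m = (\<Sum>m'\<in>C. if m' = b then wt q y v a m' h m else 0)"
      by simp (intro sum.cong, auto)
    thus ?thesis using assms finite_C by simp
  qed
  thus ?thesis using assms by (simp add: column_append)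
qed

section \<open>Exchange relations for columns and grids\<close>

lemma column_row_exchange_top:
  assumes "a1 \<in> C" "a2 \<in> C"
  shows "(\<Sum>h1\<in>C. \<Sum>h2\<in>C. column (x # y # ys) v (a1 # a2 # as) b (h1 # h2 # hs) d
    * wt q x y h1 h2 c1 c2)
       = (\<Sum>g1\<in>C. \<Sum>g2\<in>C. wt q x y a1 a2 g1 g2 * column (y # x # ys) v (g2 # g1 # as) b
         (c2 # c1 # hs) d)"
    (is "?L = ?R")
proof -
  have "?L = (\<Sum>h1\<in>C. \<Sum>h2\<in>C. \<Sum>m\<in>C. \<Sum>l\<in>C.
      wt q x v a1 m h1 d * wt q y v a2 l h2 m * wt q x y h1 h2 c1 c2 * column ys v as b hs l)"
    by (simp add: sum_distrib_left sum_distrib_right mult_ac)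
  also have "\<dots> = (\<Sum>l\<in>C. \<Sum>h2\<in>C. \<Sum>m\<in>C. \<Sum>h1\<in>C.
      wt q x v a1 m h1 d * wt q y v a2 l h2 m * wt q x y h1 h2 c1 c2 * column ys v as b hs l)"
    by (rule sum_swap4)
  also have "\<dots> = (\<Sum>l\<in>C. column ys v as b hs l * (\<Sum>h2\<in>C. \<Sum>m\<in>C. wt q y v a2 l h2 m *
           (\<Sum>h1\<in>C. wt q x v a1 m h1 d * wt q x y h1 h2 c1 c2)))"
    by (simp add: sum_distrib_left mult_ac)
  \<comment> \<open>The two upper vertices followed by the crossing \<open>R(x, y)\<close> form one
    side of the Yang-Baxter equation; \<open>l\<close> is the colour of the edge below them.\<close>
  also have "\<dots> = (\<Sum>l\<in>C. column ys v as b hs l * (\<Sum>g1\<in>C. \<Sum>g2\<in>C. wt q x y a1 a2 g1 g2 *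
           (\<Sum>m\<in>C. wt q x v g1 l c1 m * wt q y v g2 m c2 d)))"
    using assms finite_C by (intro sum.cong refl) (simp add: yang_baxter)
  also have "\<dots> = (\<Sum>l\<in>C. \<Sum>g1\<in>C. \<Sum>g2\<in>C. \<Sum>m\<in>C. wt q x y a1 a2 g1 g2 *
           (wt q y v g2 m c2 d * (wt q x v g1 l c1 m * column ys v as b hs l)))"
    by (simp add: sum_distrib_left mult_ac)
  also have "\<dots> = (\<Sum>g1\<in>C. \<Sum>g2\<in>C. \<Sum>m\<in>C. \<Sum>l\<in>C. wt q x y a1 a2 g1 g2 *
           (wt q y v g2 m c2 d * (wt q x v g1 l c1 m * column ys v as b hs l)))"
    by (rule sum_swap4'[symmetric])
  also have "\<dots> = ?R"
    by (simp add: sum_distrib_left)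
  finally show ?thesis .
qed

lemma column_row_exchange:
  assumes "length as = length xs" "length hs = length xs" "a1 \<in> C" "a2 \<in> C" "d \<in> C"
  shows "(\<Sum>h1\<in>C. \<Sum>h2\<in>C. column (xs @ x # y # ys) v (as @ a1 # a2 # as') b (hs @ h1 # h2 # hs') d
    * wt q x y h1 h2 c1 c2)
       = (\<Sum>g1\<in>C. \<Sum>g2\<in>C. wt q x y a1 a2 g1 g2 * column (xs @ y # x # ys) v (as @ g2 # g1 # as') b (hs
         @ c2 # c1 # hs') d)"
    (is "?L = ?R")
proof -
  have "?L = (\<Sum>h1\<in>C. \<Sum>h2\<in>C. \<Sum>m\<in>C. column xs v as m hs d *
      (column (x # y # ys) v (a1 # a2 # as') b (h1 # h2 # hs') m * wt q x y h1 h2 c1 c2))"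
    using assms by (simp add: column_append sum_distrib_right mult.assoc del: column.simps)
  also have "\<dots> = (\<Sum>m\<in>C. \<Sum>h1\<in>C. \<Sum>h2\<in>C. column xs v as m hs d *
      (column (x # y # ys) v (a1 # a2 # as') b (h1 # h2 # hs') m * wt q x y h1 h2 c1 c2))"
    unfolding sum.cartesian_product
    by (rule sum.reindex_bij_witness[of _ "\<lambda>(d, a, b). (a, b, d)" "\<lambda>(a, b, d). (d, a, b)"]) auto
  also have "\<dots> = (\<Sum>m\<in>C. \<Sum>g1\<in>C. \<Sum>g2\<in>C. column xs v as m hs d *
      (wt q x y a1 a2 g1 g2 * column (y # x # ys) v (g2 # g1 # as') b (c2 # c1 # hs') m))"
    unfolding sum_distrib_left[symmetric]
    using assms by (simp only: column_row_exchange_top)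
  also have "\<dots> = (\<Sum>g1\<in>C. \<Sum>g2\<in>C. \<Sum>m\<in>C. column xs v as m hs d *
      (wt q x y a1 a2 g1 g2 * column (y # x # ys) v (g2 # g1 # as') b (c2 # c1 # hs') m))"
    unfolding sum.cartesian_product
    by (rule sum.reindex_bij_witness[of _ "\<lambda>(a, b, d). (d, a, b)" "\<lambda>(d, a, b). (a, b, d)"]) auto
  also have "\<dots> = ?R"
    using assms by (simp add: column_append sum_distrib_left mult_ac del: column.simps)
  finally show ?thesis .
qed

text \<open>The crossing \<open>R(v, w)\<close> of the two columns starts on their top edges.
  Yang-Baxter, with the row variable as its first parameter, moves it below one row at a time and
  interchanges the columns there, until it acts on the bottom colours.\<close>

lemma column_pair_exchange:
  assumes "b1 \<in> C" "b2 \<in> C" "length as = length us" "length cs = length us" "set as \<subseteq> C"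
  shows "(\<Sum>d1\<in>C. \<Sum>d2\<in>C. (\<Sum>hs\<in>words (length us). column us v as b1 hs d1 * column us w hs b2 cs d2)
    * wt q v w d1 d2 e1 e2)
       = (\<Sum>g1\<in>C. \<Sum>g2\<in>C. wt q v w b1 b2 g1 g2 * (\<Sum>hs\<in>words (length us). column us w as g2 hs e2
         * column us v hs g1 cs e1))"
  using assms(3-)
proof (induction us arbitrary: as cs e1 e2)
  case Nil
  have L: "(\<Sum>d1\<in>C. \<Sum>d2\<in>C. (if b1 = d1 then 1 else 0) * (if b2 = d2 then 1 else 0)
    * wt q v w d1 d2 e1 e2)
    = (\<Sum>d1\<in>C. \<Sum>d2\<in>C. if d2 = b2 then if d1 = b1 then wt q v w d1 d2 e1 e2 else 0 else 0)"
    by (intro sum.cong refl) auto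
  have R: "(\<Sum>g1\<in>C. \<Sum>g2\<in>C. wt q v w b1 b2 g1 g2 * ((if g2 = e2 then 1 else 0) * (if g1
    = e1 then 1 else 0)))
    = (\<Sum>g1\<in>C. \<Sum>g2\<in>C. if g2 = e2 then if g1 = e1 then wt q v w b1 b2 g1 g2 else 0 else 0)"
    by (intro sum.cong refl) auto
  have "wt q v w b1 b2 e1 e2 = 0" if "e1 \<notin> C \<or> e2 \<notin> C"
  proof -
    have "\<not> (e1 = b1 \<and> e2 = b2)" "\<not> (e1 = b2 \<and> e2 = b1)"
      using that assms(1,2) by blast+
    thus ?thesis by (simp only: wt_def if_False)
  qed
  with Nil assms(1,2) finite_C show ?case by (cases "e2 \<in> C") (simp_all add: L R)
next
  case (Cons u us)
  then obtain a as' c cs' where *: "as = a # as'" "cs = c # cs'" "a \<in> C"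
    by (metis length_Suc_conv list.set_intros(1) subsetD)
  note IH = Cons.IH[of as' cs']
  let ?W = "words (length us)"
  have "(\<Sum>d1\<in>C. \<Sum>d2\<in>C. (\<Sum>hs\<in>words (length (u # us)). column (u # us) v as b1 hs d1 * column
    (u # us) w hs b2 cs d2) * wt q v w d1 d2 e1 e2)
     = (\<Sum>d1\<in>C. \<Sum>d2\<in>C. \<Sum>h\<in>C. \<Sum>hs\<in>?W. \<Sum>m2\<in>C. \<Sum>m1\<in>C.
         wt q u v a m1 h d1 * wt q u w h m2 c d2 * wt q v w d1 d2 e1 e2 * (column us v as' b1 hs m1
           * column us w hs b2 cs' m2))"
    by (simp add: * sum_words_Suc sum_distrib_left sum_distrib_right mult_ac)
  also have "\<dots> = (\<Sum>m1\<in>C. \<Sum>m2\<in>C. \<Sum>hs\<in>?W. \<Sum>h\<in>C. \<Sum>d1\<in>C. \<Sum>d2\<in>C.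
         wt q u v a m1 h d1 * wt q u w h m2 c d2 * wt q v w d1 d2 e1 e2 * (column us v as' b1 hs m1
           * column us w hs b2 cs' m2))"
    unfolding sum.cartesian_product
    by (rule sum.reindex_bij_witness[of _ "\<lambda>(m1,m2,hs,h,d1,d2). (d1,d2,h,hs,m2,m1)"
      "\<lambda>(d1,d2,h,hs,m2,m1). (m1,m2,hs,h,d1,d2)"]) auto
  also have "\<dots> = (\<Sum>m1\<in>C. \<Sum>m2\<in>C. \<Sum>hs\<in>?W. (column us v as' b1 hs m1 * column us w hs b2 cs' m2) *
       (\<Sum>h\<in>C. \<Sum>d1\<in>C. wt q u v a m1 h d1 * (\<Sum>d2\<in>C. wt q u w h m2 c d2 * wt q v w d1 d2 e1 e2)))"
    by (simp add: sum_distrib_left mult_ac)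
  also have "\<dots> = (\<Sum>m1\<in>C. \<Sum>m2\<in>C. \<Sum>hs\<in>?W. (column us v as' b1 hs m1 * column us w hs b2 cs' m2) *
       (\<Sum>h2\<in>C. \<Sum>m\<in>C. wt q v w m1 m2 h2 m * (\<Sum>h1\<in>C. wt q u w a m h1 e2 * wt q u v h1 h2 c e1)))"
    by (intro sum.cong refl arg_cong2[of _ _ _ _ "(*)"] yang_baxter[symmetric] finite_C) (use
      * in auto)
  also have "\<dots> = (\<Sum>m1\<in>C. \<Sum>m2\<in>C. \<Sum>hs\<in>?W. \<Sum>h2\<in>C. \<Sum>m\<in>C. \<Sum>h1\<in>C.
       (wt q u w a m h1 e2 * wt q u v h1 h2 c e1) * ((column us v as' b1 hs m1
         * column us w hs b2 cs' m2) * wt q v w m1 m2 h2 m))"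
    by (simp add: sum_distrib_left mult_ac)
  also have "\<dots> = (\<Sum>h2\<in>C. \<Sum>m\<in>C. \<Sum>h1\<in>C. \<Sum>m1\<in>C. \<Sum>m2\<in>C. \<Sum>hs\<in>?W.
       (wt q u w a m h1 e2 * wt q u v h1 h2 c e1) * ((column us v as' b1 hs m1
         * column us w hs b2 cs' m2) * wt q v w m1 m2 h2 m))"
    unfolding sum.cartesian_product
    by (rule sum.reindex_bij_witness[of _ "\<lambda>(h2,m,h1,m1,m2,hs). (m1,m2,hs,h2,m,h1)"
      "\<lambda>(m1,m2,hs,h2,m,h1). (h2,m,h1,m1,m2,hs)"]) auto
  also have "\<dots> = (\<Sum>h2\<in>C. \<Sum>m\<in>C. \<Sum>h1\<in>C. (wt q u w a m h1 e2 * wt q u v h1 h2 c e1) *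
       (\<Sum>m1\<in>C. \<Sum>m2\<in>C. (\<Sum>hs\<in>?W. column us v as' b1 hs m1 * column us w hs b2 cs' m2)
         * wt q v w m1 m2 h2 m))"
    by (simp only: sum_distrib_left sum_distrib_right)
  also have "\<dots> = (\<Sum>h2\<in>C. \<Sum>m\<in>C. \<Sum>h1\<in>C. (wt q u w a m h1 e2 * wt q u v h1 h2 c e1) *
       (\<Sum>g1\<in>C. \<Sum>g2\<in>C. wt q v w b1 b2 g1 g2 * (\<Sum>hs\<in>?W. column us w as' g2 hs m
         * column us v hs g1 cs' h2)))"
    using Cons.prems by (simp add: IH *)
  also have "\<dots> = (\<Sum>h2\<in>C. \<Sum>m\<in>C. \<Sum>h1\<in>C. \<Sum>g1\<in>C. \<Sum>g2\<in>C. \<Sum>hs\<in>?W.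
       wt q v w b1 b2 g1 g2 * (wt q u w a m h1 e2 * column us w as' g2 hs m * (wt q u v h1 h2 c e1
         * column us v hs g1 cs' h2)))"
    by (simp add: sum_distrib_left mult_ac)
  also have "\<dots> = (\<Sum>g1\<in>C. \<Sum>g2\<in>C. \<Sum>h1\<in>C. \<Sum>hs\<in>?W. \<Sum>m\<in>C. \<Sum>h2\<in>C.
       wt q v w b1 b2 g1 g2 * (wt q u w a m h1 e2 * column us w as' g2 hs m * (wt q u v h1 h2 c e1
         * column us v hs g1 cs' h2)))"
    unfolding sum.cartesian_product
    by (rule sum.reindex_bij_witness[of _ "\<lambda>(g1,g2,h1,hs,m,h2). (h2,m,h1,g1,g2,hs)"
      "\<lambda>(h2,m,h1,g1,g2,hs). (g1,g2,h1,hs,m,h2)"]) auto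
  also have "\<dots> = (\<Sum>g1\<in>C. \<Sum>g2\<in>C. wt q v w b1 b2 g1 g2 * (\<Sum>hs\<in>words (length (u # us)). column
    (u # us) w as g2 hs e2 * column (u # us) v hs g1 cs e1))"
    by (simp add: * sum_words_Suc sum_distrib_left sum_distrib_right mult_ac)
  finally show ?case .
qed

text \<open>All bottom and right boundary colours equal \<open>P\<close>; the words are the left and the top boundary.\<close>

fun grid :: "nat \<Rightarrow> 'a list \<Rightarrow> 'a list \<Rightarrow> nat list \<Rightarrow> nat list \<Rightarrow> 'a" where
  "grid P us [] as [] = (if as = replicate (length us) P then 1 else 0)"
| "grid P us (v # vs) as (d # ds) = (\<Sum>hs\<in>words (length us). column us v as P hs d
  * grid P us vs hs ds)"
| "grid _ _ _ _ _ = 0"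

lemma sum_words_two:
  "(\<Sum>w\<in>words (m + 2 + n). f w) = (\<Sum>as\<in>words m. \<Sum>a1\<in>C. \<Sum>a2\<in>C. \<Sum>bs\<in>words n. f (as @ a1 # a2 # bs))"
proof -
  have "m + 2 + n = m + Suc (Suc n)" by simp
  thus ?thesis by (simp only: sum_words_add sum_words_Suc)
qed

lemma eq_replicate_iff: "as = replicate n P \<longleftrightarrow> length as = n \<and> (\<forall>x\<in>set as. x = P)"
  by (metis in_set_replicate length_replicate replicate_eqI)

lemma wt_equal: "wt q v w P P a b = (if a = P \<and> b = P then v - q * w else 0)"
  by (simp add: wt_def)

text \<open>At the right boundary both rows carry \<open>P\<close>, so the crossing
  \<open>R(x, y)\<close> acts there as the scalar \<open>x - q * y\<close>. It can be inserted at
  that end and pushed to the left through every column, which interchanges the two rows.\<close>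

lemma grid_row_exchange:
  assumes "P \<in> C" "length as = length xs" "length as' = length ys" "a1 \<in> C" "a2 \<in> C"
    and "set ds \<subseteq> C" "length ds = length vs"
  shows "(x - q * y) * grid P (xs @ x # y # ys) vs (as @ a1 # a2 # as') ds
       = (\<Sum>g1\<in>C. \<Sum>g2\<in>C. wt q x y a1 a2 g1 g2 * grid P (xs @ y # x # ys) vs (as @ g2 # g1 # as') ds)"
  using assms(2-)
proof (induction vs arbitrary: as as' a1 a2 ds)
  case Nil
  let ?A = "as = replicate (length xs) P \<and> as' = replicate (length ys) P"
  have eq: "grid P (xs @ x' # y' # ys) [] (as @ b1 # b2 # as') [] = (if b1 = P \<and> b2
    = P \<and> ?A then 1 else 0)" for b1 b2 x' y'
    using Nil by (auto simp del: replicate_Suc simp add: eq_replicate_iff)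
  have "(\<Sum>g1\<in>C. \<Sum>g2\<in>C. wt q x y a1 a2 g1 g2 * grid P (xs @ y # x # ys) [] (as @ g2 # g1 # as') [])
      = pass q x y a1 a2 * (if a2 = P \<and> a1 = P \<and> ?A then 1 else 0)
        + swap q x y a1 a2 * (if a1 = P \<and> a2 = P \<and> ?A then 1 else 0)"
    unfolding eq using Nil by (subst sum_wt) (simp_all add: finite_C)
  also have "\<dots> = (x - q * y) * grid P (xs @ x # y # ys) [] (as @ a1 # a2 # as') []"
    unfolding eq by (simp add: pass_def)
  finally show ?case using Nil by simp
next
  case (Cons v vs)
  then obtain d ds' where ds: "ds = d # ds'" by (metis length_Suc_conv)
  have d: "d \<in> C" "set ds' \<subseteq> C" "length ds' = length vs" using Cons.prems ds by auto
  let ?W = "words (length xs)" and ?W' = "words (length ys)"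
  have len: "length (xs @ x # y # ys) = length xs + 2 + length ys" for x y by simp
  have "(x - q * y) * grid P (xs @ x # y # ys) (v # vs) (as @ a1 # a2 # as') ds
     = (\<Sum>hs\<in>?W. \<Sum>h1\<in>C. \<Sum>h2\<in>C. \<Sum>hs'\<in>?W'. column (xs @ x # y # ys) v (as @ a1 # a2 # as') P (hs
       @ h1 # h2 # hs') d *
         ((x - q * y) * grid P (xs @ x # y # ys) vs (hs @ h1 # h2 # hs') ds'))"
    unfolding ds grid.simps len sum_words_two by (simp add: sum_distrib_left mult_ac)
  also have "\<dots> = (\<Sum>hs\<in>?W. \<Sum>h1\<in>C. \<Sum>h2\<in>C. \<Sum>hs'\<in>?W'. column (xs @ x # y # ys) v (as @ a1 # a2 # as') P
    (hs @ h1 # h2 # hs') d *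
         (\<Sum>g1\<in>C. \<Sum>g2\<in>C. wt q x y h1 h2 g1 g2 * grid P (xs @ y # x # ys) vs (hs
           @ g2 # g1 # hs') ds'))"
    by (intro sum.cong refl arg_cong2[of _ _ _ _ "(*)"] Cons.IH) (use d in \<open>auto simp: words_def\<close>)
  also have "\<dots> = (\<Sum>hs\<in>?W. \<Sum>h1\<in>C. \<Sum>h2\<in>C. \<Sum>hs'\<in>?W'. \<Sum>g1\<in>C. \<Sum>g2\<in>C.
         grid P (xs @ y # x # ys) vs (hs @ g2 # g1 # hs') ds' *
         (column (xs @ x # y # ys) v (as @ a1 # a2 # as') P (hs @ h1 # h2 # hs') d
           * wt q x y h1 h2 g1 g2))"
    by (simp add: sum_distrib_left mult_ac)
  also have "\<dots> = (\<Sum>hs\<in>?W. \<Sum>g2\<in>C. \<Sum>g1\<in>C. \<Sum>hs'\<in>?W'. \<Sum>h1\<in>C. \<Sum>h2\<in>C.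
         grid P (xs @ y # x # ys) vs (hs @ g2 # g1 # hs') ds' *
         (column (xs @ x # y # ys) v (as @ a1 # a2 # as') P (hs @ h1 # h2 # hs') d
           * wt q x y h1 h2 g1 g2))"
    unfolding sum.cartesian_product
    by (rule sum.reindex_bij_witness[of _ "\<lambda>(hs,g2,g1,hs',h1,h2). (hs,h1,h2,hs',g1,g2)"
      "\<lambda>(hs,h1,h2,hs',g1,g2). (hs,g2,g1,hs',h1,h2)"]) auto
  also have "\<dots> = (\<Sum>hs\<in>?W. \<Sum>g2\<in>C. \<Sum>g1\<in>C. \<Sum>hs'\<in>?W'. grid P (xs @ y # x # ys) vs (hs
    @ g2 # g1 # hs') ds' *
         (\<Sum>h1\<in>C. \<Sum>h2\<in>C. column (xs @ x # y # ys) v (as @ a1 # a2 # as') P (hs @ h1 # h2 # hs') d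
           * wt q x y h1 h2 g1 g2))"
    by (simp only: sum_distrib_left)
  also have "\<dots> = (\<Sum>hs\<in>?W. \<Sum>g2\<in>C. \<Sum>g1\<in>C. \<Sum>hs'\<in>?W'. grid P (xs @ y # x # ys) vs (hs
    @ g2 # g1 # hs') ds' *
         (\<Sum>h1\<in>C. \<Sum>h2\<in>C. wt q x y a1 a2 h1 h2 * column (xs @ y # x # ys) v (as @ h2 # h1 # as') P (hs
           @ g2 # g1 # hs') d))"
    by (intro sum.cong refl arg_cong2[of _ _ _ _ "(*)"] column_row_exchange)
      (use Cons.prems d in \<open>auto simp: words_def\<close>)
  also have "\<dots> = (\<Sum>hs\<in>?W. \<Sum>g2\<in>C. \<Sum>g1\<in>C. \<Sum>hs'\<in>?W'. \<Sum>h1\<in>C. \<Sum>h2\<in>C. wt q x y a1 a2 h1 h2 *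
         (column (xs @ y # x # ys) v (as @ h2 # h1 # as') P (hs @ g2 # g1 # hs') d * grid P (xs
           @ y # x # ys) vs (hs @ g2 # g1 # hs') ds'))"
    by (simp add: sum_distrib_left mult_ac)
  also have "\<dots> = (\<Sum>h1\<in>C. \<Sum>h2\<in>C. \<Sum>hs\<in>?W. \<Sum>g2\<in>C. \<Sum>g1\<in>C. \<Sum>hs'\<in>?W'. wt q x y a1 a2 h1 h2 *
         (column (xs @ y # x # ys) v (as @ h2 # h1 # as') P (hs @ g2 # g1 # hs') d * grid P (xs
           @ y # x # ys) vs (hs @ g2 # g1 # hs') ds'))"
    unfolding sum.cartesian_product
    by (rule sum.reindex_bij_witness[of _ "\<lambda>(h1,h2,hs,g2,g1,hs'). (hs,g2,g1,hs',h1,h2)"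
      "\<lambda>(hs,g2,g1,hs',h1,h2). (h1,h2,hs,g2,g1,hs')"]) auto
  also have "\<dots> = (\<Sum>g1\<in>C. \<Sum>g2\<in>C. wt q x y a1 a2 g1 g2 * grid P (xs @ y # x # ys) (v # vs) (as
    @ g2 # g1 # as') ds)"
    unfolding ds grid.simps len sum_words_two by (simp add: sum_distrib_left)
  finally show ?case .
qed

text \<open>Dual to the exchange of rows: the crossing is pushed down from the top edges and meets
  the bottom colours \<open>P\<close>, \<open>P\<close>, where it is the scalar
  \<open>v - q * w\<close>.\<close>

lemma grid_column_exchange:
  assumes "P \<in> C" "length as = length us" "set as \<subseteq> C" "length ds = length vs"
  shows "(\<Sum>d1\<in>C. \<Sum>d2\<in>C. grid P us (vs @ v # w # ws) as (ds @ d1 # d2 # ds') * wt q v w d1 d2 e1 e2)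
       = (v - q * w) * grid P us (vs @ w # v # ws) as (ds @ e2 # e1 # ds')"
  using assms(2-)
proof (induction vs arbitrary: as ds)
  case Nil
  let ?W = "words (length us)"
  have "(\<Sum>d1\<in>C. \<Sum>d2\<in>C. grid P us (v # w # ws) as (d1 # d2 # ds') * wt q v w d1 d2 e1 e2)
    = (\<Sum>d1\<in>C. \<Sum>d2\<in>C. \<Sum>hs\<in>?W. \<Sum>hs'\<in>?W. grid P us ws hs' ds' * (column us v as P hs d1
      * column us w hs P hs' d2 * wt q v w d1 d2 e1 e2))"
    by (simp add: sum_distrib_left mult_ac)
  also have "\<dots> = (\<Sum>hs'\<in>?W. \<Sum>d1\<in>C. \<Sum>d2\<in>C. \<Sum>hs\<in>?W. grid P us ws hs' ds' * (column us v as P hs d1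
    * column us w hs P hs' d2 * wt q v w d1 d2 e1 e2))"
    by (rule sum_swap4')
  also have "\<dots> = (\<Sum>hs'\<in>?W. grid P us ws hs' ds' * (\<Sum>d1\<in>C. \<Sum>d2\<in>C. (\<Sum>hs\<in>?W. column us v as P hs d1
    * column us w hs P hs' d2) * wt q v w d1 d2 e1 e2))"
    by (simp only: sum_distrib_left sum_distrib_right)
  also have "\<dots> = (\<Sum>hs'\<in>?W. grid P us ws hs' ds' * (\<Sum>g1\<in>C. \<Sum>g2\<in>C. wt q v w P P g1 g2 *
    (\<Sum>hs\<in>?W. column us w as g2 hs e2 * column us v hs g1 hs' e1)))"
    by (intro sum.cong refl arg_cong2[of _ _ _ _ "(*)"] column_pair_exchange)
      (use assms Nil in \<open>auto simp: words_def\<close>)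
  also have "\<dots> = (\<Sum>hs'\<in>?W. grid P us ws hs' ds' * ((v - q * w) * (\<Sum>hs\<in>?W. column us w as P hs e2
    * column us v hs P hs' e1)))"
    using assms(1) by (simp add: sum_wt finite_C pass_def)
  also have "\<dots> = (\<Sum>hs'\<in>?W. \<Sum>hs\<in>?W. (v - q * w) * (column us w as P hs e2 * (column us v hs P hs' e1
    * grid P us ws hs' ds')))"
    by (simp add: sum_distrib_left mult_ac)
  also have "\<dots> = (\<Sum>hs\<in>?W. \<Sum>hs'\<in>?W. (v - q * w) * (column us w as P hs e2 * (column us v hs P hs' e1
    * grid P us ws hs' ds')))"
    by (rule sum.swap)
  also have "\<dots> = (v - q * w) * grid P us (w # v # ws) as (e2 # e1 # ds')"
    by (simp add: sum_distrib_left)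
  finally show ?case using Nil by simp
next
  case (Cons x vs)
  then obtain d ds1 where ds: "ds = d # ds1" "length ds1 = length vs" by (metis length_Suc_conv)
  let ?W = "words (length us)"
  have "(\<Sum>d1\<in>C. \<Sum>d2\<in>C. grid P us ((x # vs) @ v # w # ws) as (ds @ d1 # d2 # ds')
    * wt q v w d1 d2 e1 e2)
    = (\<Sum>d1\<in>C. \<Sum>d2\<in>C. \<Sum>hs\<in>?W. column us x as P hs d * (grid P us (vs @ v # w # ws) hs (ds1
      @ d1 # d2 # ds') * wt q v w d1 d2 e1 e2))"
    by (simp add: ds sum_distrib_left mult_ac)
  also have "\<dots> = (\<Sum>hs\<in>?W. \<Sum>d1\<in>C. \<Sum>d2\<in>C. column us x as P hs d * (grid P us (vs @ v # w # ws) hs (ds1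
    @ d1 # d2 # ds') * wt q v w d1 d2 e1 e2))"
    unfolding sum.cartesian_product
    by (rule sum.reindex_bij_witness[of _ "\<lambda>(d, a, b). (a, b, d)" "\<lambda>(a, b, d). (d, a, b)"]) auto
  also have "\<dots> = (\<Sum>hs\<in>?W. column us x as P hs d * ((v - q * w) * grid P us (vs @ w # v # ws) hs (ds1
    @ e2 # e1 # ds')))"
    unfolding sum_distrib_left[symmetric]
    by (intro sum.cong refl arg_cong2[of _ _ _ _ "(*)"] Cons.IH) (use ds in \<open>auto simp: words_def\<close>)
  also have "\<dots> = (v - q * w) * grid P us ((x # vs) @ w # v # ws) as (ds @ e2 # e1 # ds')"
    by (simp add: ds sum_distrib_left mult_ac)
  finally show ?case .
qed

text \<open>A vertex with \<open>P\<close> on the left and at the bottom must have \<open>P\<close>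
  on the right and on top. Hence the whole bottom row is forced, and the grid above it again has
  bottom colour \<open>P\<close>.\<close>

lemma grid_frozen_row:
  assumes "P \<in> C" "length as = length xs" "set ds \<subseteq> C" "length ds = length vs"
  shows "grid P (xs @ [z]) vs (as @ [P]) ds = (\<Prod>v\<leftarrow>vs. z - q * v) * grid P xs vs as ds"
  using assms(2-)
proof (induction vs arbitrary: as ds)
  case Nil
  thus ?case by (simp add: eq_replicate_iff del: replicate_Suc)
next
  case (Cons v vs)
  then obtain d ds' where ds: "ds = d # ds'" "length ds' = length vs" "d \<in> C" "set ds' \<subseteq> C"
    by (cases ds) auto
  let ?W = "words (length xs)"
  have "grid P (xs @ [z]) (v # vs) (as @ [P]) ds
      = (\<Sum>hs\<in>?W. \<Sum>h\<in>C. column (xs @ [z]) v (as @ [P]) P (hs @ [h]) d * grid P (xs @ [z]) vs (hs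
        @ [h]) ds')"
    using sum_words_add[where m="length xs" and n=1] by (simp add: ds sum_words_Suc)
  also have "\<dots> = (\<Sum>hs\<in>?W. \<Sum>h\<in>C. if h = P then (z - q * v) * column xs v as P hs d * grid P (xs
    @ [z]) vs (hs @ [h]) ds' else 0)"
  proof (intro sum.cong refl)
    fix hs h assume *: "hs \<in> ?W" "h \<in> C"
    have "column (xs @ [z]) v (as @ [P]) P (hs @ [h]) d = (\<Sum>m\<in>C. if m = P then (if h = P then (z - q
      * v) * column xs v as P hs d else 0) else 0)"
      by (subst column_snoc) (use
        * assms Cons.prems ds in \<open>auto simp: words_def wt_equal intro!: sum.cong\<close>)
    also have "\<dots> = (if h = P then (z - q * v) * column xs v as P hs d else 0)"
      using assms finite_C by simp
    finally show "column (xs @ [z]) v (as @ [P]) P (hs @ [h]) d * grid P (xs @ [z]) vs (hs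
      @ [h]) ds'
       = (if h = P then (z - q * v) * column xs v as P hs d * grid P (xs @ [z]) vs (hs
         @ [h]) ds' else 0)" by simp
  qed
  also have "\<dots> = (\<Sum>hs\<in>?W. (z - q * v) * column xs v as P hs d * grid P (xs @ [z]) vs (hs
    @ [P]) ds')"
    using assms finite_C by simp
  also have "\<dots> = (\<Sum>hs\<in>?W. (z - q * v) * column xs v as P hs d * ((\<Prod>v\<leftarrow>vs. z - q * v)
    * grid P xs vs hs ds'))"
    by (intro sum.cong refl arg_cong2[of _ _ _ _ "(*)"] Cons.IH) (use ds in \<open>auto simp: words_def\<close>)
  also have "\<dots> = (\<Prod>v\<leftarrow>v # vs. z - q * v) * grid P xs (v # vs) as ds"
    by (simp add: ds sum_distrib_left mult_ac)
  finally show ?case .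
qed

text \<open>\<open>R(z, z)\<close> is \<open>(1 - q) * z\<close> times the flip: the bottom colour
  \<open>P\<close> leaves to the right, and the left colour \<open>a\<close> goes up and becomes the
  bottom colour of the rest of the column.\<close>

lemma column_crossing_row:
  assumes "P \<in> C" "a \<in> C" "length as = length xs" "length hs = length xs" "d \<in> C"
  shows "column (xs @ [z]) z (as @ [a]) P (hs @ [h]) d = (if h = P then (1 - q) * z
    * column xs z as a hs d else 0)"
proof -
  have wt: "wt q z z a P h m = (if m = a then if h = P then (1 - q) * z else 0 else 0)" for m
    by (cases "a = P"; cases "h = P"; cases "m
      = a") (auto simp: wt_pass_swap pass_def swap_def algebra_simps)
  have "column (xs @ [z]) z (as @ [a]) P (hs @ [h]) d
     = (\<Sum>m\<in>C. if m = a then column xs z as a hs d * (if h = P then (1 - q) * z else 0) else 0)"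
    by (subst column_snoc) (use assms in \<open>auto simp: wt intro!: sum.cong sum.neutral\<close>)
  thus ?thesis using assms finite_C by simp
qed

section \<open>A single layer\<close>

text \<open>The factor \<open>v - q * w\<close> is the eigenvalue of \<open>R(v, w)\<close> on equal
  colours, which is what a crossing leaves behind at a boundary of constant colour.\<close>

definition exchangeable :: "('a list \<Rightarrow> nat list \<Rightarrow> 'a) \<Rightarrow> bool" where
  "exchangeable F \<longleftrightarrow> (\<forall>xs ys v w as bs. \<forall>e1\<in>C. \<forall>e2\<in>C.
     as \<in> words (length xs) \<longrightarrow> bs \<in> words (length ys) \<longrightarrow>
     (\<Sum>d1\<in>C. \<Sum>d2\<in>C. F (xs @ v # w # ys) (as @ d1 # d2 # bs) * wt q v w d1 d2 e1 e2)
       = (v - q * w) * F (xs @ w # v # ys) (as @ e2 # e1 # bs))"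

text \<open>For a layer with boundary colour \<open>P\<close> this says that \<open>P\<close> never
  enters from the left, so inside a column it can only come from below.\<close>

definition supported_below :: "nat \<Rightarrow> ('a list \<Rightarrow> nat list \<Rightarrow> 'a) \<Rightarrow> bool" where
  "supported_below P F \<longleftrightarrow> (\<forall>xs as. as \<in> words (length xs) \<longrightarrow> F xs as \<noteq> 0 \<longrightarrow> set as \<subseteq> {..<P})"

definition layer :: "nat \<Rightarrow> ('a list \<Rightarrow> nat list \<Rightarrow> 'a) \<Rightarrow> 'a list \<Rightarrow> 'a list \<Rightarrow> nat list \<Rightarrow> 'a" where
  "layer P F us vs ds = (\<Sum>as\<in>words (length us). F us as * grid P us vs as ds)"

lemma sum_words_snoc: "(\<Sum>w\<in>words (Suc n). f w) = (\<Sum>w\<in>words n. \<Sum>a\<in>C. f (w @ [a]))"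
  using sum_words_add[where m = n and n = 1] by (simp add: sum_words_Suc)

text \<open>The lowest vertex of the column involves the last variable of \<open>xs\<close> and the
  colour of \<open>z\<close>, which are neighbours in \<open>F\<close>. The exchange relation
  absorbs this vertex and moves \<open>z\<close> one place to the left; repeating this brings
  \<open>z\<close> to the front, with the top colour of the column.\<close>

lemma exchangeable_carry:
  assumes F: "exchangeable F" and "hs \<in> words (length xs)" "bs \<in> words (length ys)" "c \<in> C"
  shows "(\<Sum>as\<in>words (length xs). \<Sum>a\<in>C. F (xs @ z # ys) (as @ a # bs) * column xs z as a hs c)
       = (\<Prod>x\<leftarrow>xs. x - q * z) * F (z # xs @ ys) (c # hs @ bs)"
  using assms(2-)
proof (induction xs arbitrary: hs ys bs rule: rev_induct)
  case Nil
  have "(\<Sum>a\<in>C. F (z # ys) (a # bs) * (if a = c then 1 else 0)) = (\<Sum>a\<in>C. if a = c then F (z # ys)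
    (a # bs) else 0)"
    by (intro sum.cong) auto
  with Nil show ?case using finite_C by simp
next
  case (snoc x xs)
  obtain hs' g where hs: "hs = hs' @ [g]"
    using snoc.prems(1) by (cases hs rule: rev_cases) (auto simp: words_def)
  have *: "hs' \<in> words (length xs)" "g \<in> C" using snoc.prems hs by (auto simp: words_def)
  let ?W = "words (length xs)"
  have "(\<Sum>as\<in>words (length (xs @ [x])). \<Sum>a\<in>C. F ((xs @ [x]) @ z # ys) (as @ a # bs) * column (xs
    @ [x]) z as a hs c)
    = (\<Sum>as\<in>?W. \<Sum>a'\<in>C. \<Sum>a\<in>C. F (xs @ x # z # ys) (as @ a' # a # bs) *
        (\<Sum>m\<in>C. column xs z as m hs' c * wt q x z a' a g m))"
    unfolding hs length_append_singleton sum_words_snoc append_assoc append_Cons append_Nil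
    by (intro sum.cong refl arg_cong2[of _ _ _ _ "(*)"] column_snoc) (use
      * snoc.prems in \<open>auto simp: words_def\<close>)
  also have "\<dots> = (\<Sum>as\<in>?W. \<Sum>a'\<in>C. \<Sum>a\<in>C. \<Sum>m\<in>C. column xs z as m hs' c * (F (xs @ x # z # ys) (as
    @ a' # a # bs) * wt q x z a' a g m))"
    by (simp add: sum_distrib_left mult_ac)
  also have "\<dots> = (\<Sum>as\<in>?W. \<Sum>m\<in>C. \<Sum>a'\<in>C. \<Sum>a\<in>C. column xs z as m hs' c * (F (xs @ x # z # ys) (as
    @ a' # a # bs) * wt q x z a' a g m))"
    unfolding sum.cartesian_product
    by (rule sum.reindex_bij_witness[of _ "\<lambda>(as,m,a',a). (as,a',a,m)" "\<lambda>(as,a',a,m).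
      (as,m,a',a)"]) auto
  also have "\<dots> = (\<Sum>as\<in>?W. \<Sum>m\<in>C. column xs z as m hs' c * ((x - q * z) * F (xs @ z # x # ys) (as
    @ m # g # bs)))"
    unfolding sum_distrib_left[symmetric]
    by (intro sum.cong refl arg_cong2[of _ _ _ _ "(*)"] F[unfolded exchangeable_def, rule_format])
      (use * snoc.prems in auto)
  also have "\<dots> = (x - q * z) * (\<Sum>as\<in>?W. \<Sum>m\<in>C. F (xs @ z # x # ys) (as @ m # g # bs)
    * column xs z as m hs' c)"
    by (simp add: sum_distrib_left mult_ac)
  also have "\<dots> = (x - q * z) * ((\<Prod>x\<leftarrow>xs. x - q * z) * F (z # xs @ x # ys) (c # hs' @ g # bs))"
    by (subst snoc.IH) (use * snoc.prems in \<open>auto simp: words_def\<close>)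
  finally show ?case by (simp add: hs mult_ac)
qed

text \<open>The crossing \<open>R(x, y)\<close> produced by the grid is handed over to
  \<open>F\<close>, which absorbs it. Both exchanges cost the same scalar \<open>x - q * y\<close>,
  and cancelling it is where \<open>x \<noteq> q * y\<close> enters.\<close>

lemma layer_swap:
  assumes F: "exchangeable F" and "P \<in> C" "x \<noteq> q * y" "ds \<in> words (length vs)"
  shows "layer P F (xs @ x # y # ys) vs ds = layer P F (xs @ y # x # ys) vs ds"
proof -
  let ?W = "words (length xs)" and ?W' = "words (length ys)"
  have len: "length (xs @ x # y # ys) = length xs + 2 + length ys" for x y by simp
  have "(x - q * y) * layer P F (xs @ x # y # ys) vs ds
     = (\<Sum>as\<in>?W. \<Sum>a1\<in>C. \<Sum>a2\<in>C. \<Sum>bs\<in>?W'. F (xs @ x # y # ys) (as @ a1 # a2 # bs) *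
         ((x - q * y) * grid P (xs @ x # y # ys) vs (as @ a1 # a2 # bs) ds))"
    unfolding layer_def len sum_words_two by (simp add: sum_distrib_left mult_ac)
  also have "\<dots> = (\<Sum>as\<in>?W. \<Sum>a1\<in>C. \<Sum>a2\<in>C. \<Sum>bs\<in>?W'. F (xs @ x # y # ys) (as @ a1 # a2 # bs) *
         (\<Sum>g1\<in>C. \<Sum>g2\<in>C. wt q x y a1 a2 g1 g2 * grid P (xs @ y # x # ys) vs (as @ g2 # g1 # bs) ds))"
    by (intro sum.cong refl arg_cong2[of _ _ _ _ "(*)"] grid_row_exchange)
      (use assms in \<open>auto simp: words_def\<close>)
  also have "\<dots> = (\<Sum>as\<in>?W. \<Sum>a1\<in>C. \<Sum>a2\<in>C. \<Sum>bs\<in>?W'. \<Sum>g1\<in>C. \<Sum>g2\<in>C. grid P (xs @ y # x # ys) vs (as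
    @ g2 # g1 # bs) ds *
         (F (xs @ x # y # ys) (as @ a1 # a2 # bs) * wt q x y a1 a2 g1 g2))"
    by (simp add: sum_distrib_left mult_ac)
  also have "\<dots> = (\<Sum>as\<in>?W. \<Sum>g2\<in>C. \<Sum>g1\<in>C. \<Sum>bs\<in>?W'. \<Sum>a1\<in>C. \<Sum>a2\<in>C. grid P (xs @ y # x # ys) vs (as
    @ g2 # g1 # bs) ds *
         (F (xs @ x # y # ys) (as @ a1 # a2 # bs) * wt q x y a1 a2 g1 g2))"
    unfolding sum.cartesian_product
    by (rule sum.reindex_bij_witness[of _ "\<lambda>(as,g2,g1,bs,a1,a2). (as,a1,a2,bs,g1,g2)"
      "\<lambda>(as,a1,a2,bs,g1,g2). (as,g2,g1,bs,a1,a2)"]) auto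
  also have "\<dots> = (\<Sum>as\<in>?W. \<Sum>g2\<in>C. \<Sum>g1\<in>C. \<Sum>bs\<in>?W'. grid P (xs @ y # x # ys) vs (as @ g2 # g1 # bs) ds
    *
         ((x - q * y) * F (xs @ y # x # ys) (as @ g2 # g1 # bs)))"
    unfolding sum_distrib_left[symmetric]
    by (intro sum.cong refl arg_cong2[of _ _ _ _
      "(*)"] F[unfolded exchangeable_def, rule_format]) auto
  also have "\<dots> = (x - q * y) * layer P F (xs @ y # x # ys) vs ds"
    unfolding layer_def len sum_words_two by (simp add: sum_distrib_left mult_ac)
  finally show ?thesis using assms by simp
qed

lemma layer_move:
  assumes "exchangeable F" "P \<in> C" "\<And>y. y \<in> set ys \<Longrightarrow> z \<noteq> q * y" "ds \<in> words (length vs)"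
  shows "layer P F (xs @ z # ys) vs ds = layer P F (xs @ ys @ [z]) vs ds"
  using assms(3)
proof (induction ys arbitrary: xs)
  case (Cons y ys)
  have "layer P F (xs @ z # y # ys) vs ds = layer P F ((xs @ [y]) @ z # ys) vs ds"
    using layer_swap[OF assms(1,2) _ assms(4)] Cons.prems by simp
  thus ?case using Cons.IH[of "xs @ [y]"] Cons.prems by simp
qed simp

text \<open>Column and bottom row share the variable \<open>z\<close>, so they meet in a flip.
  \<open>P\<close> leaves to the right and freezes that row, giving \<open>z - q * v\<close> for
  each further column; the colour of the row goes up into the column, which then carries
  \<open>z\<close> to the front of \<open>F\<close>.\<close>

lemma layer_at_node:
  assumes F: "exchangeable F" and "P \<in> C" "c \<in> C" "ds \<in> words (length vs)"
  shows "layer P F (xs @ [z]) (z # vs) (c # ds)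
       = (1 - q) * z * (\<Prod>v\<leftarrow>vs. z - q * v) * (\<Prod>x\<leftarrow>xs. x - q * z) * layer P (\<lambda>ys as. F (z # ys)
         (c # as)) xs vs ds"
proof -
  let ?W = "words (length xs)"
  have grid: "grid P (xs @ [z]) (z # vs) (as @ [a]) (c # ds)
     = (\<Sum>hs\<in>?W. (1 - q) * z * column xs z as a hs c * ((\<Prod>v\<leftarrow>vs. z - q * v) * grid P xs vs hs ds))"
    if "as \<in> ?W" "a \<in> C" for as a
  proof -
    have "grid P (xs @ [z]) (z # vs) (as @ [a]) (c # ds)
      = (\<Sum>hs\<in>?W. \<Sum>h\<in>C. (if h = P then (1 - q) * z * column xs z as a hs c else 0) * grid P (xs
        @ [z]) vs (hs @ [h]) ds)"
      unfolding grid.simps length_append_singleton sum_words_snoc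
      by (intro sum.cong refl arg_cong2[of _ _ _ _ "(*)"] column_crossing_row)
        (use that assms in \<open>auto simp: words_def\<close>)
    also have "\<dots> = (\<Sum>hs\<in>?W. \<Sum>h\<in>C. if h = P then (1 - q) * z * column xs z as a hs c * grid P (xs
      @ [z]) vs (hs @ [P]) ds else 0)"
      by (intro sum.cong refl) auto
    also have "\<dots> = (\<Sum>hs\<in>?W. (1 - q) * z * column xs z as a hs c * grid P (xs @ [z]) vs (hs
      @ [P]) ds)"
      using assms finite_C by simp
    also have "\<dots> = (\<Sum>hs\<in>?W. (1 - q) * z * column xs z as a hs c * ((\<Prod>v\<leftarrow>vs. z - q * v)
      * grid P xs vs hs ds))"
      by (intro sum.cong refl arg_cong2[of _ _ _ _ "(*)"] grid_frozen_row)
        (use assms in \<open>auto simp: words_def\<close>)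
    finally show ?thesis .
  qed
  let ?K = "(1 - q) * z * (\<Prod>v\<leftarrow>vs. z - q * v)"
  have "layer P F (xs @ [z]) (z # vs) (c # ds) = (\<Sum>as\<in>?W. \<Sum>a\<in>C. \<Sum>hs\<in>?W.
      ?K * grid P xs vs hs ds * (F (xs @ [z]) (as @ [a]) * column xs z as a hs c))"
    unfolding layer_def length_append_singleton sum_words_snoc
    by (simp add: grid sum_distrib_left mult_ac del: grid.simps)
  also have "\<dots> = (\<Sum>hs\<in>?W. \<Sum>as\<in>?W. \<Sum>a\<in>C. ?K * grid P xs vs hs ds * (F (xs @ [z]) (as @ [a])
    * column xs z as a hs c))"
    unfolding sum.cartesian_product
    by (rule sum.reindex_bij_witness[of _ "\<lambda>(d, a, b). (a, b, d)" "\<lambda>(a, b, d). (d, a, b)"]) auto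
  also have "\<dots> = (\<Sum>hs\<in>?W. ?K * grid P xs vs hs ds * ((\<Prod>x\<leftarrow>xs. x - q * z) * F (z # xs) (c # hs)))"
    unfolding sum_distrib_left[symmetric]
    using exchangeable_carry[OF F, where ys = "[]" and bs = "[]"] assms
    by (intro sum.cong refl arg_cong2[of _ _ _ _ "(*)"]) auto
  also have "\<dots> = ?K * (\<Prod>x\<leftarrow>xs. x - q * z) * layer P (\<lambda>ys as. F (z # ys) (c # as)) xs vs ds"
    unfolding layer_def by (simp add: sum_distrib_left mult_ac)
  finally show ?thesis .
qed

text \<open>With \<open>P\<close> on top and a left colour below \<open>P\<close>, a vertex cannot
  exchange its colours. Reading from the top, \<open>P\<close> therefore continues down the column
  and every left colour crosses it unchanged.\<close>

lemma column_pass: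
  assumes "P \<in> C" "set as \<subseteq> {..<P}" "length as = length us" "length hs = length us"
  shows "column us v as P hs P = (if hs = as then (\<Prod>u\<leftarrow>us. u - v) else 0)"
  using assms(2-)
proof (induction us arbitrary: as hs)
  case (Cons u us)
  then obtain a as' h hs' where *: "as = a # as'" "hs = h # hs'"
    by (metis length_Suc_conv)
  have wt: "wt q u v a m h P = (if m = P then if h = a then u - v else 0 else 0)" for m
    using Cons.prems by (auto simp: * wt_pass_swap pass_def)
  have "column (u # us) v as P hs P = (\<Sum>m\<in>C. if m = P then (if h = a then u - v else 0)
    * column us v as' P hs' P else 0)"
    unfolding * column.simps wt by (intro sum.cong refl) auto
  also have "\<dots> = (if h = a then u - v else 0) * column us v as' P hs' P"
    using assms finite_C by simp
  finally show ?case using Cons.IH[of as' hs'] Cons.prems * by auto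
qed simp

lemma layer_pass:
  assumes "supported_below P F" "P \<in> C"
  shows "layer P F us (v # vs) (P # ds) = (\<Prod>u\<leftarrow>us. u - v) * layer P F us vs ds"
proof -
  let ?W = "words (length us)"
  have "F us as * grid P us (v # vs) as (P # ds) = (\<Prod>u\<leftarrow>us. u - v) * (F us as * grid P us vs as ds)"
    if as: "as \<in> ?W" for as
  proof (cases "F us as = 0")
    case False
    hence "set as \<subseteq> {..<P}" using assms as by (auto simp: supported_below_def)
    hence "grid P us (v # vs) as (P # ds) = (\<Sum>hs\<in>?W. if hs = as then (\<Prod>u\<leftarrow>us. u - v)
      * grid P us vs as ds else 0)"
      using as assms unfolding grid.simps by (intro sum.cong refl)
        (auto simp: column_pass words_def)
    thus ?thesis using as by simp
  qed auto
  thus ?thesis unfolding layer_def sum_distrib_left by (intro sum.cong) auto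
qed

section \<open>Degree in the column variable and interpolation\<close>

lemma wt_poly_below: "poly_below 2 (\<lambda>v. wt q x v a b c d)"
  using poly_below_linear[of x "-q"] poly_below_linear[of "q * x" "-q"] poly_below_linear[of x "-1"]
    poly_below_linear[of "(1 - q) * x" 0] poly_below_linear[of 0 "1 - q"]
  by (cases "c = a"; cases "d = b"; cases "a = b"; cases "b < a"; cases "c = b"; cases "d
    = a"; cases "a < c")
    (simp_all add: wt_def algebra_simps)

lemma column_poly_below: "poly_below (Suc (length us)) (\<lambda>v. column us v as b hs d)"
proof (induction us arbitrary: as hs d)
  case Nil
  show ?case by (cases as; cases hs) (auto intro: poly_below_const)
next
  case (Cons u us)
  show ?case
  proof (cases as; cases hs)
    fix a as' h hs' assume "as = a # as'" "hs = h # hs'"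
    moreover have "poly_below (1 + Suc (length us)) (\<lambda>v. wt q u v a m h d
      * column us v as' b hs' m)" for m
      using Cons.IH wt_poly_below by (intro poly_below_mult) (auto simp: numeral_2_eq_2)
    ultimately show ?thesis by (auto intro!: poly_below_sum)
  qed auto
qed

text \<open>Going down from the top colour to the bottom colour \<open>P\<close>, some vertex has
  another colour above and \<open>P\<close> below. It must exchange, with a left colour below
  \<open>P\<close> and \<open>P\<close> on the right, so its weight \<open>(1 - q) * u\<close> is
  free of \<open>v\<close> and one degree is lost.\<close>

lemma column_poly_below_turn:
  assumes "set as \<subseteq> {..<P}" "d \<noteq> P"
  shows "poly_below (length us) (\<lambda>v. column us v as P hs d)"
  using assms
proof (induction us arbitrary: as hs d)
  case Nil
  thus ?case by (cases as; cases hs) auto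
next
  case (Cons u us)
  show ?case
  proof (cases as; cases hs)
    fix a as' h hs' assume *: "as = a # as'" "hs = h # hs'"
    have "poly_below (Suc (length us)) (\<lambda>v. wt q u v a m h d * column us v as' P hs' m)" for m
    proof (cases "m = P")
      case True
      have "wt q u v a m h d = (if h = P \<and> d = a then (1 - q) * u else 0)" for v
        using True Cons.prems by (cases "h = P"; cases "d = a") (auto simp: wt_def *)
      thus ?thesis using column_poly_below by (auto intro: poly_below_cmult)
    next
      case False
      have "poly_below (1 + length us) (\<lambda>v. wt q u v a m h d * column us v as' P hs' m)"
        using Cons.IH[of as' m] Cons.prems False wt_poly_below
        by (intro poly_below_mult) (auto simp: * numeral_2_eq_2)
      thus ?thesis by simp
    qed
    thus ?thesis by (auto intro!: poly_below_sum simp: *)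
  qed auto
qed

lemma layer_poly_below:
  assumes "supported_below P F" "d \<noteq> P"
  shows "poly_below (length us) (\<lambda>v. layer P F us (v # vs) (d # ds))"
  unfolding layer_def
proof (intro poly_below_sum)
  fix as assume as: "as \<in> words (length us)"
  show "poly_below (length us) (\<lambda>v. F us as * grid P us (v # vs) as (d # ds))"
  proof (cases "F us as = 0")
    case False
    hence "set as \<subseteq> {..<P}" using assms as by (auto simp: supported_below_def)
    hence "poly_below (length us) (\<lambda>v. F us as * (\<Sum>hs\<in>words (length us). grid P us vs hs ds
      * column us v as P hs d))"
      by (intro poly_below_cmult poly_below_sum column_poly_below_turn assms)
    thus ?thesis by (simp add: mult_ac)
  qed auto
qed

lemma exchangeable_Cons:
  assumes "exchangeable F" "c \<in> C"
  shows "exchangeable (\<lambda>ys as. F (z # ys) (c # as))"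
  unfolding exchangeable_def
proof (intro allI ballI impI)
  fix xs ys :: "'a list" and v w as bs e1 e2
  assume "e1 \<in> C" "e2 \<in> C" "as \<in> words (length xs)" "bs \<in> words (length ys)"
  thus "(\<Sum>d1\<in>C. \<Sum>d2\<in>C. F (z # xs @ v # w # ys) (c # as @ d1 # d2 # bs) * wt q v w d1 d2 e1 e2)
     = (v - q * w) * F (z # xs @ w # v # ys) (c # as @ e2 # e1 # bs)"
    using assms(1)[unfolded exchangeable_def, rule_format, of e1 e2 "c # as"
      "z # xs" bs ys v w] assms(2)
    by (simp add: words_def)
qed

lemma supported_below_Cons:
  assumes "supported_below P F" "c \<in> C"
  shows "supported_below P (\<lambda>ys as. F (z # ys) (c # as))"
  unfolding supported_below_def
proof (intro allI impI)
  fix xs as assume "as \<in> words (length xs)" "F (z # xs) (c # as) \<noteq> 0"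
  thus "set as \<subseteq> {..<P}"
    using assms(1)[unfolded supported_below_def, rule_format, of "c # as" "z # xs"] assms(2)
    by (auto simp: words_def)
qed

lemma layer_expand:
  assumes F: "exchangeable F" "supported_below P F" and "P \<in> C" "c \<in> C" "c \<noteq> P" "ds \<in> words
    (length vs)"
    and us: "distinct us" "\<And>x y. x \<in> set us \<Longrightarrow> y \<in> set us \<Longrightarrow> x \<noteq> y \<Longrightarrow> x \<noteq> q * y"
  shows "layer P F us (v # vs) (c # ds)
       = (\<Sum>z\<in>set us. (1 - q) * z * (\<Prod>w\<leftarrow>vs. z - q * w) *
           (\<Prod>b\<in>set us - {z}. (b - v) * ((q * z - b) / (z - b))) *
           layer P (\<lambda>ys as. F (z # ys) (c # as)) (remove1 z us) vs ds)"
proof -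
  let ?A = "\<lambda>z. (1 - q) * z * (\<Prod>w\<leftarrow>vs. z - q * w)"
  let ?L = "\<lambda>z. layer P (\<lambda>ys as. F (z # ys) (c # as)) (remove1 z us) vs ds"
  let ?R = "\<lambda>v. \<Sum>z\<in>set us. ?A z * (\<Prod>b\<in>set us - {z}. (b - v) * ((q * z - b) / (z - b))) * ?L z"
  \<comment> \<open>Both sides become functions of the first column variable alone and are compared
    at the row variables.\<close>
  have "(\<lambda>v. layer P F us (v # vs) (c # ds)) = ?R"
  proof (rule poly_below_eqI)
    show "poly_below (length us) (\<lambda>v. layer P F us (v # vs) (c # ds))"
      using assms by (intro layer_poly_below)
    show "poly_below (length us) ?R"
    proof (intro poly_below_sum)
      fix z assume z: "z \<in> set us"
      have "poly_below 2 (\<lambda>v. (b - v) * K)" for b K :: 'a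
        using poly_below_linear[of "b * K" "- K"] by (simp add: algebra_simps)
      hence lin: "poly_below 2 (\<lambda>v. (b - v) * ((q * z - b) / (z - b)))" for b .
      have "card (set us - {z}) < length us"
        using z us by (metis card_Diff1_less distinct_card finite_set)
      hence "poly_below (length us) (\<lambda>v. \<Prod>b\<in>set us - {z}. (b - v) * ((q * z - b) / (z - b)))"
        by (intro poly_below_prod lin) auto
      hence "poly_below (length us) (\<lambda>v. (?A z * ?L z) * (\<Prod>b\<in>set us - {z}. (b - v) * ((q * z - b) /
        (z - b))))"
        by (rule poly_below_cmult)
      thus "poly_below (length us) (\<lambda>v. ?A z * (\<Prod>b\<in>set us - {z}. (b - v) * ((q * z - b) / (z - b)))
        * ?L z)"
        by (simp only: mult_ac)
    qed
    show "length us \<le> card (set us)" using us by (simp add: distinct_card)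
    show "layer P F us (z # vs) (c # ds) = ?R z" if z: "z \<in> set us" for z
    proof -
      obtain xs ys where split: "us = xs @ z # ys" using z by (auto simp: in_set_conv_decomp)
      have z_notin: "z \<notin> set (xs @ ys)" and d: "distinct (xs @ ys)" using us split by auto
      hence set: "set us - {z} = set (xs @ ys)" using split by auto
      have rem: "remove1 z us = xs @ ys" using z_notin split by (auto simp: remove1_append)
      have "layer P F us (z # vs) (c # ds) = layer P F ((xs @ ys) @ [z]) (z # vs) (c # ds)"
        unfolding split append_assoc
      proof (rule layer_move)
        show "z \<noteq> q * y" if "y \<in> set ys" for y
        proof -
          have "y \<in> set us" "z \<noteq> y" using that split z_notin by auto
          thus ?thesis using us(2) z by blast
        qed
      qed (use assms in \<open>auto simp: words_def\<close>)
      also have "\<dots> = ?A z * (\<Prod>x\<leftarrow>xs @ ys. x - q * z) * ?L z"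
        unfolding rem by (rule layer_at_node) (use assms in auto)
      also have "(\<Prod>x\<leftarrow>xs @ ys. x - q * z) = (\<Prod>b\<in>set us - {z}. b - q * z)"
        unfolding set using d by (rule prod.distinct_set_conv_list[symmetric])
      \<comment> \<open>The value at the node is brought into the form of a Lagrange term at
        \<open>v = z\<close>: the basis polynomial is the product of
        \<open>(b - v) / (b - z)\<close>, and
        \<open>(b - q * z) / (b - z) = (q * z - b) / (z - b)\<close>.\<close>
      also have "\<dots> = (\<Prod>b\<in>set us - {z}. (b - z) * ((q * z - b) / (z - b)))"
      proof (rule prod.cong)
        fix b assume "b \<in> set us - {z}"
        hence "z - b \<noteq> 0" by auto
        thus "b - q * z = (b - z) * ((q * z - b) / (z - b))" by (simp add: field_simps)
      qed simp
      also have "?A z * \<dots> * ?L z = ?R z"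
      proof -
        have "?R z = (\<Sum>z'\<in>set us. if z' = z then ?A z * (\<Prod>b\<in>set us - {z}. (b - z) * ((q * z - b) /
          (z - b))) * ?L z else 0)"
        proof (intro sum.cong refl)
          fix z' assume z': "z' \<in> set us"
          have "(\<Prod>b\<in>set us - {z'}. (b - z) * ((q * z' - b) / (z' - b))) = 0" if "z' \<noteq> z"
            using that z by (intro prod_zero bexI[of _ z]) auto
          thus "?A z' * (\<Prod>b\<in>set us - {z'}. (b - z) * ((q * z' - b) / (z' - b))) * ?L z'
            = (if z' = z then ?A z * (\<Prod>b\<in>set us - {z}. (b - z) * ((q * z - b) / (z - b)))
              * ?L z else 0)"
            by auto
        qed
        thus ?thesis using z by simp
      qed
      finally show ?thesis .
    qed
  qed auto
  thus ?thesis by (rule fun_cong)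
qed

text \<open>The summand of the weight function for one layer, built up column by column from the left.\<close>

fun wterm :: "nat \<Rightarrow> 'a list \<Rightarrow> 'a list \<Rightarrow> nat list \<Rightarrow> 'a" where
  "wterm P [] [] [] = 1"
| "wterm P (w # ws) [] [] = 0"
| "wterm P [] (v # vs) (d # ds) = (if d = P then wterm P [] vs ds else 0)"
| "wterm P (w # ws) (v # vs) (d # ds) =
     (if d = P then (\<Prod>x\<leftarrow>w # ws. x - v) * wterm P (w # ws) vs ds
      else (1 - q) * w * (\<Prod>x\<leftarrow>vs. w - q * x) * (\<Prod>b\<leftarrow>ws. (b - v) * ((q * w - b) / (w - b)))
        * wterm P ws vs ds)"
| "wterm _ _ _ _ = 0"

text \<open>\<open>F\<close> is arbitrary in the induction over columns because a turning column
  fixes the first variable and the first colour of \<open>F\<close>. Row variables thus come out in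
  the order of turning, together with the colours of the turning columns. A frozen column
  contributes a factor common to all orderings.\<close>

lemma layer_eq_sum_permutations:
  assumes "exchangeable F" "supported_below P F" "P \<in> C" "ds \<in> words (length vs)"
    and "distinct us" "\<And>x y. x \<in> set us \<Longrightarrow> y \<in> set us \<Longrightarrow> x \<noteq> y \<Longrightarrow> x \<noteq> q * y"
  shows "layer P F us vs ds
       = (\<Sum>ws\<in>permutations_of_set (set us). wterm P ws vs ds * F ws (filter (\<lambda>c. c \<noteq> P) ds))"
  using assms
proof (induction vs arbitrary: F us ds)
  case Nil
  hence ds: "ds = []" by (simp add: words_def)
  show ?case
  proof (cases "us = []")
    case True
    thus ?thesis by (simp add: ds layer_def)
  next
    case False
    \<comment> \<open>With no column left, a remaining row would need \<open>P\<close> already on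
      its left edge, which the support of \<open>F\<close> excludes. So every row has to turn in
      some column.\<close>
    have 0: "F us as * grid P us [] as [] = 0" if as: "as \<in> words (length us)" for as
    proof (cases "F us as = 0")
      case F: False
      hence "set as \<subseteq> {..<P}" using Nil.prems as by (auto simp: supported_below_def)
      hence "as \<noteq> replicate (length us) P" using False by (cases us) auto
      thus ?thesis by simp
    qed auto
    have "wterm P ws [] [] = 0" if "ws \<in> permutations_of_set (set us)" for ws
      using that False by (cases ws) (auto simp: permutations_of_set_def)
    moreover have "layer P F us [] [] = 0"
      unfolding layer_def by (intro sum.neutral ballI 0)
    ultimately show ?thesis by (simp add: ds)
  qed
next
  case (Cons v vs)
  then obtain d ds' where ds: "ds = d # ds'" "d \<in> C" "ds' \<in> words (length vs)"
    by (cases ds) (auto simp: words_def)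
  show ?case
  proof (cases "d = P")
    case True
    have "layer P F us (v # vs) ds = (\<Prod>u\<leftarrow>us. u - v) * layer P F us vs ds'"
      using Cons.prems by (simp add: ds True layer_pass)
    also have "layer P F us vs ds' = (\<Sum>ws\<in>permutations_of_set (set us). wterm P ws vs ds' * F ws
      (filter (\<lambda>c. c \<noteq> P) ds'))"
      by (intro Cons.IH) (use Cons.prems ds in auto)
    also have "(\<Prod>u\<leftarrow>us. u - v) * \<dots> = (\<Sum>ws\<in>permutations_of_set (set us). wterm P ws (v # vs) ds * F ws
      (filter (\<lambda>c. c \<noteq> P) ds))"
      unfolding sum_distrib_left
    proof (intro sum.cong refl)
      fix ws assume ws: "ws \<in> permutations_of_set (set us)"
      hence "set ws = set us" "distinct ws"
        by (auto dest: permutations_of_setD)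
      hence "(\<Prod>u\<leftarrow>us. u - v) = (\<Prod>u\<leftarrow>ws. u - v)"
        using Cons.prems(5) by (metis prod.distinct_set_conv_list)
      thus "(\<Prod>u\<leftarrow>us. u - v) * (wterm P ws vs ds' * F ws (filter (\<lambda>c. c \<noteq> P) ds')) = wterm P ws
        (v # vs) ds * F ws (filter (\<lambda>c. c \<noteq> P) ds)"
        by (cases ws) (simp_all add: ds True)
    qed
    finally show ?thesis .
  next
    case False
    let ?c = "\<lambda>z. (1 - q) * z * (\<Prod>w\<leftarrow>vs. z - q * w) * (\<Prod>b\<in>set us - {z}. (b - v) * ((q * z - b) /
      (z - b)))"
    have step: "?c z * layer P (\<lambda>ys as. F (z # ys) (d # as)) (remove1 z us) vs ds'
        = (\<Sum>ws\<in>permutations_of_set (set us - {z}). wterm P (z # ws) (v # vs) ds * F (z # ws) (filter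
          (\<lambda>c. c \<noteq> P) ds))"
      if z: "z \<in> set us" for z
    proof -
      have set: "set (remove1 z us) = set us - {z}" using Cons.prems by simp
      have e: "layer P (\<lambda>ys as. F (z # ys) (d # as)) (remove1 z us) vs ds'
        = (\<Sum>ws\<in>permutations_of_set (set us - {z}). wterm P ws vs ds' * F (z # ws) (d # filter
          (\<lambda>c. c \<noteq> P) ds'))"
        unfolding set[symmetric]
        by (intro Cons.IH exchangeable_Cons supported_below_Cons) (use Cons.prems ds set in auto)
      show ?thesis
        unfolding e sum_distrib_left
      proof (intro sum.cong refl)
        fix ws assume "ws \<in> permutations_of_set (set us - {z})"
        hence "set us - {z} = set ws" "distinct ws"
          by (auto dest: permutations_of_setD)
        hence pr: "(\<Prod>b\<in>set us - {z}. (b - v) * ((q * z - b) / (z - b))) = (\<Prod>b\<leftarrow>ws. (b - v) * ((q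
          * z - b) / (z - b)))"
          by (simp only: prod.distinct_set_conv_list)
        show "?c z * (wterm P ws vs ds' * F (z # ws) (d # filter (\<lambda>c. c \<noteq> P) ds'))
          = wterm P (z # ws) (v # vs) ds * F (z # ws) (filter (\<lambda>c. c \<noteq> P) ds)"
          unfolding pr ds(1) by
            (simp only: wterm.simps filter.simps False if_False not_False_eq_True if_True
            mult.assoc)
      qed
    qed
    have "layer P F us (v # vs) ds = (\<Sum>z\<in>set us. \<Sum>ws\<in>permutations_of_set (set us - {z}). wterm P
      (z # ws) (v # vs) ds * F (z # ws) (filter (\<lambda>c. c \<noteq> P) ds))"
    proof -
      have "layer P F us (v # vs) (d # ds') = (\<Sum>z\<in>set us. ?c z * layer P (\<lambda>ys as. F (z # ys)
        (d # as)) (remove1 z us) vs ds')"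
        using Cons.prems ds False by (intro layer_expand) blast+
      also have "\<dots> = (\<Sum>z\<in>set us. \<Sum>ws\<in>permutations_of_set (set us - {z}). wterm P (z # ws)
        (v # vs) ds * F (z # ws) (filter (\<lambda>c. c \<noteq> P) ds))"
        by (rule sum.cong[OF refl step])
      finally show ?thesis by (simp only: ds(1))
    qed
    also have "\<dots> = (\<Sum>ws\<in>permutations_of_set (set us). wterm P ws (v # vs) ds * F ws (filter
      (\<lambda>c. c \<noteq> P) ds))"
    proof (cases "us = []")
      case True
      thus ?thesis using False by (simp add: ds)
    next
      case us: False
      have "(\<Sum>ws\<in>permutations_of_set (set us). f ws) = (\<Sum>z\<in>set us. \<Sum>ws\<in>permutations_of_set
        (set us - {z}). f (z # ws))"
        for f :: "'a list \<Rightarrow> 'a"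
      proof -
        have "(\<Sum>ws\<in>permutations_of_set (set us). f ws) = (\<Sum>z\<in>set us. sum f
          ((\<lambda>ws. z # ws) ` permutations_of_set (set us - {z})))"
          using us by (subst permutations_of_set_nonempty) (auto intro!: sum.UNION_disjoint)
        thus ?thesis by (simp add: sum.reindex inj_on_def)
      qed
      thus ?thesis by simp
    qed
    finally show ?thesis .
  qed
qed

text \<open>Of the columns of a layer only those with \<open>u\<close>-variables meet the next
  layer, and these form a middle block. The \<open>v\<close>-columns on both sides stay
  fixed.\<close>

lemma exchangeable_layer:
  assumes "P \<in> C" "length ds1 = length vs1"
  shows "exchangeable (\<lambda>xs as. layer P F us (vs1 @ xs @ vs2) (ds1 @ as @ ds2))"
  unfolding exchangeable_def
proof (intro allI ballI impI)
  fix xs ys :: "'a list" and v w as bs e1 e2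
  assume *: "e1 \<in> C" "e2 \<in> C" "as \<in> words (length xs)" "bs \<in> words (length ys)"
  let ?W = "words (length us)"
  have "(\<Sum>d1\<in>C. \<Sum>d2\<in>C. layer P F us (vs1 @ (xs @ v # w # ys) @ vs2) (ds1 @ (as @ d1 # d2 # bs)
    @ ds2) * wt q v w d1 d2 e1 e2)
    = (\<Sum>d1\<in>C. \<Sum>d2\<in>C. \<Sum>hs\<in>?W. F us hs * (grid P us ((vs1 @ xs) @ v # w # (ys @ vs2)) hs ((ds1 @ as)
      @ d1 # d2 # (bs @ ds2)) * wt q v w d1 d2 e1 e2))"
    unfolding layer_def by (simp add: sum_distrib_left mult_ac)
  also have "\<dots> = (\<Sum>hs\<in>?W. \<Sum>d1\<in>C. \<Sum>d2\<in>C. F us hs * (grid P us ((vs1 @ xs) @ v # w # (ys @ vs2)) hs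
    ((ds1 @ as) @ d1 # d2 # (bs @ ds2)) * wt q v w d1 d2 e1 e2))"
    unfolding sum.cartesian_product
    by (rule sum.reindex_bij_witness[of _ "\<lambda>(d, a, b). (a, b, d)" "\<lambda>(a, b, d). (d, a, b)"]) auto
  also have "\<dots> = (\<Sum>hs\<in>?W. F us hs * ((v - q * w) * grid P us ((vs1 @ xs) @ w # v # (ys @ vs2)) hs
    ((ds1 @ as) @ e2 # e1 # (bs @ ds2))))"
    unfolding sum_distrib_left[symmetric]
    by (intro sum.cong refl arg_cong2[of _ _ _ _ "(*)"] grid_column_exchange) (use
      * assms in \<open>auto simp: words_def\<close>)
  also have "\<dots> = (v - q * w) * layer P F us (vs1 @ (xs @ w # v # ys) @ vs2) (ds1 @ (as
    @ e2 # e1 # bs) @ ds2)"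
    unfolding layer_def by (simp add: sum_distrib_left mult_ac)
  finally show "(\<Sum>d1\<in>C. \<Sum>d2\<in>C. layer P F us (vs1 @ (xs @ v # w # ys) @ vs2) (ds1 @ (as
    @ d1 # d2 # bs) @ ds2) * wt q v w d1 d2 e1 e2)
    = (v - q * w) * layer P F us (vs1 @ (xs @ w # v # ys) @ vs2) (ds1 @ (as @ e2 # e1 # bs)
      @ ds2)" .
qed

section \<open>Columns and grids as sums over paths\<close>

lemma column_path_sum:
  assumes "b \<in> C" "d \<in> C"
  shows "(\<Sum>f\<in>{f \<in> {0..n} \<rightarrow>\<^sub>E C. f n = b \<and> f 0 = d}. \<Prod>r\<in>{1..n}. wt q (x r) v (a r) (f r) (c r) (f
    (r - 1)))
    = column (map x [1..<Suc n]) v (map a [1..<Suc n]) b (map c [1..<Suc n]) d"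
proof -
  have "{0<..n} = {1..n}" by auto
  thus ?thesis
    using transfer_path_sum[OF finite_C,
        where G = "\<lambda>r d. column (map x [Suc r..<Suc n]) v (map a [Suc r..<Suc n]) b
          (map c [Suc r..<Suc n]) d"
        and K = "\<lambda>r d m. wt q (x r) v (a r) m (c r) d" and N = n and e = b and r = 0 and a
          = d] assms
    by (auto simp: upt_conv_Cons simp del: upt_Suc)
qed

lemma grid_path_sum:
  assumes "P \<in> C" "a \<in> words (length us)"
  shows "(\<Sum>f\<in>{f \<in> {0..n} \<rightarrow>\<^sub>E words (length us). f n = replicate (length us) P \<and> f 0 = a}.
       \<Prod>s\<in>{1..n}. column us (v s) (f (s - 1)) P (f s) (d s))
    = grid P us (map v [1..<Suc n]) a (map d [1..<Suc n])"
proof -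
  have "{0<..n} = {1..n}" by auto
  thus ?thesis
    using transfer_path_sum[OF finite_words,
        where G = "\<lambda>r a. grid P us (map v [Suc r..<Suc n]) a (map d [Suc r..<Suc n])"
        and K = "\<lambda>s a m. column us (v s) a P m (d s)" and N = n and e = "replicate
          (length us) P" and r = 0 and a = a] assms
    by (auto simp: upt_conv_Cons simp del: upt_Suc)
qed

section \<open>Explicit form of the summand of one layer\<close>

lemma wterm_nonzero_length: "wterm P ws vs ds \<noteq> 0 \<Longrightarrow> length (filter (\<lambda>c. c \<noteq> P) ds) = length ws"
  by (induction P ws vs ds rule: wterm.induct) (auto split: if_splits)

lemma wterm_frozen: "wterm P ws (v # vs) (P # ds) = (\<Prod>x\<leftarrow>ws. x - v) * wterm P ws vs ds"
  by (cases ws) auto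

lemma wterm_turn: "d \<noteq> P \<Longrightarrow> wterm P (w # ws) (v # vs) (d # ds) =
    (1 - q) * w * (\<Prod>x\<leftarrow>vs. w - q * x) * (\<Prod>b\<leftarrow>ws. (b - v) * ((q * w - b) / (w - b)))
      * wterm P ws vs ds"
  by simp

lemma wterm_Nil_turn: "length ds = length vs \<Longrightarrow> d \<noteq> P \<Longrightarrow> wterm P [] (vs @ [v]) (ds @ [d]) = 0"
  by (induction vs arbitrary: ds) (auto simp: length_Suc_conv)

text \<open>The recursion of \<open>wterm\<close> removes columns from the left, but positions are
  easiest to follow when columns are added on the right, where a new position is the largest. All
  rows have turned before the new column, which explains the factors
  \<open>w - q * v\<close>.\<close>

lemma wterm_snoc_frozen:
  assumes "length ds = length vs"
  shows "wterm P ws (vs @ [v]) (ds @ [P]) = wterm P ws vs ds * (\<Prod>w\<leftarrow>ws. w - q * v)"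
  using assms
proof (induction vs arbitrary: ws ds)
  case Nil
  thus ?case by (cases ws) auto
next
  case (Cons v0 vs)
  then obtain d0 ds' where ds: "ds = d0 # ds'" "length ds' = length vs" by (metis length_Suc_conv)
  show ?case
  proof (cases "d0 = P")
    case True
    thus ?thesis using Cons.IH[OF ds(2), of ws] by
      (simp add: ds(1) wterm_frozen mult.assoc del: wterm.simps)
  next
    case False
    show ?thesis
    proof (cases ws)
      case (Cons w ws')
      show ?thesis unfolding Cons ds(1) append_Cons wterm_turn[OF False] Cons.IH[OF ds(2)]
        by (simp only: map_append prod_list.append list.map prod_list.Cons prod_list.Nil mult_ac
          mult_1_right mult_1_left)
    qed (use False in \<open>simp add: ds\<close>)
  qed
qed

text \<open>A last turning column belongs to the last row \<open>w\<close>. This row has crossed all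
  earlier columns, giving \<open>w - x\<close> for each of them; every row that turned before meets
  the new column in its frozen part and has an interpolation factor with \<open>w\<close>.\<close>

lemma wterm_snoc_turn:
  assumes "length ds = length vs" "d \<noteq> P"
  shows "wterm P (ws @ [w]) (vs @ [v]) (ds @ [d]) = wterm P ws vs ds * (\<Prod>x\<leftarrow>vs. w - x) * ((1 - q)
    * w)
    * (\<Prod>a\<leftarrow>ws. (a - q * v) * ((q * a - w) / (a - w)))"
  using assms
proof (induction vs arbitrary: ws ds)
  case Nil
  show ?case
  proof (cases ws)
    case (Cons a ws')
    have "wterm P (ws' @ [w]) [] [] = 0" by (cases ws') auto
    thus ?thesis using Nil Cons by simp
  qed (use Nil in auto)
next
  case (Cons v0 vs)
  then obtain d0 ds' where ds: "ds = d0 # ds'" "length ds' = length vs" by (metis length_Suc_conv)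
  show ?case
  proof (cases "d0 = P")
    case True
    thus ?thesis using Cons.IH[OF ds(2) Cons.prems(2), of ws]
      by (simp add: ds(1) wterm_frozen mult_ac del: wterm.simps)
  next
    case False
    show ?thesis
    proof (cases ws)
      case Nil
      thus ?thesis using False Cons.prems ds wterm_Nil_turn[OF ds(2) Cons.prems(2)] by simp
    next
      case (Cons a ws')
      show ?thesis unfolding Cons ds(1) append_Cons wterm_turn[OF False] Cons.IH[OF ds(2) assms(2)]
        by (simp only: map_append prod_list.append list.map prod_list.Cons prod_list.Nil mult_ac
          mult_1_right mult_1_left)
    qed
  qed
qed

lemma wterm_explicit:
  assumes "card {s \<in> {1..N}. t s \<noteq> P} = n"
  shows "wterm P (map w [1..<Suc n]) (map v [1..<Suc N]) (map t [1..<Suc N])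
    = (\<Prod>a\<in>{1..n}. (\<Prod>i\<in>{1..nth_smallest {s \<in> {1..N}. t s \<noteq> P} a - 1}. w a - v i) * ((1 - q) * w a)
        * (\<Prod>i\<in>{nth_smallest {s \<in> {1..N}. t s \<noteq> P} a + 1..N}. w a - q * v i))
      * (\<Prod>(a, b)\<in>{(a, b) \<in> {1..n} \<times> {1..n}. a < b}. (q * w a - w b) / (w a - w b))"
  using assms
proof (induction N arbitrary: n)
  case (Suc N)
  let ?A = "{s \<in> {1..N}. t s \<noteq> P}" and ?A' = "{s \<in> {1..Suc N}. t s \<noteq> P}"
  let ?I = "nth_smallest ?A" and ?I' = "nth_smallest ?A'"
  have fin: "finite ?A" by simp
  have range: "?I a \<le> N" if "a \<in> {1..card ?A}" for a
    using nth_smallest_in[OF fin that] by simp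
  have last: "{j + 1..Suc N} = insert (Suc N) {j + 1..N}" if "j \<le> N" for j using that by auto
  have uN: "[1..<Suc (Suc N)] = [1..<Suc N] @ [Suc N]" by simp
  show ?case
  proof (cases "t (Suc N) = P")
    case True
    \<comment> \<open>The last column is frozen: no position changes, and each row gains one factor
      at the right end of its product.\<close>
    hence A: "?A' = ?A" by (auto simp: le_Suc_eq)
    have "wterm P (map w [1..<Suc n]) (map v [1..<Suc (Suc N)]) (map t [1..<Suc (Suc N)])
      = wterm P (map w [1..<Suc n]) (map v [1..<Suc N]) (map t [1..<Suc N]) * (\<Prod>a\<in>{1..n}. w a - q
        * v (Suc N))"
    proof -
      have "(\<Prod>x\<leftarrow>map w [1..<Suc n]. x - q * v (Suc N)) = (\<Prod>a\<in>{1..n}. w a - q * v (Suc N))"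
        by (simp add: prod.distinct_set_conv_list[symmetric] o_def atLeastLessThanSuc_atLeastAtMost
          del: upt_Suc)
      thus ?thesis
        using wterm_snoc_frozen[of "map t [1..<Suc N]" "map v [1..<Suc N]" P "map w [1..<Suc n]" "v
          (Suc N)"] True
        unfolding uN map_append list.map by (simp only: length_map)
    qed
    also have "\<dots> = (\<Prod>a\<in>{1..n}. (\<Prod>i\<in>{1..?I a - 1}. w a - v i) * ((1 - q) * w a)
        * (\<Prod>i\<in>{?I a + 1..Suc N}. w a - q * v i))
      * (\<Prod>(a, b)\<in>{(a, b) \<in> {1..n} \<times> {1..n}. a < b}. (q * w a - w b) / (w a - w b))"
    proof -
      have "(\<Prod>a\<in>{1..n}. (\<Prod>i\<in>{1..?I a - 1}. w a - v i) * ((1 - q) * w a) * (\<Prod>i\<in>{?I a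
        + 1..Suc N}. w a - q * v i))
        = (\<Prod>a\<in>{1..n}. ((\<Prod>i\<in>{1..?I a - 1}. w a - v i) * ((1 - q) * w a) * (\<Prod>i\<in>{?I a + 1..N}. w a - q
          * v i)) * (w a - q * v (Suc N)))"
      proof (intro prod.cong refl)
        fix a assume "a \<in> {1..n}"
        hence "?I a \<le> N" using Suc.prems A by (intro range) simp
        thus "(\<Prod>i\<in>{1..?I a - 1}. w a - v i) * ((1 - q) * w a) * (\<Prod>i\<in>{?I a + 1..Suc N}. w a - q
          * v i)
          = ((\<Prod>i\<in>{1..?I a - 1}. w a - v i) * ((1 - q) * w a) * (\<Prod>i\<in>{?I a + 1..N}. w a - q * v i))
            * (w a - q * v (Suc N))"
          unfolding last[OF \<open>?I a \<le> N\<close>] by (subst prod.insert) (simp_all add: mult_ac)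
      qed
      thus ?thesis using Suc.prems A by (subst Suc.IH) (auto simp: prod.distrib mult_ac)
    qed
    finally show ?thesis unfolding A .
  next
    case False
    hence A: "?A' = insert (Suc N) ?A" by (auto simp: le_Suc_eq)
    have lt: "x < Suc N" if "x \<in> ?A" for x using that by auto
    have "card ?A' = Suc (card ?A)" unfolding A by (subst card_insert_disjoint) auto
    then obtain n' where n': "n = Suc n'" "card ?A = n'" using Suc.prems by auto
    have un: "[1..<Suc (Suc n')] = [1..<Suc n'] @ [Suc n']" by simp
    have ins: "{1..Suc n'} = insert (Suc n') {1..n'}" by auto
    \<comment> \<open>The last column turns: the new row has the largest index, so the new pairs are
      \<open>(a, Suc n')\<close>, carrying the new interpolation factors.\<close>
    have pairs: "{(a, b) \<in> {1..Suc n'} \<times> {1..Suc n'}. a < b} = {(a, b) \<in> {1..n'} \<times> {1..n'}. a < b} \<union>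
      (\<lambda>a. (a, Suc n')) ` {1..n'}"
      by (auto simp: le_Suc_eq)
    have finp: "finite {(a, b) \<in> {1..n'} \<times> {1..n'}. a < b}"
      by (rule finite_subset[of _ "{1..n'} \<times> {1..n'}"]) auto
    have I': "?I' a = ?I a" if "a \<in> {1..n'}" for a
      unfolding A using that nth_smallest_insert_max(1)[OF fin lt] n' by auto
    have I'_last: "?I' (Suc n') = Suc N"
      unfolding A using nth_smallest_insert_max(2)[OF fin lt] n' by auto
    have "wterm P (map w [1..<Suc n]) (map v [1..<Suc (Suc N)]) (map t [1..<Suc (Suc N)])
      = wterm P (map w [1..<Suc n']) (map v [1..<Suc N]) (map t [1..<Suc N]) *
        (\<Prod>i\<in>{1..N}. w n - v i)
        * ((1 - q) * w n) * (\<Prod>a\<in>{1..n'}. (w a - q * v (Suc N)) * ((q * w a - w n) / (w a - w n)))"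
    proof -
      have "(\<Prod>a\<leftarrow>map w [1..<Suc n']. (a - q * v (Suc N)) * ((q * a - w n) / (a - w n)))
          = (\<Prod>a\<in>{1..n'}. (w a - q * v (Suc N)) * ((q * w a - w n) / (w a - w n)))"
        "(\<Prod>x\<leftarrow>map v [1..<Suc N]. w n - x) = (\<Prod>i\<in>{1..N}. w n - v i)"
        by (simp_all add: prod.distinct_set_conv_list[symmetric] o_def
          atLeastLessThanSuc_atLeastAtMost del: upt_Suc)
      thus ?thesis
        using wterm_snoc_turn[of "map t [1..<Suc N]" "map v [1..<Suc N]" "t (Suc N)" P
          "map w [1..<Suc n']" "w n" "v (Suc N)"] False
        unfolding n'(1) uN un map_append list.map by
          (simp only: length_map not_False_eq_True simp_thms)
    qed
    also have "\<dots> = (\<Prod>a\<in>{1..n}. (\<Prod>i\<in>{1..?I' a - 1}. w a - v i) * ((1 - q) * w a) * (\<Prod>i\<in>{?I' a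
      + 1..Suc N}. w a - q * v i))
      * (\<Prod>(a, b)\<in>{(a, b) \<in> {1..n} \<times> {1..n}. a < b}. (q * w a - w b) / (w a - w b))"
    proof -
      have old: "(\<Prod>a\<in>{1..n'}. (\<Prod>i\<in>{1..?I' a - 1}. w a - v i) * ((1 - q) * w a) * (\<Prod>i\<in>{?I' a
        + 1..Suc N}. w a - q * v i))
        = (\<Prod>a\<in>{1..n'}. ((\<Prod>i\<in>{1..?I a - 1}. w a - v i) * ((1 - q) * w a) * (\<Prod>i\<in>{?I a + 1..N}. w a - q
          * v i)) * (w a - q * v (Suc N)))"
      proof (intro prod.cong refl)
        fix a assume a: "a \<in> {1..n'}"
        hence "?I a \<le> N" using n' by (intro range) simp
        thus "(\<Prod>i\<in>{1..?I' a - 1}. w a - v i) * ((1 - q) * w a) * (\<Prod>i\<in>{?I' a + 1..Suc N}. w a - q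
          * v i)
          = ((\<Prod>i\<in>{1..?I a - 1}. w a - v i) * ((1 - q) * w a) * (\<Prod>i\<in>{?I a + 1..N}. w a - q * v i))
            * (w a - q * v (Suc N))"
          unfolding I'[OF a] last[OF \<open>?I a \<le> N\<close>] by (subst prod.insert) (simp_all add: mult_ac)
      qed
      have new: "(\<Prod>(a, b)\<in>{(a, b) \<in> {1..n} \<times> {1..n}. a < b}. (q * w a - w b) / (w a - w b))
        = (\<Prod>(a, b)\<in>{(a, b) \<in> {1..n'} \<times> {1..n'}. a < b}. (q * w a - w b) / (w a - w b)) *
          (\<Prod>a\<in>{1..n'}. (q * w a - w n) / (w a - w n))"
        unfolding n'(1) pairs by (subst prod.union_disjoint)
          (use finp in \<open>auto simp: prod.reindex inj_on_def\<close>)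
      have top: "(\<Prod>a\<in>{1..n}. (\<Prod>i\<in>{1..?I' a - 1}. w a - v i) * ((1 - q) * w a) * (\<Prod>i\<in>{?I' a
        + 1..Suc N}. w a - q * v i))
        = (\<Prod>i\<in>{1..N}. w n - v i) * ((1 - q) * w n) *
          (\<Prod>a\<in>{1..n'}. (\<Prod>i\<in>{1..?I' a - 1}. w a - v i) * ((1 - q) * w a) * (\<Prod>i\<in>{?I' a
            + 1..Suc N}. w a - q * v i))"
        unfolding n'(1) ins by (subst prod.insert) (simp_all only: I'_last, simp_all)
      show ?thesis
        unfolding new top old Suc.IH[OF n'(2)] by (simp only: prod.distrib mult_ac)
    qed
    finally show ?thesis .
  qed
qed simp

end

section \<open>The stack of layers\<close>

locale layered_model =
  fixes M :: nat and k LI LII :: "nat \<Rightarrow> nat" and LM :: nat and q :: "'a::field"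
    and u vI vII :: "nat \<Rightarrow> nat \<Rightarrow> 'a" and vM :: "nat \<Rightarrow> 'a" and col :: "nat \<Rightarrow> nat"
  assumes M_pos: "1 \<le> M" and colouring: "is_colouring M LI LII LM col"
begin

definition colours :: "nat set" where
  "colours = {1..M + 1}"

sublocale vertex_model colours q
  by unfold_locales (simp add: colours_def)

abbreviation "ncol \<equiv> ncols M k LI LII LM"

abbreviation "cvar \<equiv> colvar M k LI u vI vII vM"

definition urow :: "nat \<Rightarrow> 'a list" where
  "urow p = map (u p) [1..<Suc (k p)]"

lemma length_urow [simp]: "length (urow p) = k p"
  by (simp add: urow_def)

text \<open>The argument \<open>w\<close> is the left boundary word of layer \<open>p + 1\<close>;
  these are the edges shared by the two layers. Layer \<open>M\<close> has no such edges.\<close>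

definition top_colour :: "nat \<Rightarrow> nat list \<Rightarrow> nat \<Rightarrow> nat" where
  "top_colour p w s =
     (if p < M then
        if s \<le> LI p then col (offI LI p + s)
        else if s \<le> LI p + k (p + 1) then w ! (s - LI p - 1)
        else col (offII M LI LII LM p + (s - LI p - k (p + 1)))
      else col (offI LI M + s))"

definition cvars :: "nat \<Rightarrow> 'a list \<Rightarrow> 'a list" where
  "cvars p xs = (if p < M then map (vI p) [1..<Suc (LI p)] @ xs @ map (vII p) [1..<Suc (LII p)]
     else map vM [1..<Suc LM])"

definition top_word :: "nat \<Rightarrow> nat list \<Rightarrow> nat list" where
  "top_word p w = (if p < M then map (\<lambda>s. col (offI LI p + s)) [1..<Suc (LI p)] @ w
       @ map (\<lambda>s. col (offII M LI LII LM p + s)) [1..<Suc (LII p)]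
     else map (\<lambda>s. col (offI LI M + s)) [1..<Suc LM])"

lemma map_cvar: "map (cvar p) [1..<Suc (ncol p)] = cvars p (urow (p + 1))"
  by (intro nth_equalityI)
    (auto simp: ncols_def colvar_def cvars_def urow_def mcol_def nth_append Suc_diff_le simp del:
      upt_Suc)

lemma map_top_colour:
  assumes "p < M \<Longrightarrow> length w = k (p + 1)"
  shows "map (top_colour p w) [1..<Suc (ncol p)] = top_word p w"
  using assms
  by (intro nth_equalityI)
    (auto simp: ncols_def top_colour_def top_word_def nth_append Suc_diff_le simp del: upt_Suc)

lemma col_range:
  assumes "p \<in> {1..M}"
  shows "p < M \<Longrightarrow> s \<in> {1..LI p} \<Longrightarrow> col (offI LI p + s) \<in> {1..p + 1}"
    and "p < M \<Longrightarrow> s \<in> {1..LII p} \<Longrightarrow> col (offII M LI LII LM p + s) \<in> {1..p + 1}"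
    and "s \<in> {1..LM} \<Longrightarrow> col (offI LI M + s) \<in> {1..M + 1}"
proof -
  show "p < M \<Longrightarrow> s \<in> {1..LI p} \<Longrightarrow> col (offI LI p + s) \<in> {1..p + 1}"
    "p < M \<Longrightarrow> s \<in> {1..LII p} \<Longrightarrow> col (offII M LI LII LM p + s) \<in> {1..p + 1}"
    using colouring assms unfolding is_colouring_def layer_coords_def by force+
  show "s \<in> {1..LM} \<Longrightarrow> col (offI LI M + s) \<in> {1..M + 1}"
    using colouring[unfolded is_colouring_def, rule_format, of M "offI LI M + s"] M_pos
    unfolding layer_coords_def by auto
qed

lemma top_word_in_words:
  assumes "p \<in> {1..M}" "p < M \<Longrightarrow> set w \<subseteq> colours"
  shows "set (top_word p w) \<subseteq> colours"
proof (cases "p < M")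
  case True
  have "col (offI LI p + s) \<in> colours" if "s \<in> {1..LI p}" for s
    using col_range(1)[OF assms(1) True that] True by (auto simp: colours_def)
  moreover have "col (offII M LI LII LM p + s) \<in> colours" if "s \<in> {1..LII p}" for s
    using col_range(2)[OF assms(1) True that] True by (auto simp: colours_def)
  ultimately show ?thesis
    using True assms(2) by (auto simp: top_word_def simp del: upt_Suc)
next
  case False
  thus ?thesis using col_range(3)[OF assms(1)] by
    (auto simp: top_word_def colours_def simp del: upt_Suc)
qed

lemma top_colour_range:
  assumes "p \<in> {1..M}" "p < M \<Longrightarrow> w \<in> words (k (p + 1))" "s \<in> {1..ncol p}"
  shows "top_colour p w s \<in> colours"
proof -
  have "top_colour p w s \<in> set (map (top_colour p w) [1..<Suc (ncol p)])"
    using assms(3) by (auto simp del: upt_Suc)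
  thus ?thesis using top_word_in_words[OF assms(1), of w] assms(2)
    by (subst (asm) map_top_colour) (auto simp: words_def)
qed

lemma row_colour_in [simp]: "p \<in> {1..M} \<Longrightarrow> p + 1 \<in> colours" "p \<in> {1..M} \<Longrightarrow> Suc p \<in> colours"
  by (auto simp: colours_def)

text \<open>\<open>stack p\<close> is the partition function of the layers \<open>1, \<dots>, p\<close> as a function of the variables and top
  colours of the columns of layer \<open>p\<close> that carry \<open>u\<close>-variables, so it is the family \<open>F\<close> fed into
  layer \<open>p + 1\<close>.\<close>

fun stack :: "nat \<Rightarrow> 'a list \<Rightarrow> nat list \<Rightarrow> 'a" where
  "stack 0 xs w = of_bool (set w \<subseteq> {1})"
| "stack (Suc p) xs w = layer (p + 2) (stack p) (urow (p + 1)) (cvars (p + 1) xs) (top_word (p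
  + 1) w)"

section \<open>The partition function as a stack of layers\<close>

definition hword :: "(nat \<times> nat \<times> nat \<Rightarrow> nat) \<Rightarrow> nat \<Rightarrow> nat \<Rightarrow> nat list" where
  "hword h p s = map (\<lambda>r. h (p, r, s)) [1..<Suc (k p)]"

text \<open>A colouring of the horizontal edges of one layer, regrouped by vertical cuts:
  \<open>f s\<close> is the word on the cut just after column \<open>s\<close>.\<close>

definition hpaths :: "nat \<Rightarrow> (nat \<Rightarrow> nat list) set" where
  "hpaths p = {f \<in> {0..ncol p} \<rightarrow>\<^sub>E words (k p). f (ncol p) = replicate (k p) (p + 1)}"

lemma finite_hpaths [simp]: "finite (hpaths p)"
  unfolding hpaths_def
  by (rule finite_subset[of _ "{0..ncol p} \<rightarrow>\<^sub>E words (k p)"]) (auto intro!: finite_PiE)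

definition layer_weight :: "nat \<Rightarrow> (nat \<Rightarrow> nat list) \<Rightarrow> nat list \<Rightarrow> 'a" where
  "layer_weight p f w = (\<Prod>s\<in>{1..ncol p}. column (urow p) (cvar p s) (f (s - 1)) (p
    + 1) (f s) (top_colour p w s))"

lemma layer_weight_last: "p \<ge> M \<Longrightarrow> layer_weight p f w = layer_weight p f w'"
  by (simp add: layer_weight_def top_colour_def)

lemma sum_hpaths:
  assumes "p \<in> {1..M}" "p < M \<Longrightarrow> w \<in> words (k (p + 1))"
  shows "(\<Sum>f\<in>hpaths p. layer_weight p f w * X (f 0)) = layer (p + 1) (\<lambda>_. X) (urow p) (cvars p (urow
    (p + 1))) (top_word p w)"
proof -
  have "(\<Sum>f\<in>hpaths p. layer_weight p f w * X (f 0)) = (\<Sum>f\<in>hpaths p. \<Sum>a\<in>words (k p). if f 0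
    = a then X a * layer_weight p f w else 0)"
  proof (intro sum.cong refl)
    fix f assume "f \<in> hpaths p"
    hence "f 0 \<in> words (k p)" by (auto simp: hpaths_def)
    thus "layer_weight p f w * X (f 0) = (\<Sum>a\<in>words (k p). if f 0 = a then X a
      * layer_weight p f w else 0)"
      by simp
  qed
  also have "\<dots> = (\<Sum>a\<in>words (k p). X a * (\<Sum>f\<in>{f \<in> hpaths p. f 0 = a}. layer_weight p f w))"
    by (subst sum.swap) (simp add: sum_distrib_left sum.inter_filter[symmetric])
  also have "\<dots> = (\<Sum>a\<in>words (k p). X a * grid (p + 1) (urow p) (cvars p (urow (p
    + 1))) a (top_word p w))"
  proof (intro sum.cong refl arg_cong2[of _ _ _ _ "(*)"])
    fix a assume a: "a \<in> words (k p)"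
    note len = length_urow
    have "{f \<in> hpaths p. f 0 = a} = {f \<in> {0..ncol p} \<rightarrow>\<^sub>E words (length (urow p)). f (ncol p)
      = replicate (length (urow p)) (p + 1) \<and> f 0 = a}"
      by (auto simp: hpaths_def len)
    moreover have "map (top_colour p w) [1..<Suc (ncol p)] = top_word p w"
      using assms by (intro map_top_colour) (auto simp: words_def)
    moreover note grid_path_sum[where P = "p + 1" and a = a and us = "urow p" and n = "ncol p" and v
      = "cvar p" and d = "top_colour p w"]
    ultimately show "(\<Sum>f\<in>{f \<in> hpaths p. f 0 = a}. layer_weight p f w) = grid (p + 1) (urow p)
      (cvars p (urow (p + 1))) a (top_word p w)"
      unfolding layer_weight_def using a row_colour_in(1)[OF assms(1)] by (simp only: len map_cvar)
  qed
  finally show ?thesis by (simp add: layer_def)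
qed

text \<open>Layers interact only through left boundary words. Removing the last layer leaves the
  same sum for fewer layers, with the left word of the removed layer in place of \<open>w\<close>.
  The indicator is the left boundary condition of layer 1, which falls on \<open>w\<close> itself
  when no layer is left.\<close>

lemma stack_path_sum:
  assumes "P \<le> M" "P < M \<Longrightarrow> w \<in> words (k (P + 1))"
  shows "(\<Sum>g\<in>PiE {1..P} hpaths. of_bool (set (if P = 0 then w else g 1 0) \<subseteq> {1})
       * (\<Prod>p\<in>{1..P}. layer_weight p (g p) (if p = P then w else g (p + 1) 0)))
    = stack P (urow (P + 1)) w"
  using assms
proof (induction P arbitrary: w)
  case (Suc P)
  let ?S = "\<lambda>P w. (\<Sum>g\<in>PiE {1..P} hpaths. of_bool (set (if P = 0 then w else g 1 0) \<subseteq> {1})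
       * (\<Prod>p\<in>{1..P}. layer_weight p (g p) (if p = P then w else g (p + 1) 0)))"
  have ins: "{1..Suc P} = insert (Suc P) {1..P}" by auto
  have "?S (Suc P) w = (\<Sum>f\<in>hpaths (Suc P). layer_weight (Suc P) f w * ?S P (f 0))"
    unfolding ins
  proof (subst sum_PiE_insert, simp, unfold sum_distrib_left, intro sum.cong refl)
    fix f g
    have "(\<Prod>p\<in>{1..P}. layer_weight p ((g(Suc P := f)) p) (if p = Suc P then w else (g(Suc P := f))
      (p + 1) 0))
      = (\<Prod>p\<in>{1..P}. layer_weight p (g p) (if p = P then f 0 else g (p + 1) 0))"
      by (intro prod.cong refl) auto
    thus "of_bool (set (if Suc P = 0 then w else (g(Suc P := f)) 1 0) \<subseteq> {1})
       * (\<Prod>p\<in>insert (Suc P) {1..P}. layer_weight p ((g(Suc P := f)) p) (if p = Suc P then w else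
         (g(Suc P := f)) (p + 1) 0))
      = layer_weight (Suc P) f w * (of_bool (set (if P = 0 then f 0 else g 1 0) \<subseteq> {1})
       * (\<Prod>p\<in>{1..P}. layer_weight p (g p) (if p = P then f 0 else g (p + 1) 0)))"
      by simp
  qed
  also have "\<dots> = (\<Sum>f\<in>hpaths (Suc P). layer_weight (Suc P) f w * stack P (urow (P + 1)) (f 0))"
    by (intro sum.cong refl arg_cong2[of _ _ _ _ "(*)"] Suc.IH)
      (use Suc.prems in \<open>auto simp: hpaths_def\<close>)
  also have "\<dots> = layer (Suc P + 1) (\<lambda>_. stack P (urow (P + 1))) (urow (Suc P)) (cvars (Suc P) (urow
    (Suc P + 1))) (top_word (Suc P) w)"
    using Suc.prems by (intro sum_hpaths) auto
  also have "\<dots> = stack (Suc P) (urow (Suc P + 1)) w"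
    by (simp add: layer_def)
  finally show ?case .
qed simp

text \<open>The conditions are sorted into those on \<open>h\<close> alone and those that fix the
  two ends of each column once \<open>h\<close> is given. This prepares the summation over
  \<open>t\<close> at fixed \<open>h\<close>.\<close>

lemma boundary_iff:
  "boundary M k LI LII LM col h t \<longleftrightarrow>
     (\<forall>p\<in>{1..M}. \<forall>r\<in>{1..k p}. h (p, r, ncol p) = p + 1) \<and> (\<forall>r\<in>{1..k 1}. h (1, r, 0) = 1) \<and>
     (\<forall>p\<in>{1..M}. \<forall>s\<in>{1..ncol p}. t (p, k p, s) = p + 1 \<and> t (p, 0, s) = top_colour p (hword h (p
       + 1) 0) s)"
    (is "_ \<longleftrightarrow> ?R")
proof
  assume B: "boundary M k LI LII LM col h t"
  have "t (p, 0, s) = top_colour p (hword h (p + 1) 0) s" if p: "p \<in> {1..M}" and s: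
    "s \<in> {1..ncol p}" for p s
  proof (cases "p < M")
    case True
    consider "s \<in> {1..LI p}" | r where "s = LI p + r" "r \<in> {1..k (p + 1)}" | s' where "s = LI p
      + k (p + 1) + s'" "s' \<in> {1..LII p}"
    proof -
      assume 1: "s \<in> {1..LI p} \<Longrightarrow> thesis" and 2: "\<And>r. s = LI p + r \<Longrightarrow> r \<in> {1..k (p + 1)} \<Longrightarrow> thesis"
        and 3: "\<And>s'. s = LI p + k (p + 1) + s' \<Longrightarrow> s' \<in> {1..LII p} \<Longrightarrow> thesis"
      show thesis
        using 1 2[of "s - LI p"] 3[of "s - LI p - k (p + 1)"] s True by (fastforce simp: ncols_def)
    qed
    thus ?thesis
      using B True p unfolding boundary_def
      by cases (auto simp: top_colour_def hword_def simp del: upt_Suc)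
  next
    case False
    thus ?thesis using B p s by (auto simp: boundary_def top_colour_def ncols_def)
  qed
  thus ?R using B by (auto simp: boundary_def)
next
  assume R: ?R
  hence top: "t (p, 0, s) = top_colour p (hword h (p + 1) 0) s" if "p \<in> {1..M}"
    "s \<in> {1..ncol p}" for p s
    using that by blast
  have "h (p + 1, r, 0) = t (p, 0, LI p + r)" if "p \<in> {1..<M}" "r \<in> {1..k (p + 1)}" for p r
    using top[of p "LI p + r"] that by
      (auto simp: ncols_def top_colour_def hword_def simp del: upt_Suc)
  moreover have "t (p, 0, s) = col (offI LI p + s)" if "p \<in> {1..<M}" "s \<in> {1..LI p}" for p s
    using top[of p s] that by (auto simp: ncols_def top_colour_def)
  moreover have "t (p, 0, LI p + k (p + 1) + s) = col (offII M LI LII LM p + s)" if "p \<in> {1..<M}"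
    "s \<in> {1..LII p}" for p s
    using top[of p "LI p + k (p + 1) + s"] that by (auto simp: ncols_def top_colour_def)
  moreover have "t (M, 0, s) = col (offI LI M + s)" if "s \<in> {1..LM}" for s
    using top[of M s] that M_pos by (auto simp: ncols_def top_colour_def)
  ultimately show "boundary M k LI LII LM col h t"
    using R unfolding boundary_def by blast
qed

definition hcols :: "(nat \<times> nat \<times> nat \<Rightarrow> nat) set" where
  "hcols = {h \<in> hedges M k LI LII LM \<rightarrow>\<^sub>E colours.
     (\<forall>p\<in>{1..M}. \<forall>r\<in>{1..k p}. h (p, r, ncol p) = p + 1) \<and> (\<forall>r\<in>{1..k 1}. h (1, r, 0) = 1)}"

definition tcols :: "(nat \<times> nat \<times> nat \<Rightarrow> nat) \<Rightarrow> (nat \<times> nat \<times> nat \<Rightarrow> nat) set" where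
  "tcols h = {t \<in> tedges M k LI LII LM \<rightarrow>\<^sub>E colours.
     \<forall>p\<in>{1..M}. \<forall>s\<in>{1..ncol p}. t (p, k p, s) = p + 1 \<and> t (p, 0, s) = top_colour p (hword h (p
       + 1) 0) s}"

text \<open>At fixed \<open>h\<close> the vertical edges of different columns are independent, so
  \<open>t\<close> splits into one sequence of colours per column and the sum of products becomes a
  product of sums.\<close>

lemma sum_tcols:
  assumes h: "h \<in> hcols"
  shows "(\<Sum>t\<in>tcols h. \<Prod>p\<in>{1..M}. \<Prod>r\<in>{1..k p}. \<Prod>s\<in>{1..ncol p}.
       wt q (u p r) (cvar p s) (h (p, r, s - 1)) (t (p, r, s)) (h (p, r, s)) (t (p, r - 1, s)))
    = (\<Prod>p\<in>{1..M}. layer_weight p (hword h p) (hword h (p + 1) 0))"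
proof -
  define J where "J = (SIGMA p:{1..M}. {1..ncol p})"
  define B where "B = (\<lambda>(p, s). {f \<in> {0..k p} \<rightarrow>\<^sub>E colours. f (k p) = p + 1 \<and> f 0 = top_colour p
    (hword h (p + 1) 0) s})"
  let ?w = "\<lambda>j f. \<Prod>r\<in>{1..k (fst j)}. wt q (u (fst j) r) (cvar (fst j) (snd j)) (h
    (fst j, r, snd j - 1)) (f r) (h (fst j, r, snd j)) (f (r - 1))"
  have finB: "finite (B j)" for j
    unfolding B_def case_prod_unfold
    by (rule finite_subset[of _ "{0..k (fst j)} \<rightarrow>\<^sub>E colours"]) (auto intro!: finite_PiE finite_C)
  have "(\<Sum>t\<in>tcols h. \<Prod>p\<in>{1..M}. \<Prod>r\<in>{1..k p}. \<Prod>s\<in>{1..ncol p}.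
       wt q (u p r) (cvar p s) (h (p, r, s - 1)) (t (p, r, s)) (h (p, r, s)) (t (p, r - 1, s)))
    = (\<Sum>g\<in>PiE J B. \<Prod>j\<in>J. ?w j (g j))"
  proof (rule sum.reindex_bij_witness[where
        i = "\<lambda>g. restrict (\<lambda>(p, r, s). g (p, s) r) (tedges M k LI LII LM)" and
        j = "\<lambda>t. restrict (\<lambda>(p, s). restrict (\<lambda>r. t (p, r, s)) {0..k p}) J"])
    fix t assume t: "t \<in> tcols h"
    hence tE: "t \<in> tedges M k LI LII LM \<rightarrow>\<^sub>E colours" by (simp add: tcols_def)
    let ?g = "restrict (\<lambda>(p, s). restrict (\<lambda>r. t (p, r, s)) {0..k p}) J"
    show "restrict (\<lambda>(p, r, s). ?g (p, s) r) (tedges M k LI LII LM) = t"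
      by (rule PiE_ext[OF _ tE]) (use tE in \<open>auto simp: tedges_def J_def PiE_iff\<close>)
    show "?g \<in> PiE J B"
      using t by (auto simp: J_def B_def tcols_def tedges_def PiE_iff)
    have "(\<Prod>j\<in>J. ?w j (?g j)) = (\<Prod>p\<in>{1..M}. \<Prod>s\<in>{1..ncol p}. \<Prod>r\<in>{1..k p}.
       wt q (u p r) (cvar p s) (h (p, r, s - 1)) (t (p, r, s)) (h (p, r, s)) (t (p, r - 1, s)))"
      unfolding J_def by (subst prod.Sigma) (auto intro!: prod.cong)
    thus "(\<Prod>j\<in>J. ?w j (?g j)) = (\<Prod>p\<in>{1..M}. \<Prod>r\<in>{1..k p}. \<Prod>s\<in>{1..ncol p}.
       wt q (u p r) (cvar p s) (h (p, r, s - 1)) (t (p, r, s)) (h (p, r, s)) (t (p, r - 1, s)))"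
      by (simp only: prod.swap[of _ "{1..ncol _}"])
  next
    fix g assume g: "g \<in> PiE J B"
    let ?t = "restrict (\<lambda>(p, r, s). g (p, s) r) (tedges M k LI LII LM)"
    have gB: "g (p, s) \<in> B (p, s)" if "p \<in> {1..M}" "s \<in> {1..ncol p}" for p s
      using g that by (auto simp: J_def)
    show "?t \<in> tcols h"
      using gB by (fastforce simp: tcols_def tedges_def B_def PiE_iff)
    show "restrict (\<lambda>(p, s). restrict (\<lambda>r. ?t (p, r, s)) {0..k p}) J = g"
    proof (rule extensionalityI[of _ J])
      show "g \<in> extensional J" using g by (auto simp: PiE_def)
      fix j assume j: "j \<in> J"
      show "restrict (\<lambda>(p, s). restrict (\<lambda>r. ?t (p, r, s)) {0..k p}) J j = g j"
        using j gB[of "fst j" "snd j"]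
        by (auto simp: J_def tedges_def B_def PiE_iff extensional_def fun_eq_iff)
    qed auto
  qed
  also have "\<dots> = (\<Prod>j\<in>J. \<Sum>f\<in>B j. ?w j f)"
    using prod_sum_PiE[of J B ?w] finB by (simp add: J_def)
  also have "\<dots> = (\<Prod>j\<in>J. column (urow (fst j)) (cvar (fst j) (snd j)) (hword h (fst j) (snd j - 1))
    (fst j + 1) (hword h (fst j) (snd j))
        (top_colour (fst j) (hword h (fst j + 1) 0) (snd j)))"
  proof (intro prod.cong refl)
    fix j assume "j \<in> J"
    then obtain p s where j: "j = (p, s)" "p \<in> {1..M}" "s \<in> {1..ncol p}" by (auto simp: J_def)
    have "hword h (p + 1) 0 \<in> words (k (p + 1))" if "p < M"
      using h that by
        (auto simp: words_def hword_def hcols_def hedges_def PiE_iff simp del: upt_Suc)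
    hence "top_colour p (hword h (p + 1) 0) s \<in> colours"
      using j by (intro top_colour_range) auto
    thus "(\<Sum>f\<in>B j. ?w j f) = column (urow (fst j)) (cvar (fst j) (snd j)) (hword h (fst j)
      (snd j - 1)) (fst j + 1) (hword h (fst j) (snd j))
        (top_colour (fst j) (hword h (fst j + 1) 0) (snd j))"
      using row_colour_in(1)[OF j(2)] unfolding j B_def urow_def hword_def fst_conv snd_conv
        prod.case
      by (intro column_path_sum)
  qed
  also have "\<dots> = (\<Prod>p\<in>{1..M}. layer_weight p (hword h p) (hword h (p + 1) 0))"
    unfolding J_def layer_weight_def by (subst prod.Sigma) (auto intro!: prod.cong)
  finally show ?thesis .
qed

lemma layer_weight_cong:
  "(\<And>s. s \<in> {0..ncol p} \<Longrightarrow> f s = f' s) \<Longrightarrow> layer_weight p f w = layer_weight p f' w"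
  unfolding layer_weight_def by (intro prod.cong refl) auto

lemma partition_function_eq_stack:
  "partition_function M k LI LII LM q u vI vII vM col = stack M (urow (M + 1)) []"
proof -
  let ?w = "\<lambda>h t. \<Prod>p\<in>{1..M}. \<Prod>r\<in>{1..k p}. \<Prod>s\<in>{1..ncol p}.
       wt q (u p r) (cvar p s) (h (p, r, s - 1)) (t (p, r, s)) (h (p, r, s)) (t (p, r - 1, s))"
  have fin_h: "finite hcols"
    by (rule finite_subset[of _ "hedges M k LI LII LM \<rightarrow>\<^sub>E colours"])
      (auto simp: hcols_def hedges_def intro!: finite_PiE finite_C)
  have fin_t: "finite (tcols h)" for h
    by (rule finite_subset[of _ "tedges M k LI LII LM \<rightarrow>\<^sub>E colours"])
      (auto simp: tcols_def tedges_def intro!: finite_PiE finite_C)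
  have "{(h, t) \<in> edge_colourings M k LI LII LM. boundary M k LI LII LM col h t}
    = Sigma hcols tcols"
    unfolding boundary_iff edge_colourings_def hcols_def tcols_def colours_def by blast
  hence "partition_function M k LI LII LM q u vI vII vM col = (\<Sum>(h, t)\<in>Sigma hcols tcols. ?w h t)"
    unfolding partition_function_def
  proof (intro sum.cong, simp, clarify, intro prod.cong refl Rcoeff_eq_wt)
    fix h t p r s
    assume "h \<in> hcols" "t \<in> tcols h" "p \<in> {1..M}" "r \<in> {1..k p}" "s \<in> {1..ncol p}"
    thus "h (p, r, s - 1) \<in> {1..M + 1}" "t (p, r, s) \<in> {1..M + 1}"
      unfolding hcols_def tcols_def hedges_def tedges_def PiE_iff colours_def by auto
  qed
  also have "\<dots> = (\<Sum>h\<in>hcols. \<Sum>t\<in>tcols h. ?w h t)"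
    using fin_h fin_t by (simp add: sum.Sigma)
  also have "\<dots> = (\<Sum>h\<in>hcols. \<Prod>p\<in>{1..M}. layer_weight p (hword h p) (hword h (p + 1) 0))"
    by (intro sum.cong refl sum_tcols)
  also have "\<dots> = (\<Sum>g\<in>{g \<in> PiE {1..M} hpaths. set (g 1 0) \<subseteq> {1}}.
      \<Prod>p\<in>{1..M}. layer_weight p (g p) (if p = M then [] else g (p + 1) 0))"
  \<comment> \<open>Colourings of the horizontal edges correspond to one path of words per layer;
    row \<open>r\<close> is entry \<open>r - 1\<close> of a word.\<close>
  proof (rule sum.reindex_bij_witness[where
        j = "\<lambda>h. restrict (\<lambda>p. restrict (hword h p) {0..ncol p}) {1..M}" and
        i = "\<lambda>g. restrict (\<lambda>(p, r, s). g p s ! (r - 1)) (hedges M k LI LII LM)"])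
    fix h assume h: "h \<in> hcols"
    hence hE: "h \<in> hedges M k LI LII LM \<rightarrow>\<^sub>E colours" by (simp add: hcols_def)
    let ?g = "restrict (\<lambda>p. restrict (hword h p) {0..ncol p}) {1..M}"
    show "restrict (\<lambda>(p, r, s). ?g p s ! (r - 1)) (hedges M k LI LII LM) = h"
      by (rule extensionalityI[of _ "hedges M k LI LII LM"])
        (use hE in \<open>auto simp: hedges_def PiE_def hword_def simp del: upt_Suc\<close>)
    have "hword h p s \<in> words (k p)" if "p \<in> {1..M}" "s \<in> {0..ncol p}" for p s
      using hE that by (auto simp: words_def hword_def hedges_def PiE_iff simp del: upt_Suc)
    moreover have "hword h p (ncol p) = replicate (k p) (p + 1)" if "p \<in> {1..M}" for p
      using h that by (auto simp: hcols_def hword_def eq_replicate_iff simp del: upt_Suc)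
    moreover have "set (hword h 1 0) \<subseteq> {1}"
      using h by (auto simp: hcols_def hword_def simp del: upt_Suc)
    ultimately show "?g \<in> {g \<in> PiE {1..M} hpaths. set (g 1 0) \<subseteq> {1}}"
      using M_pos by (auto simp: hpaths_def)
    show "(\<Prod>p\<in>{1..M}. layer_weight p (?g p) (if p = M then [] else ?g (p + 1) 0))
        = (\<Prod>p\<in>{1..M}. layer_weight p (hword h p) (hword h (p + 1) 0))"
    proof (intro prod.cong refl)
      fix p assume p: "p \<in> {1..M}"
      have "layer_weight p (?g p) w = layer_weight p (hword h p) w" for w
        using p by (intro layer_weight_cong) auto
      \<comment> \<open>For \<open>p = M\<close> the word of a next layer is not read, so
        \<open>[]\<close> may stand for \<open>hword h (M + 1) 0\<close>.\<close>
      moreover have "layer_weight p f (if p = M then [] else ?g (p + 1) 0) = layer_weight p f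
        (hword h (p + 1) 0)" for f
        using p layer_weight_last[of p f "[]" "hword h (p + 1) 0"] by auto
      ultimately show "layer_weight p (?g p) (if p = M then [] else ?g (p + 1) 0) = layer_weight p
        (hword h p) (hword h (p + 1) 0)"
        by simp
    qed
  next
    fix g assume "g \<in> {g \<in> PiE {1..M} hpaths. set (g 1 0) \<subseteq> {1}}"
    hence g: "g \<in> PiE {1..M} hpaths" and g1: "set (g 1 0) \<subseteq> {1}" by auto
    let ?h = "restrict (\<lambda>(p, r, s). g p s ! (r - 1)) (hedges M k LI LII LM)"
    have gp: "g p \<in> hpaths p" if "p \<in> {1..M}" for p using g that by auto
    have gw: "g p s \<in> words (k p)" if "p \<in> {1..M}" "s \<in> {0..ncol p}" for p s
      using gp[OF that(1)] that by (auto simp: hpaths_def)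
    have hw: "hword ?h p s = g p s" if "p \<in> {1..M}" "s \<in> {0..ncol p}" for p s
      using gw[OF that] that
      by (intro nth_equalityI) (auto simp: words_def hword_def hedges_def simp del: upt_Suc)
    show "restrict (\<lambda>p. restrict (hword ?h p) {0..ncol p}) {1..M} = g"
    proof (rule extensionalityI[of _ "{1..M}"])
      fix p assume p: "p \<in> {1..M}"
      show "restrict (\<lambda>p. restrict (hword ?h p) {0..ncol p}) {1..M} p = g p"
      proof
        fix s
        have "g p s = undefined" if "s \<notin> {0..ncol p}"
          using gp[OF p] that by (auto simp: hpaths_def)
        thus "restrict (\<lambda>p. restrict (hword ?h p) {0..ncol p}) {1..M} p s = g p s"
          using p hw[OF p, of s] by (cases "s \<in> {0..ncol p}")
            (simp_all only: restrict_apply if_True if_False not_False_eq_True)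
      qed
    qed (use g in \<open>auto simp: PiE_def\<close>)
    have nth_in: "g p s ! (r - 1) \<in> set (g p s)" if "p \<in> {1..M}" "s \<in> {0..ncol p}"
      "r \<in> {1..k p}" for p r s
      using gw[OF that(1,2)] that by (intro nth_mem) (auto simp: words_def)
    have "g p s ! (r - 1) \<in> colours" if "p \<in> {1..M}" "s \<in> {0..ncol p}" "r \<in> {1..k p}" for p r s
      using nth_in[OF that] gw[OF that(1,2)] by (auto simp: words_def)
    moreover have "g p (ncol p) ! (r - 1) = p + 1" if "p \<in> {1..M}" "r \<in> {1..k p}" for p r
      using gp[OF that(1)] that by (auto simp: hpaths_def)
    moreover have "g 1 0 ! (r - 1) = 1" if "r \<in> {1..k 1}" for r
      using nth_in[of 1 0 r] g1 that M_pos by auto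
    ultimately show "?h \<in> hcols"
      using M_pos by (auto simp: hcols_def hedges_def PiE_iff)
  qed
  also have "\<dots> = (\<Sum>g\<in>PiE {1..M} hpaths. of_bool (set (if M = 0 then [] else g 1 0) \<subseteq> {1})
       * (\<Prod>p\<in>{1..M}. layer_weight p (g p) (if p = M then [] else g (p + 1) 0)))"
  proof -
    have "finite (PiE {1..M} hpaths)"
      by (intro finite_PiE) auto
    thus ?thesis using M_pos by (intro sum.mono_neutral_cong_left) auto
  qed
  also have "\<dots> = stack M (urow (M + 1)) []"
    by (rule stack_path_sum) auto
  finally show ?thesis .
qed

text \<open>Here \<open>y\<close> lists the permuted row variables of layer \<open>p\<close> and
  \<open>x\<close> those of the next layer. The inner columns are coloured by
  \<open>Iset (p + 1)\<close> in increasing order, the word left over once the boundary colours of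
  the later layers have been removed.\<close>

definition stack_weight :: "nat \<Rightarrow> (nat \<Rightarrow> 'a) \<Rightarrow> (nat \<Rightarrow> 'a) \<Rightarrow> 'a" where
  "stack_weight p y x = wterm (p + 1) (map y [1..<Suc (k p)]) (cvars p (map x [1..<Suc (k (p
    + 1))]))
     (top_word p (map col (sorted_list_of_set (Iset M LI LII LM col (p + 1)))))"

section \<open>Coordinates, columns and their colours\<close>

abbreviation "Iat \<equiv> Iset M LI LII LM col"

abbreviation "inner_word p \<equiv> map col (sorted_list_of_set (Iat p))"

lemma offI_Suc: "1 \<le> p \<Longrightarrow> offI LI (Suc p) = offI LI p + LI p"
  unfolding offI_def by (simp add: atLeastLessThanSuc)

lemma offI_mono: "p \<le> p' \<Longrightarrow> offI LI p \<le> offI LI p'"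
  unfolding offI_def by (intro sum_mono2) auto

lemma offII_Suc: "p < M \<Longrightarrow> offII M LI LII LM p = offII M LI LII LM (Suc p) + (if Suc p < M then LII
  (Suc p) else 0)"
proof -
  assume "p < M"
  have "{p<..<M} = (if Suc p < M then insert (Suc p) {Suc p<..<M} else {})"
    by auto
  thus ?thesis by (auto simp: offII_def)
qed

lemma offII_antimono: "p \<le> p' \<Longrightarrow> offII M LI LII LM p' \<le> offII M LI LII LM p"
  unfolding offII_def by (intro add_left_mono sum_mono2) auto

text \<open>The order of the \<open>v\<close>-variables is nested: \<open>vI p\<close> precedes and
  \<open>vII p\<close> follows all coordinates of the layers \<open>p + 1\<close>, ...,
  \<open>M\<close>.\<close>

lemma Ihat_bounds:
  assumes "1 \<le> p" "p < M" "c \<in> Ihat M LI LII LM (Suc p)"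
  shows "offI LI p + LI p < c" "c \<le> offII M LI LII LM p"
proof -
  obtain p' where p': "Suc p \<le> p'" "p' \<le> M" "c \<in> layer_coords M LI LII LM p'"
    using assms by (auto simp: Ihat_def)
  have low: "offI LI p + LI p \<le> offI LI p'"
    using offI_mono[OF p'(1)] offI_Suc[OF assms(1)] by simp
  have le_M: "offI LI M \<le> offII M LI LII LM p''" for p'' by (simp add: offII_def)
  have "offI LI p + LI p < c \<and> c \<le> offII M LI LII LM p"
  proof (cases "p' < M")
    case True
    then consider s where "c = offI LI p' + s" "s \<in> {1..LI p'}" | s where "c = offII M LI LII LM p'
      + s" "s \<in> {1..LII p'}"
      using p'(3) by (auto simp: layer_coords_def)
    thus ?thesis
    proof cases
      case 1
      have "offI LI p' + LI p' \<le> offI LI M" using offI_mono[of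
        "Suc p'" M] offI_Suc[of p'] True assms p' by simp
      thus ?thesis using 1 low le_M[of p] by auto
    next
      case 2
      have "offII M LI LII LM p' + LII p' = offII M LI LII LM (p' - 1)"
        using offII_Suc[of "p' - 1"] True p' by simp
      also have "\<dots> \<le> offII M LI LII LM p" using p' by (intro offII_antimono) auto
      finally show ?thesis using 2 low le_M[of p'] offI_mono[of p' M] p' by auto
    qed
  next
    case False
    then obtain s where "c = offI LI M + s" "s \<in> {1..LM}" using p' by (auto simp: layer_coords_def)
    moreover have "offI LI M + LM \<le> offII M LI LII LM p" by (simp add: offII_def)
    ultimately show ?thesis using low p' False by auto
  qed
  thus "offI LI p + LI p < c" "c \<le> offII M LI LII LM p" by auto
qed

lemma finite_Ihat [simp]: "finite (Ihat M LI LII LM p)"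
proof -
  have "finite (layer_coords M LI LII LM p)" for p
    by (auto simp: layer_coords_def setcompr_eq_image)
  thus ?thesis by (simp add: Ihat_def)
qed

lemma finite_Iset [simp]: "finite (Iat p)"
  unfolding Iset_def by (rule finite_subset[OF _ finite_Ihat[of p]]) auto

text \<open>These are the coordinates that \<open>relabel\<close> numbers. In increasing order they
  are the columns of layer \<open>p\<close>, and the turning columns among them form
  \<open>Iset p\<close>.\<close>

definition visible :: "nat \<Rightarrow> nat set" where
  "visible p = {c \<in> Ihat M LI LII LM p. col c \<in> {1..p + 1}}"

lemma finite_visible [simp]: "finite (visible p)"
  unfolding visible_def by (rule finite_subset[OF _ finite_Ihat[of p]]) auto

lemma Ihat_Suc: "p \<le> M \<Longrightarrow> Ihat M LI LII LM p = layer_coords M LI LII LM p \<union> Ihat M LI LII LM (Suc p)"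
  unfolding Ihat_def by (auto simp: atLeastAtMost_insertL[symmetric])

lemma visible_split:
  assumes "p \<in> {1..M}"
  shows "visible p = layer_coords M LI LII LM p \<union> Iat (Suc p)"
proof -
  have "col c \<in> {1..p + 1}" if "c \<in> layer_coords M LI LII LM p" for c
    using colouring assms that by (auto simp: is_colouring_def)
  thus ?thesis using Ihat_Suc[of p] assms by (auto simp: visible_def Iset_def)
qed

lemma Iset_subset_visible: "Iat p = {c \<in> visible p. col c \<noteq> p + 1}"
  by (auto simp: Iset_def visible_def)

lemma layer_coords_image:
  "layer_coords M LI LII LM p =
     (if p < M then (+) (offI LI p) ` {1..LI p} \<union> (+) (offII M LI LII LM p) ` {1..LII p}
      else (+) (offI LI M) ` {1..LM})"
  unfolding layer_coords_def by (auto simp del: image_add_atLeastAtMost)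

lemma set_map_plus_upt: "set (map ((+) x) [1..<Suc m]) = (+) x ` {1..m}"
  by (simp add: atLeastLessThanSuc_atLeastAtMost del: upt_Suc)

text \<open>By nesting, the own \<open>v\<close>-columns of layer \<open>p\<close> stand to the left
  and right of the inherited ones, exactly as in the grid. Hence a relabelled coordinate is a column
  number.\<close>

lemma sorted_visible:
  assumes "1 \<le> p" "p < M"
  shows "sorted_list_of_set (visible p) = map ((+) (offI LI p)) [1..<Suc (LI p)]
    @ sorted_list_of_set (Iat (Suc p))
      @ map ((+) (offII M LI LII LM p)) [1..<Suc (LII p)]"
proof (rule sorted_list_of_set_eqI)
  have b: "offI LI p + LI p < c" "c \<le> offII M LI LII LM p" if "c \<in> Iat (Suc p)" for c
    using Ihat_bounds[OF assms, of c] that by (auto simp: Iset_def)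
  have le: "offI LI p + LI p \<le> offII M LI LII LM p"
    using offI_Suc[OF assms(1)] offI_mono[of "Suc p" M] assms by (simp add: offII_def)
  have sm: "sorted (map ((+) x) [1..<Suc m])" "distinct (map ((+) x) [1..<Suc m])" for x m :: nat
    by (simp_all add: sorted_map distinct_map sorted_wrt_mono_rel[of _ "(\<le>)"] del: upt_Suc)
  show "sorted (map ((+) (offI LI p)) [1..<Suc (LI p)] @ sorted_list_of_set (Iat (Suc p))
      @ map ((+) (offII M LI LII LM p)) [1..<Suc (LII p)])"
    unfolding sorted_append using sm b le by (fastforce simp del: upt_Suc)
  show "distinct (map ((+) (offI LI p)) [1..<Suc (LI p)] @ sorted_list_of_set (Iat (Suc p))
      @ map ((+) (offII M LI LII LM p)) [1..<Suc (LII p)])"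
    unfolding distinct_append using sm b le by (fastforce simp del: upt_Suc)
  show "set (map ((+) (offI LI p)) [1..<Suc (LI p)] @ sorted_list_of_set (Iat (Suc p))
      @ map ((+) (offII M LI LII LM p)) [1..<Suc (LII p)]) = visible p"
    unfolding set_append set_map_plus_upt
    using visible_split[of p] assms by
      (auto simp: layer_coords_image simp del: image_add_atLeastAtMost)
qed

lemma sorted_visible_last: "sorted_list_of_set (visible M) = map ((+) (offI LI M)) [1..<Suc LM]"
proof (rule sorted_list_of_set_eqI)
  have "Iat (Suc M) = {}" by (simp add: Iset_def Ihat_def)
  thus "set (map ((+) (offI LI M)) [1..<Suc LM]) = visible M"
    unfolding set_map_plus_upt
    using visible_split[of M] M_pos by (simp add: layer_coords_image)
qed (simp_all add: sorted_map distinct_map sorted_wrt_mono_rel[of _ "(\<le>)"] del: upt_Suc)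

lemma top_word_inner:
  assumes "p \<in> {1..M}"
  shows "top_word p (inner_word (Suc p)) = map col (sorted_list_of_set (visible p))"
proof (cases "p < M")
  case True
  thus ?thesis using assms sorted_visible[of p] by (simp add: top_word_def o_def del: upt_Suc)
next
  case False
  hence "p = M" using assms by simp
  thus ?thesis using sorted_visible_last by (simp add: top_word_def o_def del: upt_Suc)
qed

text \<open>This closes the recursion over layers: removing the boundary colour from the top word of
  layer \<open>p\<close> gives the inner word of layer \<open>p - 1\<close>.\<close>

lemma filter_top_word:
  assumes "p \<in> {1..M}"
  shows "filter (\<lambda>c. c \<noteq> p + 1) (top_word p (inner_word (Suc p))) = inner_word p"
  unfolding top_word_inner[OF assms] Iset_subset_visible[of p]
  by (simp add: filter_map o_def filter_sorted_list_of_set)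

end

section \<open>The identity for generic parameters\<close>

locale generic_layered_model = layered_model +
  assumes inj: "\<And>p. p \<in> {1..M} \<Longrightarrow> inj_on (u p) {1..k p}"
    and generic: "\<And>p a b. p \<in> {1..M} \<Longrightarrow> a \<in> {1..k p} \<Longrightarrow> b \<in> {1..k p} \<Longrightarrow> a \<noteq> b \<Longrightarrow> u p a \<noteq> q * u p b"
    and card_Iset: "\<And>p. p \<in> {1..M} \<Longrightarrow> card (Iset M LI LII LM col p) = k p"
begin

lemma distinct_urow: "p \<in> {1..M} \<Longrightarrow> distinct (urow p)"
  using inj[of p] by (simp add: urow_def distinct_map atLeastLessThanSuc_atLeastAtMost del: upt_Suc)

lemma urow_generic:
  assumes "p \<in> {1..M}" "x \<in> set (urow p)" "y \<in> set (urow p)" "x \<noteq> y"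
  shows "x \<noteq> q * y"
proof -
  obtain a b where ab: "x = u p a" "y = u p b" "a \<in> {1..k p}" "b \<in> {1..k p}"
    using assms(2,3) by (auto simp: urow_def simp del: upt_Suc)
  thus ?thesis using generic[OF assms(1) ab(3,4)] assms(4) by metis
qed

text \<open>Layer \<open>p + 1\<close> has boundary colour \<open>p + 2\<close>, whence the shift.
  At level 0 only words in the colour 1 occur, and \<open>R(v, w)\<close> is a scalar on them. In
  the step, exchange holds for the output of any layer, while support needs the expansion: a nonzero
  term forces the colours other than \<open>p + 2\<close> into the support of
  \<open>stack p\<close>, so all of them are below \<open>p + 3\<close>.\<close>

lemma stack_exchangeable_supported:
  assumes "p < M"
  shows "exchangeable (stack p) \<and> supported_below (p + 2) (stack p)"
  using assms
proof (induction p)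
  case 0
  have 1: "1 \<in> colours" by (simp add: colours_def)
  have ex: "exchangeable (stack 0)"
    unfolding exchangeable_def
  proof (intro allI ballI impI)
    fix xs ys :: "'a list" and v w :: 'a and as bs :: "nat list" and e1 e2 :: nat
    assume "e1 \<in> colours" "e2 \<in> colours"
    let ?b = "of_bool (set as \<subseteq> {1} \<and> set bs \<subseteq> {1}) :: 'a"
    have "(\<Sum>d1\<in>colours. \<Sum>d2\<in>colours. stack 0 (xs @ v # w # ys) (as @ d1 # d2 # bs)
      * wt q v w d1 d2 e1 e2)
      = (\<Sum>d1\<in>colours. \<Sum>d2\<in>colours. if d2 = 1 then if d1 = 1 then ?b
        * wt q v w 1 1 e1 e2 else 0 else 0)"
      by (intro sum.cong refl) auto
    also have "\<dots> = ?b * wt q v w 1 1 e1 e2" using 1 finite_C by simp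
    also have "\<dots> = (v - q * w) * stack 0 (xs @ w # v # ys) (as @ e2 # e1 # bs)"
      by (auto simp: wt_equal)
    finally show "(\<Sum>d1\<in>colours. \<Sum>d2\<in>colours. stack 0 (xs @ v # w # ys) (as @ d1 # d2 # bs)
      * wt q v w d1 d2 e1 e2)
      = (v - q * w) * stack 0 (xs @ w # v # ys) (as @ e2 # e1 # bs)" .
  qed
  have "supported_below (0 + 2) (stack 0)" by (auto simp: supported_below_def)
  with ex show ?case by blast
next
  case (Suc p)
  hence IH: "exchangeable (stack p)" "supported_below (p + 2) (stack p)" by auto
  have P: "p + 2 \<in> colours" using Suc.prems by (auto simp: colours_def)
  have pM: "p + 1 < M" using Suc.prems by simp
  have "exchangeable (\<lambda>xs w. layer (p + 2) (stack p) (urow (p + 1)) (cvars (p + 1) xs) (top_word (p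
    + 1) w))"
    unfolding cvars_def top_word_def if_P[OF pM]
    by (rule exchangeable_layer[OF P]) simp
  hence ex: "exchangeable (stack (Suc p))"
    unfolding exchangeable_def stack.simps .
  have "set w \<subseteq> {..<Suc p + 2}" if w: "w \<in> words (length xs)" and nz: "stack
    (Suc p) xs w \<noteq> 0" for xs w
  proof -
    have "layer (p + 2) (stack p) (urow (p + 1)) (cvars (p + 1) xs) (top_word (p + 1) w) =
      (\<Sum>ws\<in>permutations_of_set (set (urow (p + 1))). wterm (p + 2) ws (cvars (p + 1) xs) (top_word
        (p + 1) w) *
         stack p ws (filter (\<lambda>c. c \<noteq> p + 2) (top_word (p + 1) w)))"
    proof (rule layer_eq_sum_permutations[OF IH P])
      show "top_word (p + 1) w \<in> words (length (cvars (p + 1) xs))"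
        using w pM top_word_in_words[of "p + 1" w] unfolding words_def
        by (auto simp: top_word_def cvars_def simp del: upt_Suc)
    qed (use distinct_urow[of "p + 1"] urow_generic[of "p + 1"] pM in auto)
    hence "(\<Sum>ws\<in>permutations_of_set (set (urow (p + 1))). wterm (p + 2) ws (cvars (p
      + 1) xs) (top_word (p + 1) w) *
         stack p ws (filter (\<lambda>c. c \<noteq> p + 2) (top_word (p + 1) w))) \<noteq> 0"
      using nz by simp
    then obtain ws where "wterm (p + 2) ws (cvars (p + 1) xs) (top_word (p + 1) w) *
        stack p ws (filter (\<lambda>c. c \<noteq> p + 2) (top_word (p + 1) w)) \<noteq> 0"
      by (rule sum.not_neutral_contains_not_neutral)
    hence ws: "wterm (p + 2) ws (cvars (p + 1) xs) (top_word (p + 1) w) \<noteq> 0"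
        "stack p ws (filter (\<lambda>c. c \<noteq> p + 2) (top_word (p + 1) w)) \<noteq> 0"
      by auto
    hence "length (filter (\<lambda>c. c \<noteq> p + 2) (top_word (p + 1) w)) = length ws"
      using wterm_nonzero_length by blast
    moreover have "set (top_word (p + 1) w) \<subseteq> colours"
      using w pM by (intro top_word_in_words) (auto simp: words_def)
    ultimately have "filter (\<lambda>c. c \<noteq> p + 2) (top_word (p + 1) w) \<in> words (length ws)"
      by (auto simp: words_def)
    hence "set (filter (\<lambda>c. c \<noteq> p + 2) (top_word (p + 1) w)) \<subseteq> {..<p + 2}"
      using IH(2) ws(2) unfolding supported_below_def by blast
    moreover have "set w \<subseteq> set (top_word (p + 1) w)" using pM by (auto simp: top_word_def)
    ultimately show ?thesis by fastforce
  qed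
  thus ?case using ex unfolding supported_below_def by blast
qed

lemma stack_Suc:
  assumes "p + 1 \<le> M" "length (top_word (p + 1) w) = length (cvars (p + 1) xs)" "p
    + 1 < M \<Longrightarrow> set w \<subseteq> colours"
  shows "stack (Suc p) xs w = (\<Sum>\<pi>\<in>{\<pi>. \<pi> permutes {1..k (p + 1)}}.
     wterm (p + 2) (map (\<lambda>a. u (p + 1) (\<pi> a)) [1..<Suc (k (p + 1))]) (cvars (p + 1) xs) (top_word (p
       + 1) w) *
     stack p (map (\<lambda>a. u (p + 1) (\<pi> a)) [1..<Suc (k (p + 1))]) (filter (\<lambda>c. c \<noteq> p + 2) (top_word (p
       + 1) w)))"
proof -
  have P: "p + 2 \<in> colours" using assms by (auto simp: colours_def)
  have "stack (Suc p) xs w = (\<Sum>ws\<in>permutations_of_set (set (urow (p + 1))).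
     wterm (p + 2) ws (cvars (p + 1) xs) (top_word (p + 1) w) * stack p ws (filter (\<lambda>c. c \<noteq> p
       + 2) (top_word (p + 1) w)))"
    unfolding stack.simps
  proof (rule layer_eq_sum_permutations[OF _ _ P])
    show "exchangeable (stack p)" "supported_below (p + 2) (stack p)"
      using stack_exchangeable_supported[of p] assms by auto
    show "top_word (p + 1) w \<in> words (length (cvars (p + 1) xs))"
      using assms top_word_in_words[of "p + 1" w] by (auto simp: words_def)
  qed (use distinct_urow[of "p + 1"] urow_generic[of "p + 1"] assms in auto)
  thus ?thesis
    unfolding urow_def using inj[of "p + 1"] assms by (subst (asm) sum_permutations_of_set) auto
qed

lemma length_inner_word: "p \<in> {1..M} \<Longrightarrow> length (inner_word p) = k p"
  using card_Iset by simp

text \<open>The permuted row variables of layer \<open>p + 1\<close> are the column variables of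
  layer \<open>p\<close>, so each permutation enters two neighbouring factors. Keeping
  \<open>x\<close> free in the induction is what passes them down.\<close>

lemma stack_expansion:
  assumes "P \<le> M"
  shows "stack P (map x [1..<Suc (k (P + 1))]) (inner_word (P + 1))
    = (\<Sum>\<sigma>\<in>(\<Pi>\<^sub>E p\<in>{1..P}. {\<pi>. \<pi> permutes {1..k p}}).
        \<Prod>p\<in>{1..P}. stack_weight p (\<lambda>a. u p (\<sigma> p a)) (if p = P then x else (\<lambda>a. u (p + 1) (\<sigma> (p
          + 1) a))))"
  using assms
proof (induction P arbitrary: x)
  case 0
  have "set (inner_word 1) \<subseteq> {1}" by (auto simp: Iset_def)
  thus ?case by simp
next
  case (Suc P)
  have P: "P + 1 \<in> {1..M}" using Suc.prems by simp
  have colset: "set (inner_word (Suc (P + 1))) \<subseteq> colours" if "P + 1 < M"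
    using that by (auto simp: Iset_def colours_def)
  have len: "length (top_word (P + 1) (inner_word (Suc (P + 1)))) = length (cvars (P
    + 1) (map x [1..<Suc (k (Suc P + 1))]))"
    using length_inner_word[of "Suc (P
      + 1)"] by (auto simp: top_word_def cvars_def simp del: upt_Suc)
  let ?perms = "\<lambda>p. {\<pi>. \<pi> permutes {1..k p}}"
  have ins: "{1..Suc P} = insert (Suc P) {1..P}" by auto
  have "stack (Suc P) (map x [1..<Suc (k (Suc P + 1))]) (inner_word (Suc P + 1))
    = (\<Sum>\<pi>\<in>?perms (Suc P). stack_weight (Suc P) (\<lambda>a. u (Suc P) (\<pi> a)) x *
        stack P (map (\<lambda>a. u (Suc P) (\<pi> a)) [1..<Suc (k (P + 1))]) (inner_word (P + 1)))"
    using stack_Suc[of P "inner_word (Suc (P + 1))" "map x [1..<Suc (k (Suc P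
      + 1))]"] len colset Suc.prems filter_top_word[OF P]
    by (simp add: stack_weight_def del: upt_Suc stack.simps)
  also have "\<dots> = (\<Sum>\<pi>\<in>?perms (Suc P). \<Sum>\<sigma>\<in>PiE {1..P} ?perms. stack_weight (Suc P) (\<lambda>a. u (Suc P)
    (\<pi> a)) x *
        (\<Prod>p\<in>{1..P}. stack_weight p (\<lambda>a. u p (\<sigma> p a)) (if p = P then (\<lambda>a. u (Suc P) (\<pi> a)) else
          (\<lambda>a. u (p + 1) (\<sigma> (p + 1) a)))))"
    using Suc by (simp add: sum_distrib_left del: upt_Suc)
  also have "\<dots> = (\<Sum>\<sigma>\<in>PiE {1..Suc P} ?perms. \<Prod>p\<in>{1..Suc P}. stack_weight p (\<lambda>a. u p (\<sigma> p a))
        (if p = Suc P then x else (\<lambda>a. u (p + 1) (\<sigma> (p + 1) a))))"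
    unfolding ins
  proof (subst sum_PiE_insert, simp, intro sum.cong refl)
    fix \<pi> \<sigma>
    have "(\<Prod>p\<in>{1..P}. stack_weight p (\<lambda>a. u p ((\<sigma>(Suc P := \<pi>)) p a)) (if p = Suc P then x else
      (\<lambda>a. u (p + 1) ((\<sigma>(Suc P := \<pi>)) (p + 1) a))))
      = (\<Prod>p\<in>{1..P}. stack_weight p (\<lambda>a. u p (\<sigma> p a)) (if p = P then (\<lambda>a. u (Suc P) (\<pi> a)) else
        (\<lambda>a. u (p + 1) (\<sigma> (p + 1) a))))"
      by (intro prod.cong refl) auto
    thus "stack_weight (Suc P) (\<lambda>a. u (Suc P) (\<pi> a)) x *
        (\<Prod>p\<in>{1..P}. stack_weight p (\<lambda>a. u p (\<sigma> p a)) (if p = P then (\<lambda>a. u (Suc P) (\<pi> a)) else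
          (\<lambda>a. u (p + 1) (\<sigma> (p + 1) a))))
      = (\<Prod>p\<in>insert (Suc P) {1..P}. stack_weight p (\<lambda>a. u p ((\<sigma>(Suc P := \<pi>)) p a)) (if p
        = Suc P then x else (\<lambda>a. u (p + 1) ((\<sigma>(Suc P := \<pi>)) (p + 1) a))))"
      by simp
  qed
  finally show ?case .
qed

section \<open>Relabelled positions as column numbers\<close>

lemma relabel_nth:
  assumes "s < card (visible p)"
  shows "relabel M LI LII LM col p (sorted_list_of_set (visible p) ! s) = Suc s"
proof -
  let ?L = "sorted_list_of_set (visible p)"
  have len: "length ?L = card (visible p)" by simp
  have sd: "sorted_wrt (<) ?L" by simp
  have mono: "i < card (visible p) \<Longrightarrow> ?L ! i \<le> ?L ! s \<longleftrightarrow> i \<le> s" for i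
    using assms sorted_wrt_nth_less[OF sd, of i s] sorted_wrt_nth_less[OF sd, of s i] len
    by (cases i s rule: linorder_cases) auto
  have "{d \<in> Ihat M LI LII LM p. col d \<in> {1..p + 1} \<and> d \<le> ?L ! s} = {d \<in> set ?L. d \<le> ?L ! s}"
    by (auto simp: visible_def)
  also have "\<dots> = (\<lambda>i. ?L ! i) ` {..s}"
  proof (intro equalityI subsetI)
    fix d assume "d \<in> {d \<in> set ?L. d \<le> ?L ! s}"
    then obtain i where "i < card (visible p)" "d = ?L ! i" "?L ! i \<le> ?L ! s"
      by (metis (mono_tags, lifting) in_set_conv_nth len mem_Collect_eq)
    thus "d \<in> (\<lambda>i. ?L ! i) ` {..s}" using mono by auto
  next
    fix d assume "d \<in> (\<lambda>i. ?L ! i) ` {..s}"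
    then obtain i where "i \<le> s" "d = ?L ! i" by auto
    moreover have "?L ! i \<in> set ?L" using \<open>i \<le> s\<close> assms len by (intro nth_mem) simp
    ultimately show "d \<in> {d \<in> set ?L. d \<le> ?L ! s}" using mono[of i] assms by auto
  qed
  also have "card \<dots> = card {..s}"
    by (rule card_image) (use assms len in \<open>auto simp: inj_on_def nth_eq_iff_index_eq\<close>)
  finally show ?thesis by (simp add: relabel_def)
qed

text \<open>Counting visible coordinates up to a given one inverts their increasing enumeration. The
  relabelled set therefore consists of the turning columns of layer \<open>p\<close>.\<close>

lemma Itilde_eq:
  "Itilde M LI LII LM col p = {s \<in> {1..card (visible p)}. col (sorted_list_of_set (visible p) !
    (s - 1)) \<noteq> p + 1}"
proof -
  let ?L = "sorted_list_of_set (visible p)"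
  have "Iat p = (\<lambda>s. ?L ! (s - 1)) ` {s \<in> {1..card (visible p)}. col (?L ! (s - 1)) \<noteq> p + 1}"
  proof (intro equalityI subsetI)
    fix c assume "c \<in> Iat p"
    hence "c \<in> set ?L" "col c \<noteq> p + 1" using Iset_subset_visible[of p] by auto
    then obtain i where "i < card (visible p)" "c = ?L ! i" "col (?L ! i) \<noteq> p + 1"
      by (metis in_set_conv_nth length_sorted_list_of_set)
    thus "c \<in> (\<lambda>s. ?L ! (s - 1)) ` {s \<in> {1..card (visible p)}. col (?L ! (s - 1)) \<noteq> p + 1}"
      by (intro image_eqI[of _ _ "Suc i"]) auto
  next
    fix c assume "c \<in> (\<lambda>s. ?L ! (s - 1)) ` {s \<in> {1..card (visible p)}. col (?L ! (s - 1)) \<noteq> p + 1}"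
    then obtain s where s: "s \<in> {1..card (visible p)}" "col (?L ! (s - 1)) \<noteq> p + 1" "c
      = ?L ! (s - 1)" by auto
    have "?L ! (s - 1) \<in> set ?L" using s by (intro nth_mem) auto
    thus "c \<in> Iat p" using s Iset_subset_visible[of p] by auto
  qed
  moreover have "relabel M LI LII LM col p (?L ! (s - 1)) = s" if "s \<in> {1..card (visible p)}" for s
    using relabel_nth[of "s - 1" p] that by auto
  ultimately show ?thesis unfolding Itilde_def by (auto simp: image_image)
qed

lemma card_visible: "p \<in> {1..M} \<Longrightarrow> card (visible p) = ncol p"
  using arg_cong[OF top_word_inner[of p], of length] length_inner_word[of "Suc p"]
  by (auto simp: top_word_def ncols_def simp del: upt_Suc split: if_splits)

text \<open>The update \<open>u(p + 1 := x)\<close> places the permuted variables of the next layer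
  into the columns: \<open>mcol\<close> reads \<open>u\<close> at layer \<open>p\<close> only
  through the index \<open>p + 1\<close>.\<close>

lemma stack_weight_explicit:
  assumes p: "p \<in> {1..M}"
  shows "stack_weight p y x =
    (\<Prod>a\<in>{1..k p}. (\<Prod>i\<in>{1..nth_smallest (Itilde M LI LII LM col p) a - 1}. y a - colvar M k LI (u(p
      + 1 := x)) vI vII vM p i)
        * ((1 - q) * y a)
        * (\<Prod>i\<in>{nth_smallest (Itilde M LI LII LM col p) a + 1..ncol p}. y a - q * colvar M k LI (u(p
          + 1 := x)) vI vII vM p i))
    * (\<Prod>(a, b)\<in>{(a, b) \<in> {1..k p} \<times> {1..k p}. a < b}. (q * y a - y b) / (y a - y b))"
proof -
  let ?t = "\<lambda>s. col (sorted_list_of_set (visible p) ! (s - 1))"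
  have cv: "map (colvar M k LI (u(p + 1 := x)) vI vII vM p) [1..<Suc (ncol p)]
    = cvars p (map x [1..<Suc (k (p + 1))])"
    by (intro nth_equalityI)
      (auto simp: ncols_def colvar_def cvars_def mcol_def nth_append Suc_diff_le simp del: upt_Suc)
  have tw: "map ?t [1..<Suc (ncol p)] = top_word p (inner_word (p + 1))"
    using top_word_inner[OF p] card_visible[OF p]
    by (intro nth_equalityI) (auto simp del: upt_Suc)
  have A: "{s \<in> {1..ncol p}. ?t s \<noteq> p + 1} = Itilde M LI LII LM col p"
    using Itilde_eq[of p] card_visible[OF p] by simp
  have "card {s \<in> {1..ncol p}. ?t s \<noteq> p + 1} = length (filter (\<lambda>c. c \<noteq> p + 1) (map ?t [1..<Suc
    (ncol p)]))"
    by (simp add: filter_map o_def distinct_card[symmetric] atLeastLessThanSuc_atLeastAtMost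
      conj_commute del: upt_Suc)
  also have "\<dots> = k p"
    unfolding tw using filter_top_word[OF p] length_inner_word[OF p] by simp
  finally have "card {s \<in> {1..ncol p}. ?t s \<noteq> p + 1} = k p" .
  from wterm_explicit[OF this, of y "colvar M k LI (u(p + 1 := x)) vI vII vM p"]
  show ?thesis unfolding A tw cv stack_weight_def .
qed

text \<open>In layer \<open>M\<close> every coordinate is visible, so relabelling only subtracts the
  offset. The last layer can thus share the formula of the others, with its shifted positions
  recovered at the end.\<close>

lemma Itilde_last:
  assumes "a \<in> {1..k M}"
  shows "nth_smallest (Iat M) a = offI LI M + nth_smallest (Itilde M LI LII LM col M) a"
proof -
  have M: "M \<in> {1..M}" using M_pos by simp
  have "card (visible M) = LM" using card_visible[OF M] by (simp add: ncols_def)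
  hence It: "Itilde M LI LII LM col M = {s \<in> {1..LM}. col (offI LI M + s) \<noteq> M + 1}"
    unfolding Itilde_eq sorted_visible_last by (auto simp del: upt_Suc)
  have "visible M = (+) (offI LI M) ` {1..LM}"
    using arg_cong[OF sorted_visible_last, of set] by
      (simp add: atLeastLessThanSuc_atLeastAtMost del: upt_Suc)
  hence I: "Iat M = (+) (offI LI M) ` Itilde M LI LII LM col M"
    using Iset_subset_visible[of M] by (simp only: It Compr_image_eq)
  have "card (Itilde M LI LII LM col M) = k M"
    using card_Iset[OF M] unfolding I by (simp add: card_image)
  moreover have "finite (Itilde M LI LII LM col M)" unfolding It by simp
  ultimately show ?thesis unfolding I using assms by (intro nth_smallest_shift) auto
qed

lemma generic_identity:
  "partition_function M k LI LII LM q u vI vII vM col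
    = weight_function M k LI LII LM q u vI vII vM col"
proof -
  let ?perms = "\<lambda>p. {\<pi>. \<pi> permutes {1..k p}}"
  \<comment> \<open>Layer \<open>M\<close> has no inner columns: \<open>Iset (M + 1)\<close> is
    empty, and the list built from \<open>u (M + 1)\<close> is a placeholder.\<close>
  have top: "stack M (urow (M + 1)) [] = stack M (map (u (M + 1)) [1..<Suc (k (M + 1))]) (inner_word
    (M + 1))"
    by (simp add: urow_def Iset_def Ihat_def del: upt_Suc)
  have last: "{1..M} = insert M {1..M - 1}" using M_pos by auto
  show ?thesis
    unfolding partition_function_eq_stack top stack_expansion[OF order.refl] weight_function_def
      Let_def
  proof (intro sum.cong refl)
    fix \<sigma> :: "nat \<Rightarrow> nat \<Rightarrow> nat"
    let ?us = "\<lambda>p a. u p (\<sigma> p a)"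
    have low: "stack_weight p (?us p) (if p = M then u (M + 1) else ?us (p + 1)) =
      (\<Prod>a\<in>{1..k p}. (\<Prod>i\<in>{1..nth_smallest
        (Itilde M LI LII LM col p) a - 1}. ?us p a - mcol k LI vI ?us vII p i)
        * ((1 - q) * ?us p a)
        * (\<Prod>i\<in>{nth_smallest (Itilde M LI LII LM col p) a + 1..ncol p}. ?us p a - q
          * mcol k LI vI ?us vII p i))
      * (\<Prod>(a, b)\<in>{(a, b) \<in> {1..k p} \<times> {1..k p}. a < b}. (q * ?us p a - ?us p b) /
        (?us p a - ?us p b))"
      if "p \<in> {1..M - 1}" for p
    proof -
      have p: "p \<in> {1..M}" "p < M" "p \<noteq> M" using that M_pos by auto
      have "colvar M k LI (u(p + 1 := ?us (p + 1))) vI vII vM p = mcol k LI vI ?us vII p"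
        using p by (auto simp: colvar_def mcol_def fun_eq_iff)
      thus ?thesis using p by (simp only: stack_weight_explicit if_False)
    qed
    have up: "stack_weight M (?us M) (if M = M then u (M + 1) else ?us (M + 1)) =
      (\<Prod>a\<in>{1..k M}. (\<Prod>i\<in>{1..nth_smallest (Iat M) a - 1 - offI LI M}. ?us M a - vM i)
        * ((1 - q) * ?us M a)
        * (\<Prod>i\<in>{nth_smallest (Iat M) a + 1 - offI LI M..LM}. ?us M a - q * vM i))
      * (\<Prod>(a, b)\<in>{(a, b) \<in> {1..k M} \<times> {1..k M}. a < b}. (q * ?us M a - ?us M b) /
        (?us M a - ?us M b))"
    proof -
      have "colvar M k LI x vI vII vM M = vM" for x by (auto simp: colvar_def fun_eq_iff)
      moreover have "ncol M = LM" by (simp add: ncols_def)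
      moreover have "M \<in> {1..M}" using M_pos by simp
      ultimately show ?thesis
        by (simp add: stack_weight_explicit Itilde_last cong: prod.cong_simp)
    qed
    have "(\<Prod>p\<in>{1..M}. stack_weight p (?us p) (if p = M then u (M + 1) else ?us (p + 1)))
      = (\<Prod>p\<in>{1..M - 1}. stack_weight p (?us p) (if p = M then u (M + 1) else ?us (p + 1)))
        * stack_weight M (?us M) (if M = M then u (M + 1) else ?us (M + 1))"
      unfolding last by (subst prod.insert) (use M_pos in \<open>auto simp: mult_ac\<close>)
    also have "(\<Prod>p\<in>{1..M - 1}. stack_weight p (?us p) (if p = M then u (M + 1) else ?us (p + 1)))
      = (\<Prod>p\<in>{1..M - 1}. (\<Prod>a\<in>{1..k p}. (\<Prod>i\<in>{1..nth_smallest
        (Itilde M LI LII LM col p) a - 1}. ?us p a - mcol k LI vI ?us vII p i)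
        * ((1 - q) * ?us p a)
        * (\<Prod>i\<in>{nth_smallest (Itilde M LI LII LM col p) a + 1..ncol p}. ?us p a - q
          * mcol k LI vI ?us vII p i))
      * (\<Prod>(a, b)\<in>{(a, b) \<in> {1..k p} \<times> {1..k p}. a < b}. (q * ?us p a - ?us p b) /
        (?us p a - ?us p b)))"
      by (rule prod.cong[OF refl low])
    finally show "(\<Prod>p\<in>{1..M}. stack_weight p (?us p) (if p = M then u (M + 1) else ?us (p + 1))) =
      (\<Prod>p\<in>{1..M - 1}. (\<Prod>a\<in>{1..k p}. (\<Prod>i\<in>{1..nth_smallest
        (Itilde M LI LII LM col p) a - 1}. ?us p a - mcol k LI vI ?us vII p i)
        * ((1 - q) * ?us p a)
        * (\<Prod>i\<in>{nth_smallest (Itilde M LI LII LM col p) a + 1..ncol p}. ?us p a - q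
          * mcol k LI vI ?us vII p i))
      * (\<Prod>(a, b)\<in>{(a, b) \<in> {1..k p} \<times> {1..k p}. a < b}. (q * ?us p a - ?us p b) /
        (?us p a - ?us p b)))
      * (\<Prod>a\<in>{1..k M}. (\<Prod>i\<in>{1..nth_smallest (Iat M) a - 1 - offI LI M}. ?us M a - vM i)
        * ((1 - q) * ?us M a)
        * (\<Prod>i\<in>{nth_smallest (Iat M) a + 1 - offI LI M..LM}. ?us M a - q * vM i))
      * (\<Prod>(a, b)\<in>{(a, b) \<in> {1..k M} \<times> {1..k M}. a < b}. (q * ?us M a - ?us M b) /
        (?us M a - ?us M b))"
      unfolding up by (simp only: mult.assoc)
  qed
qed

end

section \<open>Arbitrary parameters\<close>

text \<open>No degree is tracked here, unlike in \<open>poly_below\<close>, since the two sides will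
  be compared at infinitely many values of \<open>q\<close>.\<close>

definition polyfun :: "('a::field \<Rightarrow> 'a) \<Rightarrow> bool" where
  "polyfun f \<longleftrightarrow> (\<exists>p. \<forall>x. f x = poly p x)"

lemma polyfun_const: "polyfun (\<lambda>_. c)"
  unfolding polyfun_def by (rule exI[of _ "[:c:]"]) simp

lemma polyfun_id: "polyfun (\<lambda>x. x)"
  unfolding polyfun_def by (rule exI[of _ "[:0, 1:]"]) simp

lemma polyfun_add: "polyfun f \<Longrightarrow> polyfun g \<Longrightarrow> polyfun (\<lambda>x. f x + g x)"
  unfolding polyfun_def by (metis poly_add)

lemma polyfun_diff: "polyfun f \<Longrightarrow> polyfun g \<Longrightarrow> polyfun (\<lambda>x. f x - g x)"
  unfolding polyfun_def by (metis poly_diff)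

lemma polyfun_mult: "polyfun f \<Longrightarrow> polyfun g \<Longrightarrow> polyfun (\<lambda>x. f x * g x)"
  unfolding polyfun_def by (metis poly_mult)

lemma polyfun_divide: "polyfun f \<Longrightarrow> polyfun (\<lambda>x. f x / c)"
  using polyfun_mult[OF _ polyfun_const[of "inverse c"]] by (simp add: divide_inverse)

lemma polyfun_sum: "(\<And>a. a \<in> A \<Longrightarrow> polyfun (\<lambda>x. f x a)) \<Longrightarrow> polyfun (\<lambda>x. \<Sum>a\<in>A. f x a)"
  by (induction A rule: infinite_finite_induct) (auto intro: polyfun_const polyfun_add)

lemma polyfun_prod: "(\<And>a. a \<in> A \<Longrightarrow> polyfun (\<lambda>x. f x a)) \<Longrightarrow> polyfun (\<lambda>x. \<Prod>a\<in>A. f x a)"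
  by (induction A rule: infinite_finite_induct) (auto intro: polyfun_const polyfun_mult)

lemma polyfun_case_prod: "polyfun (\<lambda>x. f x (fst z) (snd z)) \<Longrightarrow> polyfun (\<lambda>x. case z of
  (a, b) \<Rightarrow> f x a b)"
  by (simp add: case_prod_unfold)

lemmas polyfun_intros = polyfun_const polyfun_id polyfun_case_prod polyfun_sum polyfun_prod
  polyfun_add polyfun_diff polyfun_mult polyfun_divide

lemma polyfun_partition_function:
  "polyfun (\<lambda>q. partition_function M k LI LII LM q u vI vII vM col)"
  unfolding partition_function_def Rcoeff_def by (intro polyfun_intros)

text \<open>Every denominator is a difference of \<open>u\<close>-variables and constant in
  \<open>q\<close>.\<close>

lemma polyfun_weight_function:
  "polyfun (\<lambda>q. weight_function M k LI LII LM q u vI vII vM col)"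
  unfolding weight_function_def Let_def by (intro polyfun_intros)

lemma polyfun_eqI:
  assumes "polyfun f" "polyfun g" "finite S" "\<And>x. x \<notin> S \<Longrightarrow> f x = g x"
  shows "f x = g (x :: 'a::field_char_0)"
proof -
  obtain p p' where p: "\<And>x. f x = poly p x" "\<And>x. g x = poly p' x"
    using assms unfolding polyfun_def by blast
  have "infinite (- S)" using assms(3) infinite_UNIV_char_0 finite_compl by blast
  moreover have "- S \<subseteq> {x. poly (p - p') x = 0}" using assms(4) p by auto
  ultimately have "p - p' = 0" using poly_roots_finite finite_subset by blast
  thus ?thesis using p by simp
qed

theorem theorem2p9:
  fixes M LM :: nat and k LI LII :: "nat \<Rightarrow> nat" and col :: "nat \<Rightarrow> nat"
    and q :: "'a::field_char_0"
    and u vI vII :: "nat \<Rightarrow> nat \<Rightarrow> 'a" and vM :: "nat \<Rightarrow> 'a"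
  assumes "M \<ge> 1"
    and "q \<noteq> 0"
    and "\<And>p. p \<in> {1..M} \<Longrightarrow> inj_on (u p) {1..k p}"
    and "admissible M k LI LII LM col"
  shows "partition_function M k LI LII LM q u vI vII vM col
       = weight_function M k LI LII LM q u vI vII vM col"
proof (rule polyfun_eqI[OF polyfun_partition_function polyfun_weight_function])
  let ?T = "SIGMA p:{1..M}. {1..k p} \<times> {1..k p}"
  \<comment> \<open>Outside these ratios no two row variables of a layer are related by the factor
    \<open>x\<close>, so the generic case applies.\<close>
  let ?S = "(\<lambda>(p, a, b). u p a / u p b) ` ?T"
  show "finite ?S" by simp
  fix x assume x: "x \<notin> ?S"
  have "u p a \<noteq> x * u p b" if "p \<in> {1..M}" "a \<in> {1..k p}" "b \<in> {1..k p}" "a \<noteq> b" for p a b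
  proof
    assume eq: "u p a = x * u p b"
    have "u p a \<noteq> u p b" using assms(3)[OF that(1)] that by (auto dest: inj_onD)
    \<comment> \<open>If \<open>u p b\<close> were zero, then \<open>u p a\<close> would be zero
      too, against distinctness; so the equation can be solved for \<open>x\<close>.\<close>
    hence "u p b \<noteq> 0" using eq by auto
    hence "x = u p a / u p b" using eq by simp
    moreover have "(p, a, b) \<in> ?T" using that by simp
    ultimately show False using x by force
  qed
  then interpret generic_layered_model M k LI LII LM x u vI vII vM col
    using assms by unfold_locales (auto simp: admissible_def)
  show "partition_function M k LI LII LM x u vI vII vM col
    = weight_function M k LI LII LM x u vI vII vM col"
    by (rule generic_identity)
qed

end
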